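(* Let $N\ge 2$, $s\in(0,1)$, and let $\Omega\subset\mathbb{R}^N$ be a bounded domain with $C^2$ boundary. For $\rho\in L^\infty(\Omega)$ let $G_\rho$, $\widetilde{\mu}_k(\rho)$ ($k=1,2,3,\ldots$) and $\widetilde{u}_\rho$ be as defined in the context. Then: (i) the map $\rho\mapsto G_\rho$ is sequentially weakly* continuous from $L^\infty(\Omega)$ to $\mathcal{L}(H_0^s(\Omega),H_0^s(\Omega))$ endowed with the (operator) norm topology; that is, if $\rho_n\to\rho$ weakly* in $L^\infty(\Omega)$, then $G_{\rho_n}\to G_\rho$ in operator norm; (ii) for every $k=1,2,3,\ldots$ the map $\rho\mapsto\widetilde{\mu}_k(\rho)$ is sequentially weakly* continuous on $L^\infty(\Omega)$; (iii) the map $\rho\mapsto\widetilde{\mu}_1(\rho)\,\widetilde{u}_\rho$ is sequentially weakly* continuous from $L^\infty(\Omega)$ to $H_0^s(\Omega)$ endowed with the norm topology. In particular, for any sequence $\{\rho_n\}$ weakly* convergent to $\eta\in L^\infty(\Omega)$ with $\widetilde{\mu}_1(\eta)>0$, the sequence $\{\widetilde{u}_{\rho_n}\}$ converges to $\widetilde{u}_\eta$ in $H_0^s(\Omega)$.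
   Context: $H_0^s(\Omega)=\{u\in H^s(\mathbb{R}^N): u=0 \text{ a.e. in } \mathbb{R}^N\setminus\Omega\}$ is a Hilbert space with inner product $\langle u,v\rangle_{H_0^s(\Omega)}=\int_{\mathbb{R}^{2N}}\frac{(u(x)-u(y))(v(x)-v(y))}{|x-y|^{N+2s}}\,dx\,dy$ and associated norm. For $\rho\in L^\infty(\Omega)$, $G_\rho:H_0^s(\Omega)\to H_0^s(\Omega)$ is the bounded linear operator such that $G_\rho(f)$ is the unique element of $H_0^s(\Omega)$ with $\langle G_\rho(f),\varphi\rangle_{H_0^s(\Omega)}=\int_\Omega\rho f\varphi\,dx$ for all $\varphi\in H_0^s(\Omega)$ (i.e. the weak solution $u$ of $(-\Delta)^su=\rho f$ in $\Omega$, $u=0$ in $\Omega^c=\mathbb{R}^N\setminus\Omega$, with normalization constant of the fractional Laplacian equal to 1). It is self-adjoint and compact. If $|\{\rho>0\}|>0$ (where $\{\rho>0\}=\{x\in\Omega:\rho(x)>0\}$ and $|\cdot|$ is Lebesgue measure), $\mu_1(\rho)\ge\mu_2(\rho)\ge\cdots>0$ denotes the sequence of all positive eigenvalues of $G_\rho$, repeated according to multiplicity; equivalently $\mu_k(\rho)=\max_{F_k}\min_{f\in F_k,\,f\ne0}\frac{\int_\Omega\rho f^2\,dx}{\|f\|^2_{H_0^s(\Omega)}}$, with $F_k$ ranging over the $k$-dimensional subspaces of $H_0^s(\Omega)$. The eigenvalue $\mu_1(\rho)$ is known to be simple with eigenfunctions of one sign in $\Omega$; $u_\rho$ denotes the positive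 eigenfunction of $G_\rho$ for $\mu_1(\rho)$ normalized by $\|u_\rho\|_{H_0^s(\Omega)}=1$. Set $\widetilde{\mu}_k(\rho)=\mu_k(\rho)$ and $\widetilde{u}_\rho=u_\rho$ if $|\{\rho>0\}|>0$, and $\widetilde{\mu}_k(\rho)=0$ and $\widetilde{u}_\rho=0$ if $|\{\rho>0\}|=0$. The weak* topology on $L^\infty(\Omega)$ is that of the duality with $L^1(\Omega)$. *)

theory Defs
  imports "HOL-Analysis.Analysis"
begin

text \<open>
  Elements of \<open>L\<^sup>\<infinity>(\<Omega>)\<close> and of the Sobolev spaces are represented by Lebesgue measurable
  functions; equality of elements is equality almost everywhere. All quantities below depend only
  on the almost-everywhere class of the functions involved.
\<close>

subsection \<open>Bounded domains with twice continuously differentiable boundary\<close>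

definition C2_function :: "('a::euclidean_space \<Rightarrow> real) \<Rightarrow> bool" where
  "C2_function f \<longleftrightarrow>
     (\<exists>(grad :: 'a \<Rightarrow> 'a) (hess :: 'a \<Rightarrow> 'a \<Rightarrow>\<^sub>L 'a).
        (\<forall>x. (f has_derivative (\<lambda>h. grad x \<bullet> h)) (at x)) \<and>
        (\<forall>x. (grad has_derivative blinfun_apply (hess x)) (at x)) \<and>
        continuous_on UNIV hess)"

text \<open>
  Near each boundary point, \<open>\<Omega>\<close> is the part of a ball strictly above the graph of a \<open>C\<^sup>2\<close> function
  \<open>\<gamma>\<close> of the \<open>N - 1\<close> coordinates orthogonal to a unit vector \<open>e\<close>. A \<open>C\<^sup>2\<close> function on the hyperplane
  orthogonal to \<open>e\<close> is the same thing as the restriction to it of a \<open>C\<^sup>2\<close> function on the whole space,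
  and \<open>x - (x \<bullet> e) e\<close> is the orthogonal projection of \<open>x\<close> to that hyperplane.
\<close>

definition C2_boundary :: "'a::euclidean_space set \<Rightarrow> bool" where
  "C2_boundary \<Omega> \<longleftrightarrow>
     (\<forall>z \<in> frontier \<Omega>. \<exists>e r \<gamma>. norm e = 1 \<and> 0 < r \<and> C2_function \<gamma> \<and>
        (\<forall>x \<in> ball z r. x \<in> \<Omega> \<longleftrightarrow> \<gamma> (x - (x \<bullet> e) *\<^sub>R e) < x \<bullet> e))"

definition bounded_C2_domain :: "'a::euclidean_space set \<Rightarrow> bool" where
  "bounded_C2_domain \<Omega> \<longleftrightarrow>
     open \<Omega> \<and> connected \<Omega> \<and> \<Omega> \<noteq> {} \<and> bounded \<Omega> \<and> C2_boundary \<Omega>"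


subsection \<open>Essentially bounded functions and weak* convergence of sequences\<close>

text \<open>Values outside \<open>\<Omega>\<close> are unconstrained and never used.\<close>

definition Linf :: "'a::euclidean_space set \<Rightarrow> ('a \<Rightarrow> real) set" where
  "Linf \<Omega> = {\<rho>. \<rho> \<in> borel_measurable (lebesgue_on \<Omega>) \<and>
                (\<exists>C. AE x in lebesgue_on \<Omega>. \<bar>\<rho> x\<bar> \<le> C)}"

definition weakstar_converges ::
    "'a::euclidean_space set \<Rightarrow> (nat \<Rightarrow> 'a \<Rightarrow> real) \<Rightarrow> ('a \<Rightarrow> real) \<Rightarrow> bool" where
  "weakstar_converges \<Omega> \<rho>s \<rho> \<longleftrightarrow>
     (\<forall>n. \<rho>s n \<in> Linf \<Omega>) \<and> \<rho> \<in> Linf \<Omega> \<and>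
     (\<forall>g. integrable (lebesgue_on \<Omega>) g \<longrightarrow>
        (\<lambda>n. LINT x|lebesgue_on \<Omega>. \<rho>s n x * g x) \<longlonglongrightarrow> (LINT x|lebesgue_on \<Omega>. \<rho> x * g x))"


subsection \<open>Fractional Sobolev spaces\<close>

text \<open>
  Double integrals over \<open>\<real>\<^sup>2\<^sup>N\<close> are Lebesgue integrals on the product type. On the diagonal (a null
  set) the integrands have the value \<open>0\<close>.
\<close>

definition Hs :: "real \<Rightarrow> ('a::euclidean_space \<Rightarrow> real) set" where
  "Hs s = {u. u \<in> borel_measurable lebesgue \<and>
              integrable lebesgue (\<lambda>x. (u x)\<^sup>2) \<and>
              integrable lebesgue
                (\<lambda>(x :: 'a, y :: 'a). (u x - u y)\<^sup>2 / norm (x - y) powr (real DIM('a) + 2 * s))}"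

definition H0s :: "real \<Rightarrow> 'a::euclidean_space set \<Rightarrow> ('a \<Rightarrow> real) set" where
  "H0s s \<Omega> = {u \<in> Hs s. AE x in lebesgue. x \<notin> \<Omega> \<longrightarrow> u x = 0}"

definition H0s_inner :: "real \<Rightarrow> ('a::euclidean_space \<Rightarrow> real) \<Rightarrow> ('a \<Rightarrow> real) \<Rightarrow> real" where
  "H0s_inner s u v =
     integral\<^sup>L lebesgue
       (\<lambda>(x :: 'a, y :: 'a).
          (u x - u y) * (v x - v y) / norm (x - y) powr (real DIM('a) + 2 * s))"

definition H0s_norm :: "real \<Rightarrow> ('a::euclidean_space \<Rightarrow> real) \<Rightarrow> real" where
  "H0s_norm s u = sqrt (H0s_inner s u u)"

text \<open>The operator norm takes the value \<open>\<infinity>\<close> on unbounded operators.\<close>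

definition H0s_opnorm ::
    "real \<Rightarrow> 'a::euclidean_space set \<Rightarrow> (('a \<Rightarrow> real) \<Rightarrow> ('a \<Rightarrow> real)) \<Rightarrow> ennreal" where
  "H0s_opnorm s \<Omega> T = (SUP f \<in> {f \<in> H0s s \<Omega>. H0s_norm s f \<le> 1}. ennreal (H0s_norm s (T f)))"


subsection \<open>The solution operator and its positive eigenvalues\<close>

text \<open>
  The chosen function is a representative of the weak solution, which is unique up to equality
  almost everywhere.
\<close>

definition G :: "real \<Rightarrow> 'a::euclidean_space set \<Rightarrow> ('a \<Rightarrow> real) \<Rightarrow> ('a \<Rightarrow> real) \<Rightarrow> 'a \<Rightarrow> real" where
  "G s \<Omega> \<rho> f = (SOME u. u \<in> H0s s \<Omega> \<and>
     (\<forall>\<phi> \<in> H0s s \<Omega>. H0s_inner s u \<phi> = (LINT x|lebesgue_on \<Omega>. \<rho> x * f x * \<phi> x)))"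

definition G_eigenspace ::
    "real \<Rightarrow> 'a::euclidean_space set \<Rightarrow> ('a \<Rightarrow> real) \<Rightarrow> real \<Rightarrow> ('a \<Rightarrow> real) set" where
  "G_eigenspace s \<Omega> \<rho> l = {f \<in> H0s s \<Omega>. AE x in lebesgue. G s \<Omega> \<rho> f x = l * f x}"

text \<open>
  \<open>V\<close> has a basis of \<open>d\<close> elements, where linear independence and spanning are understood modulo
  equality almost everywhere. In particular dimension \<open>0\<close> means that all elements of \<open>V\<close> vanish
  almost everywhere.
\<close>

definition has_ae_dim :: "('a::euclidean_space \<Rightarrow> real) set \<Rightarrow> nat \<Rightarrow> bool" where
  "has_ae_dim V d \<longleftrightarrow>
     (\<exists>b :: nat \<Rightarrow> 'a \<Rightarrow> real.
        (\<forall>i<d. b i \<in> V) \<and>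
        (\<forall>c :: nat \<Rightarrow> real. (AE x in lebesgue. (\<Sum>i<d. c i * b i x) = 0) \<longrightarrow> (\<forall>i<d. c i = 0)) \<and>
        (\<forall>f \<in> V. \<exists>c :: nat \<Rightarrow> real. AE x in lebesgue. f x = (\<Sum>i<d. c i * b i x)))"

text \<open>
  \<open>m 1 \<ge> m 2 \<ge> \<dots> > 0\<close> lists all positive eigenvalues, each as often as its multiplicity. A positive
  number that is not an eigenvalue has an eigenspace of dimension \<open>0\<close> and so does not occur;
  the value \<open>m 0\<close> is irrelevant.
\<close>

definition lists_pos_eigenvalues ::
    "real \<Rightarrow> 'a::euclidean_space set \<Rightarrow> ('a \<Rightarrow> real) \<Rightarrow> (nat \<Rightarrow> real) \<Rightarrow> bool" where
  "lists_pos_eigenvalues s \<Omega> \<rho> m \<longleftrightarrow>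
     (\<forall>k\<ge>1. 0 < m k) \<and>
     (\<forall>j\<ge>1. \<forall>k\<ge>j. m k \<le> m j) \<and>
     (\<forall>l>0. finite {k. 1 \<le> k \<and> m k = l} \<and>
             has_ae_dim (G_eigenspace s \<Omega> \<rho> l) (card {k. 1 \<le> k \<and> m k = l}))"

definition mu :: "real \<Rightarrow> 'a::euclidean_space set \<Rightarrow> ('a \<Rightarrow> real) \<Rightarrow> nat \<Rightarrow> real" where
  "mu s \<Omega> \<rho> = (SOME m. lists_pos_eigenvalues s \<Omega> \<rho> m)"

definition u_pos :: "real \<Rightarrow> 'a::euclidean_space set \<Rightarrow> ('a \<Rightarrow> real) \<Rightarrow> 'a \<Rightarrow> real" where
  "u_pos s \<Omega> \<rho> = (SOME u. u \<in> G_eigenspace s \<Omega> \<rho> (mu s \<Omega> \<rho> 1) \<and>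
     (AE x in lebesgue_on \<Omega>. 0 < u x) \<and> H0s_norm s u = 1)"

definition mu_tilde :: "real \<Rightarrow> 'a::euclidean_space set \<Rightarrow> ('a \<Rightarrow> real) \<Rightarrow> nat \<Rightarrow> real" where
  "mu_tilde s \<Omega> \<rho> k = (if emeasure lebesgue {x \<in> \<Omega>. 0 < \<rho> x} > 0 then mu s \<Omega> \<rho> k else 0)"

definition u_tilde :: "real \<Rightarrow> 'a::euclidean_space set \<Rightarrow> ('a \<Rightarrow> real) \<Rightarrow> 'a \<Rightarrow> real" where
  "u_tilde s \<Omega> \<rho> = (if emeasure lebesgue {x \<in> \<Omega>. 0 < \<rho> x} > 0 then u_pos s \<Omega> \<rho> else (\<lambda>_. 0))"

end

theory Submission
  imports Defs "HOL-Library.Function_Algebras"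
begin

text \<open>All three statements come from one estimate. With \<open>B\<close> the inner product of \<open>H0s\<close> and
\<open>Q\<^sub>\<rho>(f, g) = \<integral>\<^sub>\<Omega> \<rho> f g\<close>, the operator \<open>G\<^sub>\<rho>\<close> is determined by \<open>B (G\<^sub>\<rho> f) g = Q\<^sub>\<rho>(f, g)\<close>, and weak*
convergence \<open>\<rho>\<^sub>n \<rightarrow> \<rho>\<close> implies \<open>\<bar>Q\<^bsub>\<rho>\<^sub>n\<^esub>(f, f) - Q\<^sub>\<rho>(f, f)\<bar> \<le> \<delta>\<^sub>n B f f\<close> with \<open>\<delta>\<^sub>n \<rightarrow> 0\<close>
(\<open>weakstar_form_converges\<close>). Two facts carry this estimate. Weakly* convergent sequences are bounded
(\<open>uniform_boundedness_Linf\<close>, by a gliding hump). And a function of finite energy is close in \<open>L\<^sup>2\<close>,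
relative to its energy, to its averages over cubes of a small fixed size (\<open>cube_fluctuation\<close>); so
\<open>\<integral> (\<rho>\<^sub>n - \<rho>) f\<^sup>2\<close> is controlled by the finitely many numbers \<open>\<integral>\<^sub>Q (\<rho>\<^sub>n - \<rho>)\<close>, each of which
tends to \<open>0\<close> (\<open>form_uniformly_small\<close>).

Statement (i) follows from the estimate by polarization.

For (ii), the same averages give the compactness of \<open>Q\<^sub>\<rho>\<close>: \<open>Q\<^sub>\<rho>(f, f) \<le> \<epsilon> B f f + \<Sum>\<^sub>i (L\<^sub>i f)\<^sup>2\<close>
with finitely many bounded functionals \<open>L\<^sub>i\<close>. In a complete space this yields maximizers of
\<open>Q\<^sub>\<rho>(f, f) / B f f\<close>, and successive maximization on orthogonal complements produces the eigenvalues
(\<open>spectral_seq_exists\<close>). It never stops when \<open>\<rho> > 0\<close> on a set of positive measure, because disjointly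
supported bumps make \<open>Q\<^sub>\<rho>\<close> positive on spaces of every dimension (\<open>positive_directions\<close>). Comparing
\<open>k\<close>-dimensional spans shows that the \<open>k\<close>-th eigenvalues of two forms within \<open>\<delta> B\<close> of each other
differ by at most \<open>\<delta>\<close> (\<open>spectral_seq_compare\<close>).

For (iii), the absolute value of a maximizer is a maximizer, since taking absolute values does not
increase the energy. A strong maximum principle (\<open>strong_maximum_principle\<close>) then makes first
eigenfunctions strictly positive or strictly negative, and two orthogonal ones cannot coexist: a
combination with vanishing integral would have no sign. Hence there is a gap between the first two
eigenvalues. The positive first eigenfunction for \<open>\<rho>\<^sub>n\<close> almost maximizes \<open>Q\<^sub>\<rho>\<close>, and the gap forces it
to be close to the one for \<open>\<rho>\<close> (\<open>near_maximizer_close\<close>).\<close>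

section \<open>Symmetric forms on a real vector space\<close>

text \<open>Forms live on a subspace, and only their values there matter: the function spaces below are proper
subspaces of the space of all functions. No definiteness is assumed, as functions that vanish almost
everywhere are null vectors.\<close>

locale sym_form =
  fixes V :: "'v::real_vector set" and A :: "'v \<Rightarrow> 'v \<Rightarrow> real"
  assumes V: "subspace V"
    and add_left: "\<lbrakk>f \<in> V; g \<in> V; h \<in> V\<rbrakk> \<Longrightarrow> A (f + g) h = A f h + A g h"
    and scale_left: "\<lbrakk>f \<in> V; g \<in> V\<rbrakk> \<Longrightarrow> A (c *\<^sub>R f) g = c * A f g"
    and commute: "\<lbrakk>f \<in> V; g \<in> V\<rbrakk> \<Longrightarrow> A f g = A g f"
begin

lemma mem_add: "f \<in> V \<Longrightarrow> g \<in> V \<Longrightarrow> f + g \<in> V"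
  and mem_diff: "f \<in> V \<Longrightarrow> g \<in> V \<Longrightarrow> f - g \<in> V"
  and mem_scale: "f \<in> V \<Longrightarrow> c *\<^sub>R f \<in> V"
  and mem_zero: "0 \<in> V"
  and mem_sum: "(\<And>i. i \<in> I \<Longrightarrow> h i \<in> V) \<Longrightarrow> sum h I \<in> V"
  using V by (auto intro: subspace_add subspace_diff subspace_mul subspace_0 subspace_sum)

lemmas mem = mem_add mem_diff mem_scale mem_zero mem_sum

lemma add_right: "\<lbrakk>f \<in> V; g \<in> V; h \<in> V\<rbrakk> \<Longrightarrow> A h (f + g) = A h f + A h g"
  by (metis add_left commute mem_add)

lemma scale_right: "\<lbrakk>f \<in> V; g \<in> V\<rbrakk> \<Longrightarrow> A f (c *\<^sub>R g) = c * A f g"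
  by (metis scale_left commute mem_scale)

lemma diff_left: "\<lbrakk>f \<in> V; g \<in> V; h \<in> V\<rbrakk> \<Longrightarrow> A (f - g) h = A f h - A g h"
  using add_left[of f "(-1) *\<^sub>R g" h] scale_left[of g h "-1"] mem_scale[of g "-1"] by simp

lemma diff_right: "\<lbrakk>f \<in> V; g \<in> V; h \<in> V\<rbrakk> \<Longrightarrow> A h (f - g) = A h f - A h g"
  by (metis diff_left commute mem_diff)

lemma zero_left: "f \<in> V \<Longrightarrow> A 0 f = 0"
  using scale_left[of f f 0] by simp

lemma sum_left: "(\<And>i. i \<in> I \<Longrightarrow> h i \<in> V) \<Longrightarrow> f \<in> V \<Longrightarrow> A (sum h I) f = (\<Sum>i\<in>I. A (h i) f)"
  by (induction I rule: infinite_finite_induct) (auto simp: zero_left add_left mem)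

lemma sum_right:
  assumes "\<And>i. i \<in> I \<Longrightarrow> h i \<in> V" "f \<in> V"
  shows "A f (sum h I) = (\<Sum>i\<in>I. A f (h i))"
proof -
  have "A f (sum h I) = A (sum h I) f" using assms by (intro commute) (auto intro: mem)
  also have "\<dots> = (\<Sum>i\<in>I. A (h i) f)" using assms by (rule sum_left)
  also have "\<dots> = (\<Sum>i\<in>I. A f (h i))" using assms by (intro sum.cong refl commute) auto
  finally show ?thesis .
qed

lemma add_add: "\<lbrakk>f \<in> V; g \<in> V\<rbrakk> \<Longrightarrow> A (f + g) (f + g) = A f f + 2 * A f g + A g g"
  by (simp add: add_left add_right mem commute[of g f])

lemma diff_diff: "\<lbrakk>f \<in> V; g \<in> V\<rbrakk> \<Longrightarrow> A (f - g) (f - g) = A f f - 2 * A f g + A g g"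
  by (simp add: diff_left diff_right mem commute[of g f])

lemma scale_scale: "f \<in> V \<Longrightarrow> A (c *\<^sub>R f) (c *\<^sub>R f) = c\<^sup>2 * A f f"
  by (simp add: scale_left scale_right mem power2_eq_square)

lemma sum_diag:
  assumes "finite I" "\<And>i. i \<in> I \<Longrightarrow> e i \<in> V"
    and "\<And>i j. \<lbrakk>i \<in> I; j \<in> I; i \<noteq> j\<rbrakk> \<Longrightarrow> A (e i) (e j) = 0"
  shows "A (\<Sum>i\<in>I. c i *\<^sub>R e i) (\<Sum>i\<in>I. c i *\<^sub>R e i) = (\<Sum>i\<in>I. (c i)\<^sup>2 * A (e i) (e i))"
proof -
  have "A (\<Sum>i\<in>I. c i *\<^sub>R e i) (\<Sum>i\<in>I. c i *\<^sub>R e i) = (\<Sum>i\<in>I. \<Sum>j\<in>I. c i * (c j * A (e i) (e j)))"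
    (is "A ?s ?s = _")
  proof -
    have s: "?s \<in> V" using assms by (auto intro: mem)
    have "A ?s ?s = (\<Sum>i\<in>I. c i * A (e i) ?s)" using assms s by (simp add: sum_left[where f = ?s] mem scale_left)
    also have "\<dots> = (\<Sum>i\<in>I. \<Sum>j\<in>I. c i * (c j * A (e i) (e j)))"
      using assms by (intro sum.cong refl) (simp add: sum_right mem scale_right sum_distrib_left)
    finally show ?thesis .
  qed
  also have "\<dots> = (\<Sum>i\<in>I. (c i)\<^sup>2 * A (e i) (e i))"
  proof (rule sum.cong[OF refl])
    fix i assume i: "i \<in> I"
    have "(\<Sum>j\<in>I. c i * (c j * A (e i) (e j))) = (\<Sum>j\<in>I. if j = i then c i * (c i * A (e i) (e i)) else 0)"
      using assms(3) i by (intro sum.cong) auto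
    then show "(\<Sum>j\<in>I. c i * (c j * A (e i) (e j))) = (c i)\<^sup>2 * A (e i) (e i)"
      using assms(1) i by (simp add: power2_eq_square)
  qed
  finally show ?thesis .
qed

lemma sym_form_subspace: "subspace W \<Longrightarrow> W \<subseteq> V \<Longrightarrow> sym_form W A"
  by unfold_locales (auto intro: add_left scale_left commute)

end

lemma sym_form_lin_comb:
  assumes "sym_form V A" "sym_form V B"
  shows "sym_form V (\<lambda>f g. a * A f g - B f g)"
proof -
  interpret A: sym_form V A by fact
  interpret B: sym_form V B by fact
  show ?thesis
    using A.commute B.commute
    by unfold_locales (auto simp: A.V A.add_left B.add_left A.scale_left B.scale_left algebra_simps)
qed

locale pos_form = sym_form +
  assumes nonneg: "f \<in> V \<Longrightarrow> 0 \<le> A f f"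
begin

lemma Cauchy_Schwarz:
  assumes f: "f \<in> V" and g: "g \<in> V"
  shows "(A f g)\<^sup>2 \<le> A f f * A g g"
proof -
  have *: "0 \<le> A f f - 2 * t * A f g + t\<^sup>2 * A g g" for t
    using nonneg[of "f - t *\<^sub>R g"] f g
    by (simp add: diff_diff mem scale_left scale_right power2_eq_square algebra_simps)
  show ?thesis
  proof (cases "A g g = 0")
    case True
    have "A f g = 0"
    proof (rule ccontr)
      assume "A f g \<noteq> 0"
      then show False
        using *[of "(A f f + 1) / (2 * A f g)"] True nonneg[OF f] by simp
    qed
    then show ?thesis by (simp add: True)
  next
    case False
    then have "0 < A g g" using nonneg[OF g] by simp
    then show ?thesis
      using *[of "A f g / A g g"] by (simp add: field_simps power2_eq_square)
  qed
qed

text \<open>Applied to \<open>\<mu> B - Q\<close>, this is the principle that maximizers of \<open>Q / B\<close> are eigenvectors.\<close>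

lemma isotropic: "\<lbrakk>f \<in> V; g \<in> V; A f f = 0\<rbrakk> \<Longrightarrow> A f g = 0"
  using Cauchy_Schwarz[of f g] by simp

lemma abs_le: "\<lbrakk>f \<in> V; g \<in> V\<rbrakk> \<Longrightarrow> \<bar>A f g\<bar> \<le> sqrt (A f f) * sqrt (A g g)"
  using Cauchy_Schwarz[of f g] real_le_rsqrt[of "\<bar>A f g\<bar>" "A f f * A g g"]
  by (simp add: real_sqrt_mult)

lemma triangle_sq:
  assumes "f \<in> V" "g \<in> V" shows "A (f + g) (f + g) \<le> 2 * A f f + 2 * A g g"
    and "A (f - g) (f - g) \<le> 2 * A f f + 2 * A g g"
  using nonneg[of "f - g"] nonneg[of "f + g"] assms by (simp_all add: add_add diff_diff mem)

end

section \<open>Linear systems and common subsequences\<close>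

text \<open>Elimination of one unknown per equation. This is the only linear algebra below: it supplies vectors of
a span that are orthogonal to given ones, and the invariance of dimension.\<close>

lemma underdetermined_system:
  fixes A :: "nat \<Rightarrow> nat \<Rightarrow> real"
  assumes "m < n"
  shows "\<exists>c. (\<exists>i<n. c i \<noteq> 0) \<and> (\<forall>j<m. (\<Sum>i<n. c i * A i j) = 0)"
  using assms
proof (induction m arbitrary: A n)
  case 0
  then show ?case by (intro exI[of _ "\<lambda>_. 1"]) auto
next
  case (Suc m)
  then obtain n' where n: "n = Suc n'" "m < n'" by (cases n) auto
  show ?case
  proof (cases "\<forall>i<n. A i m = 0")
    case True
    obtain c where "\<exists>i<n. c i \<noteq> 0" "\<forall>j<m. (\<Sum>i<n. c i * A i j) = 0"
      using Suc.IH[of n A] Suc.prems by auto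
    then show ?thesis using True by (intro exI[of _ c]) (auto simp: less_Suc_eq)
  next
    case False
    then obtain p where p: "p < n" "A p m \<noteq> 0" by auto
    \<comment> \<open>use equation \<open>m\<close> to eliminate the unknown \<open>p\<close>; the remaining ones are renumbered by \<open>\<sigma>\<close>\<close>
    define \<sigma> where "\<sigma> i = (if i < p then i else Suc i)" for i
    have \<sigma>: "bij_betw \<sigma> {..<n'} ({..<n} - {p})"
      by (rule bij_betwI[where g = "\<lambda>i. if i < p then i else i - 1"])
        (use p n in \<open>auto simp: \<sigma>_def split: if_splits\<close>)
    obtain c where c: "\<exists>i<n'. c i \<noteq> 0"
      "\<forall>j<m. (\<Sum>i<n'. c i * (A (\<sigma> i) j - A (\<sigma> i) m / A p m * A p j)) = 0"
      using Suc.IH[of n' "\<lambda>i j. A (\<sigma> i) j - A (\<sigma> i) m / A p m * A p j"] n by auto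
    define \<tau> where "\<tau> = the_inv_into {..<n'} \<sigma>"
    have \<tau>: "\<tau> (\<sigma> i) = i" if "i < n'" for i
      using that \<sigma> by (auto simp: \<tau>_def bij_betw_def intro: the_inv_into_f_f)
    define d where "d i = (if i = p then - (\<Sum>k<n'. c k * A (\<sigma> k) m) / A p m else c (\<tau> i))" for i
    have sum_d: "(\<Sum>i<n. d i * A i j) =
        (\<Sum>k<n'. c k * A (\<sigma> k) j) - (\<Sum>k<n'. c k * A (\<sigma> k) m) / A p m * A p j" for j
    proof -
      have "(\<Sum>i<n. d i * A i j) = d p * A p j + (\<Sum>i\<in>{..<n} - {p}. d i * A i j)"
        using p by (intro sum.remove) auto
      also have "(\<Sum>i\<in>{..<n} - {p}. d i * A i j) = (\<Sum>k<n'. d (\<sigma> k) * A (\<sigma> k) j)"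
        using sum.reindex_bij_betw[OF \<sigma>, of "\<lambda>i. d i * A i j"] by simp
      also have "\<dots> = (\<Sum>k<n'. c k * A (\<sigma> k) j)"
      proof (rule sum.cong[OF refl])
        fix k assume "k \<in> {..<n'}"
        moreover have "\<sigma> k \<noteq> p" by (auto simp: \<sigma>_def)
        ultimately show "d (\<sigma> k) * A (\<sigma> k) j = c k * A (\<sigma> k) j" by (simp add: d_def \<tau>)
      qed
      finally show ?thesis by (simp add: d_def)
    qed
    have "(\<Sum>i<n. d i * A i j) = 0" if "j < Suc m" for j
    proof (cases "j = m")
      case True then show ?thesis using p by (simp add: sum_d)
    next
      case False
      then have "(\<Sum>i<n'. c i * (A (\<sigma> i) j - A (\<sigma> i) m / A p m * A p j)) = 0" using c that by simp
      then show ?thesis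
        by (simp add: sum_d right_diff_distrib sum_subtractf sum_divide_distrib sum_distrib_right mult.assoc)
    qed
    moreover obtain i where i: "i < n'" "c i \<noteq> 0" using c by auto
    then have "d (\<sigma> i) = c i" "\<sigma> i < n" using \<tau> n by (auto simp: d_def \<sigma>_def)
    ultimately show ?thesis using i by (intro exI[of _ d]) auto
  qed
qed

lemma common_convergent_subseq:
  fixes a :: "nat \<Rightarrow> nat \<Rightarrow> real"
  assumes "\<And>i. i < m \<Longrightarrow> \<exists>C. \<forall>n. \<bar>a i n\<bar> \<le> C"
  shows "\<exists>r. strict_mono r \<and> (\<forall>i<m. convergent (\<lambda>n. a i (r n)))"
  using assms
proof (induction m)
  case 0
  then show ?case by (intro exI[of _ id]) (auto simp: strict_mono_def)
next
  case (Suc m)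
  then obtain r where r: "strict_mono r" "\<forall>i<m. convergent (\<lambda>n. a i (r n))" by auto
  obtain C where "\<forall>n. \<bar>a m n\<bar> \<le> C" using Suc.prems[of m] by auto
  then have "bounded (range (\<lambda>n. a m (r n)))" by (auto simp: bounded_iff)
  then obtain l q where q: "strict_mono q" "((\<lambda>n. a m (r n)) \<circ> q) \<longlonglongrightarrow> l"
    using bounded_imp_convergent_subsequence by blast
  have "convergent (\<lambda>n. a i (r (q n)))" if "i < Suc m" for i
  proof (cases "i = m")
    case True then show ?thesis using q by (auto simp: convergent_def o_def)
  next
    case False
    then have "convergent (\<lambda>n. a i (r n))" using r that by simp
    then show ?thesis using convergent_subseq_convergent[OF _ q(1)] by (fastforce simp: o_def)
  qed
  then show ?case using strict_mono_o[OF r(1) q(1)] by (intro exI[of _ "\<lambda>n. r (q n)"]) (auto simp: o_def)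
qed

section \<open>Spectral theory in a complete semi-inner-product space\<close>

locale semi_hilbert = pos_form V B for V :: "'v::real_vector set" and B +
  assumes complete:
    "\<lbrakk>\<And>n. f n \<in> V; \<And>e. e > 0 \<Longrightarrow> \<exists>N. \<forall>m\<ge>N. \<forall>n\<ge>N. B (f m - f n) (f m - f n) < e\<rbrakk>
      \<Longrightarrow> \<exists>g\<in>V. (\<lambda>n. B (f n - g) (f n - g)) \<longlonglongrightarrow> 0"
begin

text \<open>The bound is stated for squares, which avoids square roots of \<open>B\<close>.\<close>

definition bounded_functional :: "('v \<Rightarrow> real) \<Rightarrow> bool" where
  "bounded_functional L \<longleftrightarrow>
     (\<forall>f\<in>V. \<forall>g\<in>V. L (f + g) = L f + L g) \<and> (\<forall>c. \<forall>f\<in>V. L (c *\<^sub>R f) = c * L f) \<and>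
     (\<exists>C. \<forall>f\<in>V. (L f)\<^sup>2 \<le> C * B f f)"

definition bounded_form :: "('v \<Rightarrow> 'v \<Rightarrow> real) \<Rightarrow> bool" where
  "bounded_form Q \<longleftrightarrow> sym_form V Q \<and> (\<exists>C. \<forall>f\<in>V. \<bar>Q f f\<bar> \<le> C * B f f)"

text \<open>For nonnegative \<open>Q\<close> the inequality says that \<open>Q\<close> is small on a subspace of finite codimension, which
is compactness of the operator that represents \<open>Q\<close>. It is one-sided because only positive
eigenvalues are sought.\<close>

definition compact_form :: "('v \<Rightarrow> 'v \<Rightarrow> real) \<Rightarrow> bool" where
  "compact_form Q \<longleftrightarrow> bounded_form Q \<and>
     (\<forall>\<epsilon>>0. \<exists>(m::nat) L. (\<forall>i<m. bounded_functional (L i)) \<and>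
        (\<forall>f\<in>V. Q f f \<le> \<epsilon> * B f f + (\<Sum>i<m. (L i f)\<^sup>2)))"

lemma bounded_functional_diff:
  "bounded_functional L \<Longrightarrow> f \<in> V \<Longrightarrow> g \<in> V \<Longrightarrow> L (f - g) = L f - L g"
  unfolding bounded_functional_def
  using mem_scale[of g "-1"]
  by (metis (no_types, opaque_lifting) add_uminus_conv_diff mult_minus1 scaleR_minus1_left)

lemma bounded_functional_sum:
  "bounded_functional L \<Longrightarrow> (\<And>i. i \<in> I \<Longrightarrow> h i \<in> V) \<Longrightarrow> L (sum h I) = (\<Sum>i\<in>I. L (h i))"
proof (induction I rule: infinite_finite_induct)
  case (insert x F)
  then show ?case by (simp add: bounded_functional_def mem)
next
  case empty
  then have "L (0 *\<^sub>R 0) = 0 * L 0" using mem_zero unfolding bounded_functional_def by blast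
  then show ?case by simp
next
  case (infinite A)
  then have "L (0 *\<^sub>R 0) = 0 * L 0" using mem_zero unfolding bounded_functional_def by blast
  then show ?case using infinite by simp
qed

text \<open>\<open>Q\<close> is a difference of the two nonnegative forms \<open>C B\<close> and \<open>C B - Q\<close>, for which the
Cauchy-Schwarz inequality bounds the mixed terms.\<close>

lemma tendsto_quadratic:
  assumes Q: "bounded_form Q" and f: "\<And>n. f n \<in> V" and g: "g \<in> V"
    and lim: "(\<lambda>n. B (f n - g) (f n - g)) \<longlonglongrightarrow> 0"
  shows "(\<lambda>n. Q (f n) (f n)) \<longlonglongrightarrow> Q g g"
proof -
  interpret Q: sym_form V Q using Q by (simp add: bounded_form_def)
  obtain C where C: "\<And>f. f \<in> V \<Longrightarrow> \<bar>Q f f\<bar> \<le> C * B f f" using Q by (auto simp: bounded_form_def)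
  define P where "P = (\<lambda>f h. C * B f h - Q f h)"
  interpret P: pos_form V P
    unfolding P_def pos_form_def pos_form_axioms_def
    using sym_form_lin_comb[OF sym_form_axioms Q.sym_form_axioms, of C] C by fastforce
  have gen: "(\<lambda>n. R (f n) (f n)) \<longlonglongrightarrow> R g g"
    if R: "pos_form V R" and bd: "\<And>f. f \<in> V \<Longrightarrow> R f f \<le> D * B f f" for R D
  proof -
    interpret R: pos_form V R by fact
    have "(\<lambda>n. D * B (f n - g) (f n - g)) \<longlonglongrightarrow> 0" using tendsto_mult_right_zero[OF lim] by simp
    then have l1: "(\<lambda>n. R (f n - g) (f n - g)) \<longlonglongrightarrow> 0"
      by (rule tendsto_sandwich[OF _ _ tendsto_const, rotated 2])
        (use f g bd R.nonneg in \<open>auto simp: mem intro!: always_eventually\<close>)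
    have "(\<lambda>n. sqrt (R (f n - g) (f n - g)) * sqrt (R g g)) \<longlonglongrightarrow> 0"
      using tendsto_mult_left_zero[OF tendsto_real_sqrt[OF l1, simplified]] by simp
    then have l2: "(\<lambda>n. R (f n - g) g) \<longlonglongrightarrow> 0"
      by (rule Lim_null_comparison[rotated])
        (use f g R.abs_le in \<open>auto simp: mem intro!: always_eventually\<close>)
    have "R (f n) (f n) = R (f n - g) (f n - g) + 2 * R (f n - g) g + R g g" for n
      using R.add_add[of "f n - g" g] f g by (simp add: mem)
    then show ?thesis
      using tendsto_add[OF tendsto_add[OF l1 tendsto_mult_left[OF l2, of 2]] tendsto_const[of "R g g"]]
      by simp
  qed
  have "(\<lambda>n. C * B (f n) (f n) - P (f n) (f n)) \<longlonglongrightarrow> C * B g g - P g g"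
  proof (intro tendsto_diff tendsto_mult_left)
    show "(\<lambda>n. B (f n) (f n)) \<longlonglongrightarrow> B g g" by (rule gen[of B 1]) (auto simp: pos_form_axioms)
    show "(\<lambda>n. P (f n) (f n)) \<longlonglongrightarrow> P g g"
    proof (rule gen[of P "2 * C", OF P.pos_form_axioms])
      fix f assume "f \<in> V"
      then show "P f f \<le> 2 * C * B f f" using C[of f] by (simp add: P_def)
    qed
  qed
  then show ?thesis by (simp add: P_def)
qed

text \<open>Let \<open>\<mu>\<close> be the supremum of \<open>Q f f / B f f\<close>. On a maximizing sequence the nonnegative form
\<open>S = \<mu> B - Q\<close> tends to \<open>0\<close>, hence so it does on differences \<open>d\<close> of members far out. There
\<open>\<mu> B d d = S d d + Q d d\<close>, and compactness bounds \<open>Q d d\<close> by \<open>(\<mu> / 2) B d d\<close> plus finitely many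
squares \<open>(L\<^sub>i d)\<^sup>2\<close>, which are small along a subsequence. So the subsequence is Cauchy.\<close>

lemma maximizer_exists:
  assumes Q: "compact_form Q" and f0: "f0 \<in> V" "0 < Q f0 f0"
  shows "\<exists>e\<in>V. B e e = 1 \<and> 0 < Q e e \<and> (\<forall>f\<in>V. Q f f \<le> Q e e * B f f)"
proof -
  have bQ: "bounded_form Q" using Q by (simp add: compact_form_def)
  interpret Q: sym_form V Q using bQ by (simp add: bounded_form_def)
  obtain C where C: "\<And>f. f \<in> V \<Longrightarrow> \<bar>Q f f\<bar> \<le> C * B f f" using bQ by (auto simp: bounded_form_def)
  define X where "X = {Q f f |f. f \<in> V \<and> B f f = 1}"
  define \<mu> where "\<mu> = Sup X"
  have bdd: "bdd_above X"
  proof (rule bdd_aboveI)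
    fix x assume "x \<in> X"
    then obtain f where "x = Q f f" "f \<in> V" "B f f = 1" unfolding X_def by blast
    then show "x \<le> C" using C[of f] by simp
  qed
  have "B f0 f0 > 0" using C[OF f0(1)] f0 nonneg[OF f0(1)]
    by (cases "B f0 f0 = 0") auto
  define g0 where "g0 = (1 / sqrt (B f0 f0)) *\<^sub>R f0"
  have g0: "g0 \<in> V" "B g0 g0 = 1" "Q g0 g0 > 0"
    using f0 \<open>B f0 f0 > 0\<close> unfolding g0_def
    by (auto simp: mem scale_scale Q.scale_scale power_divide)
  have Q_le: "Q f f \<le> \<mu> * B f f" if f: "f \<in> V" for f
  proof (cases "B f f = 0")
    case True then show ?thesis using C[OF f] by simp
  next
    case False
    then have pos: "B f f > 0" using nonneg[OF f] by simp
    define g where "g = (1 / sqrt (B f f)) *\<^sub>R f"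
    have "g \<in> V" "B g g = 1" "Q g g = Q f f / B f f"
      using f pos unfolding g_def by (auto simp: mem scale_scale Q.scale_scale power_divide)
    moreover from this have "Q g g \<in> X" unfolding X_def by blast
    ultimately have "Q f f / B f f \<le> \<mu>" unfolding \<mu>_def
      using cSup_upper[OF _ bdd, of "Q g g"] by simp
    then show ?thesis using pos by (simp add: field_simps)
  qed
  have \<mu>_pos: "\<mu> > 0" using Q_le[OF g0(1)] g0 by simp
  define S where "S = (\<lambda>f h. \<mu> * B f h - Q f h)"
  interpret S: pos_form V S
    unfolding S_def pos_form_def pos_form_axioms_def
    using sym_form_lin_comb[OF sym_form_axioms Q.sym_form_axioms] Q_le by auto
  have "\<exists>f\<in>V. B f f = 1 \<and> \<mu> - 1 / real (Suc n) < Q f f" for n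
  proof -
    have "\<exists>x\<in>X. \<mu> - 1 / real (Suc n) < x" unfolding \<mu>_def
      by (rule less_cSupD) (use g0 in \<open>auto simp: X_def\<close>)
    then show ?thesis by (auto simp: X_def)
  qed
  then obtain f where f: "\<And>n. f n \<in> V" "\<And>n. B (f n) (f n) = 1" "\<And>n. \<mu> - 1 / real (Suc n) < Q (f n) (f n)"
    by (metis (no_types, lifting))
  have S_small: "S (f n) (f n) < 1 / real (Suc n)" for n using f(3)[of n] by (simp add: S_def f)
  have "\<exists>(m::nat) L. (\<forall>i<m. bounded_functional (L i)) \<and>
      (\<forall>f\<in>V. Q f f \<le> \<mu> / 2 * B f f + (\<Sum>i<m. (L i f)\<^sup>2))"
    using Q half_gt_zero[OF \<mu>_pos] unfolding compact_form_def by blast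
  then obtain m :: nat and L where L: "\<And>i. i < m \<Longrightarrow> bounded_functional (L i)"
    and QL: "\<And>f. f \<in> V \<Longrightarrow> Q f f \<le> \<mu> / 2 * B f f + (\<Sum>i<m. (L i f)\<^sup>2)"
    by blast
  have "\<exists>D. \<forall>n. \<bar>L i (f n)\<bar> \<le> D" if im: "i < m" for i
  proof -
    obtain D where "\<And>f. f \<in> V \<Longrightarrow> (L i f)\<^sup>2 \<le> D * B f f"
      using L[OF im] unfolding bounded_functional_def by blast
    then have "(L i (f n))\<^sup>2 \<le> D" for n using f(1,2)[of n] by fastforce
    then have "\<bar>L i (f n)\<bar> \<le> sqrt D" for n using real_le_rsqrt[of "\<bar>L i (f n)\<bar>" D] by simp
    then show ?thesis by blast
  qed
  then obtain r where r: "strict_mono r" "\<And>i. i < m \<Longrightarrow> convergent (\<lambda>n. L i (f (r n)))"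
    using common_convergent_subseq[of m "\<lambda>i n. L i (f n)"] by auto
  define h where "h n = f (r n)" for n
  have hV: "h n \<in> V" for n by (simp add: h_def f)
  have S_h: "S (h n) (h n) \<le> 1 / real (Suc n)" for n
  proof -
    have "1 / real (Suc (r n)) \<le> 1 / real (Suc n)"
      using seq_suble[OF r(1), of n] by (simp add: frac_le)
    then show ?thesis using S_small[of "r n"] by (simp add: h_def)
  qed
  have key: "\<mu> / 2 * B (h a - h b) (h a - h b) \<le>
      2 / real (Suc a) + 2 / real (Suc b) + (\<Sum>i<m. (L i (h a) - L i (h b))\<^sup>2)" for a b
  proof -
    have "\<mu> * B (h a - h b) (h a - h b) = S (h a - h b) (h a - h b) + Q (h a - h b) (h a - h b)"
      by (simp add: S_def)
    moreover have "S (h a - h b) (h a - h b) \<le> 2 * S (h a) (h a) + 2 * S (h b) (h b)"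
      by (rule S.triangle_sq) (auto simp: hV)
    moreover have "Q (h a - h b) (h a - h b) \<le> \<mu> / 2 * B (h a - h b) (h a - h b) + (\<Sum>i<m. (L i (h a) - L i (h b))\<^sup>2)"
      using QL[of "h a - h b"] by (simp add: mem hV bounded_functional_diff L)
    moreover have "2 / real (Suc a) = 2 * (1 / real (Suc a))" "2 / real (Suc b) = 2 * (1 / real (Suc b))"
      "\<mu> / 2 * B (h a - h b) (h a - h b) = (\<mu> * B (h a - h b) (h a - h b)) / 2" by simp_all
    ultimately show ?thesis using S_h[of a] S_h[of b] by linarith
  qed
  have "\<exists>g\<in>V. (\<lambda>n. B (h n - g) (h n - g)) \<longlonglongrightarrow> 0"
  proof (rule complete[OF hV])
    fix e :: real assume e: "e > 0"
    \<comment> \<open>The right-hand side of the key inequality consists of four terms of the size of 1/n and of m squares.\<close>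
    define \<delta> where "\<delta> = (\<mu> / 2 * e) / (real m + 5)"
    have \<delta>: "\<delta> > 0" using e \<mu>_pos by (auto simp: \<delta>_def)
    have "\<exists>N. \<forall>a\<ge>N. \<forall>b\<ge>N. \<bar>L i (h a) - L i (h b)\<bar> < sqrt \<delta>" if "i < m" for i
      using CauchyD[OF convergent_Cauchy[OF r(2)[OF that]], of "sqrt \<delta>"] \<delta>
      by (auto simp: h_def)
    then have "\<forall>i. \<exists>N. i < m \<longrightarrow> (\<forall>a\<ge>N. \<forall>b\<ge>N. \<bar>L i (h a) - L i (h b)\<bar> < sqrt \<delta>)" by blast
    then have "\<exists>N. \<forall>i. i < m \<longrightarrow> (\<forall>a\<ge>N i. \<forall>b\<ge>N i. \<bar>L i (h a) - L i (h b)\<bar> < sqrt \<delta>)"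
      by (rule choice)
    then obtain N where N: "\<And>i a b. \<lbrakk>i < m; a \<ge> N i; b \<ge> N i\<rbrakk> \<Longrightarrow> \<bar>L i (h a) - L i (h b)\<bar> < sqrt \<delta>"
      by blast
    obtain N0 where N0: "1 / real (Suc N0) < \<delta>" using nat_approx_posE[OF \<delta>] by blast
    define M where "M = N0 + (\<Sum>i<m. N i)"
    have "B (h a - h b) (h a - h b) < e" if ab: "a \<ge> M" "b \<ge> M" for a b
    proof -
      have "1 / real (Suc a) < \<delta>" "1 / real (Suc b) < \<delta>"
        using ab N0 frac_le[of 1 1 "real (Suc N0)" "real (Suc a)"]
          frac_le[of 1 1 "real (Suc N0)" "real (Suc b)"] unfolding M_def by auto
      moreover have "(\<Sum>i<m. (L i (h a) - L i (h b))\<^sup>2) \<le> (\<Sum>i<m. \<delta>)"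
      proof (rule sum_mono)
        fix i assume i: "i \<in> {..<m}"
        then have "N i \<le> (\<Sum>i<m. N i)" by (intro member_le_sum) auto
        then have "\<bar>L i (h a) - L i (h b)\<bar> < sqrt \<delta>" using N[of i a b] i ab by (simp add: M_def)
        then show "(L i (h a) - L i (h b))\<^sup>2 \<le> \<delta>"
          using power_mono[of "\<bar>L i (h a) - L i (h b)\<bar>" "sqrt \<delta>" 2] \<delta> by simp
      qed
      ultimately have "\<mu> / 2 * B (h a - h b) (h a - h b) < (real m + 5) * \<delta>"
        using key[of a b] \<delta> by (simp add: algebra_simps)
      also have "\<dots> = \<mu> / 2 * e"
      proof -
        have "real m + 5 \<noteq> 0" by linarith
        then show ?thesis
          unfolding \<delta>_def by (simp only: times_divide_eq_right nonzero_mult_div_cancel_left not_False_eq_True)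
      qed
      finally show ?thesis using \<mu>_pos by (simp add: mult_less_cancel_left)
    qed
    then show "\<exists>N. \<forall>m\<ge>N. \<forall>n\<ge>N. B (h m - h n) (h m - h n) < e" by blast
  qed
  then obtain g where g: "g \<in> V" and lim: "(\<lambda>n. B (h n - g) (h n - g)) \<longlonglongrightarrow> 0" by auto
  have bB: "bounded_form B" unfolding bounded_form_def
    using sym_form_axioms nonneg by (auto intro!: exI[of _ 1])
  have "(\<lambda>n. B (h n) (h n)) \<longlonglongrightarrow> B g g" by (rule tendsto_quadratic[OF bB hV g lim])
  then have B1: "B g g = 1" using LIMSEQ_unique[of "\<lambda>n. 1" _ 1] by (simp add: h_def f)
  have "(\<lambda>n. \<mu> * B (h n) (h n) - S (h n) (h n)) \<longlonglongrightarrow> Q g g"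
    using tendsto_quadratic[OF bQ hV g lim] by (simp add: S_def)
  moreover have "(\<lambda>n. S (h n) (h n)) \<longlonglongrightarrow> 0"
    by (rule tendsto_sandwich[OF _ _ tendsto_const LIMSEQ_Suc[OF lim_1_over_n]])
      (use S_h hV S.nonneg in \<open>auto intro!: always_eventually\<close>)
  ultimately have "(\<lambda>n. \<mu>) \<longlonglongrightarrow> Q g g"
    using tendsto_add[of "\<lambda>n. \<mu> * B (h n) (h n) - S (h n) (h n)" "Q g g" _ "\<lambda>n. S (h n) (h n)" 0] f
    by (simp add: h_def)
  then have "Q g g = \<mu>" by (simp add: LIMSEQ_const_iff)
  then show ?thesis using g B1 \<mu>_pos Q_le by auto
qed

lemma maximizer_eigenvector:
  assumes Q: "sym_form V Q" and e: "e \<in> V" "Q e e = \<mu> * B e e"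
    and max: "\<And>f. f \<in> V \<Longrightarrow> Q f f \<le> \<mu> * B f f" and g: "g \<in> V"
  shows "Q e g = \<mu> * B e g"
proof -
  interpret S: pos_form V "\<lambda>f h. \<mu> * B f h - Q f h"
    unfolding pos_form_def pos_form_axioms_def
    using sym_form_lin_comb[OF sym_form_axioms Q] max by auto
  show ?thesis using S.isotropic[OF e(1) g] e(2) by simp
qed

text \<open>For \<open>Q f g = L f * L g\<close>, a compact form of rank one, a maximizer of \<open>Q / B\<close> is an eigenvector, and
the eigenvector equation is the representation of \<open>L\<close>.\<close>

theorem Riesz_representation:
  assumes L: "bounded_functional L"
  shows "\<exists>u\<in>V. \<forall>g\<in>V. B u g = L g"
proof (cases "\<forall>f\<in>V. L f = 0")
  case True
  then show ?thesis using mem_zero zero_left by (intro bexI[of _ 0]) auto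
next
  case False
  then obtain f0 where f0: "f0 \<in> V" "L f0 \<noteq> 0" by auto
  define Q where "Q = (\<lambda>f g. L f * L g)"
  have sf: "sym_form V Q"
    using L unfolding Q_def bounded_functional_def
    by unfold_locales (auto simp: V algebra_simps)
  have cf: "compact_form Q" unfolding compact_form_def bounded_form_def
  proof (intro conjI allI impI)
    show "\<exists>C. \<forall>f\<in>V. \<bar>Q f f\<bar> \<le> C * B f f"
      using L by (auto simp: bounded_functional_def Q_def power2_eq_square abs_mult)
    fix \<epsilon> :: real assume "\<epsilon> > 0"
    then show "\<exists>(m::nat) K. (\<forall>i<m. bounded_functional (K i)) \<and> (\<forall>f\<in>V. Q f f \<le> \<epsilon> * B f f + (\<Sum>i<m. (K i f)\<^sup>2))"
      using L nonneg by (intro exI[of _ 1] exI[of _ "\<lambda>_. L"]) (auto simp: Q_def power2_eq_square)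
  qed (rule sf)
  have "0 < Q f0 f0" using f0 by (auto simp: Q_def zero_less_mult_iff)
  from maximizer_exists[OF cf f0(1) this] obtain e
    where e: "e \<in> V" "B e e = 1" "0 < Q e e" "\<forall>f\<in>V. Q f f \<le> Q e e * B f f" by blast
  have Le: "L e \<noteq> 0" using e(3) by (auto simp: Q_def)
  have "B (L e *\<^sub>R e) g = L g" if g: "g \<in> V" for g
  proof -
    have "L e * L g = L e * (L e * B e g)"
      using maximizer_eigenvector[OF sf e(1), of "Q e e" g] e g by (simp add: Q_def)
    then have "L g = L e * B e g" using Le by (simp only: mult_cancel_left) simp
    then show ?thesis using e(1) g by (simp only: scale_left)
  qed
  then show ?thesis using e mem_scale by blast
qed

end

context semi_hilbert
begin

text \<open>The last condition says that \<open>e k\<close> maximizes \<open>Q / B\<close> on the orthogonal complement of its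
predecessors.\<close>

definition spectral_seq :: "('v \<Rightarrow> 'v \<Rightarrow> real) \<Rightarrow> (nat \<Rightarrow> 'v) \<Rightarrow> (nat \<Rightarrow> real) \<Rightarrow> bool" where
  "spectral_seq Q e \<mu> \<longleftrightarrow>
     (\<forall>i. e i \<in> V) \<and> (\<forall>i j. B (e i) (e j) = (if i = j then 1 else 0)) \<and>
     (\<forall>i. 0 < \<mu> i) \<and> (\<forall>i. \<forall>f\<in>V. Q (e i) f = \<mu> i * B (e i) f) \<and>
     (\<forall>k. \<forall>f\<in>V. (\<forall>i<k. B f (e i) = 0) \<longrightarrow> Q f f \<le> \<mu> k * B f f)"

lemma spectral_seqD:
  assumes "spectral_seq Q e \<mu>"
  shows "e i \<in> V" "B (e i) (e j) = (if i = j then 1 else 0)" "0 < \<mu> i"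
    and "f \<in> V \<Longrightarrow> Q (e i) f = \<mu> i * B (e i) f"
    and "\<lbrakk>f \<in> V; \<And>i. i < k \<Longrightarrow> B f (e i) = 0\<rbrakk> \<Longrightarrow> Q f f \<le> \<mu> k * B f f"
  using assms unfolding spectral_seq_def by blast+

text \<open>Orthogonality passes to limits, so the existence of maximizers is available on orthogonal complements.\<close>

lemma semi_hilbert_orthogonal:
  fixes k :: nat
  assumes e: "\<And>i. i < k \<Longrightarrow> e i \<in> V"
  shows "semi_hilbert {f \<in> V. \<forall>i<k. B f (e i) = 0} B" (is "semi_hilbert ?W B")
proof -
  have W: "subspace ?W"
    using V e by (auto simp: subspace_def add_left scale_left zero_left)
  interpret W: sym_form ?W B by (rule sym_form_subspace[OF W]) auto
  show ?thesis
  proof unfold_locales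
    fix f assume "f \<in> ?W" then show "0 \<le> B f f" using nonneg by simp
  next
    fix f :: "nat \<Rightarrow> 'v"
    assume f: "\<And>n. f n \<in> ?W"
      and C: "\<And>e. e > 0 \<Longrightarrow> \<exists>N. \<forall>m\<ge>N. \<forall>n\<ge>N. B (f m - f n) (f m - f n) < e"
    have "f n \<in> V" for n using f by simp
    from complete[OF this C] obtain g where g: "g \<in> V" "(\<lambda>n. B (f n - g) (f n - g)) \<longlonglongrightarrow> 0"
      by blast
    have "B g (e i) = 0" if i: "i < k" for i
    proof -
      have "(B g (e i))\<^sup>2 \<le> B (f n - g) (f n - g) * B (e i) (e i)" for n
      proof -
        have "B (f n - g) (e i) = - B g (e i)" using f[of n] g e[OF i] i by (simp add: diff_left)
        then show ?thesis using Cauchy_Schwarz[of "f n - g" "e i"] f[of n] g e[OF i] by (simp add: mem)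
      qed
      moreover have "(\<lambda>n. B (f n - g) (f n - g) * B (e i) (e i)) \<longlonglongrightarrow> 0"
        using tendsto_mult_left_zero[OF g(2)] by simp
      ultimately have "(B g (e i))\<^sup>2 \<le> 0"
        by (intro LIMSEQ_le_const[where a = "(B g (e i))\<^sup>2"]) auto
      then show ?thesis by simp
    qed
    then show "\<exists>g\<in>?W. (\<lambda>n. B (f n - g) (f n - g)) \<longlonglongrightarrow> 0" using g by auto
  qed
qed

lemma bounded_functional_mono:
  assumes "semi_hilbert W B" "W \<subseteq> V" "bounded_functional L"
  shows "semi_hilbert.bounded_functional W B L"
proof -
  interpret W: semi_hilbert W B by fact
  show ?thesis using assms(2,3) unfolding bounded_functional_def W.bounded_functional_def
    by (meson subsetD)
qed

lemma compact_form_mono: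
  assumes W: "semi_hilbert W B" "W \<subseteq> V" and Q: "compact_form Q"
  shows "semi_hilbert.compact_form W B Q"
proof -
  interpret W: semi_hilbert W B by fact
  have Qs: "sym_form V Q" using Q by (simp add: compact_form_def bounded_form_def)
  have "sym_form W Q" by (rule sym_form.sym_form_subspace[OF Qs W.V W(2)])
  moreover have "\<exists>C. \<forall>f\<in>W. \<bar>Q f f\<bar> \<le> C * B f f"
    using Q W(2) unfolding compact_form_def bounded_form_def by (meson subsetD)
  moreover have "\<exists>(m::nat) L. (\<forall>i<m. W.bounded_functional (L i)) \<and>
        (\<forall>f\<in>W. Q f f \<le> \<epsilon> * B f f + (\<Sum>i<m. (L i f)\<^sup>2))" if "\<epsilon> > 0" for \<epsilon>
  proof -
    from Q that obtain m :: nat and L where "\<forall>i<m. bounded_functional (L i)"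
      "\<forall>f\<in>V. Q f f \<le> \<epsilon> * B f f + (\<Sum>i<m. (L i f)\<^sup>2)"
      unfolding compact_form_def by blast
    then show ?thesis using bounded_functional_mono[OF W] W(2) by (intro exI[of _ m] exI[of _ L]) auto
  qed
  ultimately show ?thesis unfolding W.compact_form_def W.bounded_form_def by blast
qed

text \<open>Every step maximizes \<open>Q / B\<close> on the orthogonal complement of the vectors found so far. There the
maximizer satisfies the eigenvector equation; it holds against the earlier vectors too, since those
are eigenvectors and \<open>Q\<close> is symmetric.\<close>

theorem spectral_seq_exists:
  assumes Q: "compact_form Q"
    and pos: "\<And>(k::nat) e. (\<And>i. i < k \<Longrightarrow> e i \<in> V) \<Longrightarrow> \<exists>f\<in>V. (\<forall>i<k. B f (e i) = 0) \<and> 0 < Q f f"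
  shows "\<exists>e \<mu>. spectral_seq Q e \<mu>"
proof -
  have Qs: "sym_form V Q" using Q by (simp add: compact_form_def bounded_form_def)
  interpret Q: sym_form V Q by (rule Qs)
  define P where "P e k x \<longleftrightarrow> x \<in> V \<and> B x x = 1 \<and> 0 < Q x x \<and> (\<forall>i<k. B x (e i) = 0) \<and>
      (\<forall>f\<in>V. (\<forall>i<k. B f (e i) = 0) \<longrightarrow> Q f f \<le> Q x x * B f f)" for e :: "nat \<Rightarrow> 'v" and k x
  have "\<exists>e. \<forall>k. P e k (e k)"
  proof (rule dependent_wf_choice[OF wf_less])
    fix e g :: "nat \<Rightarrow> 'v" and k :: nat and x
    assume "\<And>i. (i, k) \<in> {(x, y). x < y} \<Longrightarrow> e i = g i"
    then show "P e k x = P g k x" by (simp add: P_def)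
  next
    fix k :: nat and e :: "nat \<Rightarrow> 'v"
    assume "\<And>i. (i, k) \<in> {(x, y). x < y} \<Longrightarrow> P e i (e i)"
    then have e: "\<And>i. i < k \<Longrightarrow> e i \<in> V" by (simp add: P_def)
    let ?W = "{f \<in> V. \<forall>i<k. B f (e i) = 0}"
    interpret W: semi_hilbert ?W B by (rule semi_hilbert_orthogonal[OF e])
    obtain f0 where f0: "f0 \<in> ?W" "0 < Q f0 f0" using pos[of k e] e by blast
    have "W.compact_form Q"
      by (rule compact_form_mono[OF W.semi_hilbert_axioms _ Q]) auto
    from W.maximizer_exists[OF this f0] show "\<exists>x. P e k x" unfolding P_def by auto
  qed
  then obtain e where e: "\<And>k. P e k (e k)" by blast
  define \<mu> where "\<mu> k = Q (e k) (e k)" for k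
  have eV: "e i \<in> V" for i using e[of i] by (simp add: P_def)
  have orth: "B (e i) (e j) = (if i = j then 1 else 0)" for i j
    using e[of i] e[of j] commute[OF eV[of i] eV[of j]]
    by (cases i j rule: linorder_cases) (auto simp: P_def)
  have max: "Q f f \<le> \<mu> k * B f f" if "f \<in> V" "\<And>i. i < k \<Longrightarrow> B f (e i) = 0" for f k
    using e[of k] that by (simp add: P_def \<mu>_def)
  have eig: "Q (e k) f = \<mu> k * B (e k) f" if f: "f \<in> V" for f k
    using f
  proof (induction k arbitrary: f rule: less_induct)
    case (less k)
    let ?W = "{f \<in> V. \<forall>i<k. B f (e i) = 0}"
    interpret W: semi_hilbert ?W B by (rule semi_hilbert_orthogonal[OF eV])
    have QW: "sym_form ?W Q" by (rule sym_form.sym_form_subspace[OF Qs W.V]) auto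
    \<comment> \<open>the projection to the span of the earlier vectors\<close>
    define p where "p = (\<Sum>i<k. B f (e i) *\<^sub>R e i)"
    have p: "p \<in> V" unfolding p_def by (intro mem) (simp add: eV)
    have Bp: "B p (e j) = B f (e j)" if "j < k" for j
    proof -
      have "B p (e j) = (\<Sum>i<k. if i = j then B f (e j) else 0)" unfolding p_def
        by (simp add: sum_left mem eV scale_left orth if_distrib cong: if_cong)
      then show ?thesis using that by simp
    qed
    have fpW: "f - p \<in> ?W" using less.prems p eV Bp by (auto simp: mem diff_left)
    have ekW: "e k \<in> ?W" using eV orth by auto
    have 1: "Q (e k) (f - p) = \<mu> k * B (e k) (f - p)"
      by (rule W.maximizer_eigenvector[OF QW ekW _ _ fpW])
        (use max orth in \<open>auto simp: \<mu>_def\<close>)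
    have 2: "Q (e k) p = 0" "B (e k) p = 0"
    proof -
      have "Q (e k) (e i) = 0" if "i < k" for i
        using less.IH[OF that eV[of k]] Q.commute[OF eV[of k] eV[of i]] orth[of i k] that by simp
      then show "Q (e k) p = 0" "B (e k) p = 0" unfolding p_def
        by (simp_all add: sum_right Q.sum_right mem eV scale_right Q.scale_right orth)
    qed
    show ?case using 1 2 less.prems p eV by (simp add: Q.diff_right diff_right)
  qed
  have "spectral_seq Q e \<mu>"
  proof -
    have "0 < \<mu> i" for i using e[of i] by (simp add: P_def \<mu>_def)
    then show ?thesis unfolding spectral_seq_def using eV orth max eig by blast
  qed
  then show ?thesis by blast
qed

lemma spectral_seq_antimono:
  assumes "spectral_seq Q e \<mu>" "i \<le> j" shows "\<mu> j \<le> \<mu> i"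
  using spectral_seqD(5)[OF assms(1) spectral_seqD(1)[OF assms(1), of j], of i]
    spectral_seqD(4)[OF assms(1) spectral_seqD(1)[OF assms(1), of j], of j]
    spectral_seqD(2)[OF assms(1), of j] assms(2) by simp

lemma Bessel:
  assumes e: "\<And>i. e i \<in> V" "\<And>i j. B (e i) (e j) = (if i = (j::nat) then 1 else 0)"
    and C: "\<And>f. f \<in> V \<Longrightarrow> (L f)\<^sup>2 \<le> C * B f f" and L: "bounded_functional L"
  shows "(\<Sum>i<n. (L (e i))\<^sup>2) \<le> C"
proof -
  define s where "s = (\<Sum>i<n. (L (e i))\<^sup>2)"
  define f where "f = (\<Sum>i<n. L (e i) *\<^sub>R e i)"
  have f: "f \<in> V" unfolding f_def by (intro mem) (simp add: e)
  have "L f = s" unfolding f_def s_def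
    using L e(1) by (subst bounded_functional_sum) (auto simp: mem power2_eq_square bounded_functional_def)
  moreover have "B f f = s" unfolding f_def s_def by (subst sum_diag) (auto simp: e)
  ultimately have "s * s \<le> C * s" using C[OF f] by (simp add: power2_eq_square)
  moreover have "s \<ge> 0" by (simp add: s_def sum_nonneg)
  moreover have "0 \<le> C" using order_trans[OF zero_le_power2 C[OF e(1)[of 0]]] by (simp add: e(2))
  ultimately show ?thesis unfolding s_def[symmetric] by (cases "s = 0") auto
qed

text \<open>By Bessel's inequality every bounded functional tends to \<open>0\<close> along an orthonormal sequence, and
compactness bounds \<open>\<mu> n = Q (e n) (e n)\<close> by \<open>\<epsilon>\<close> plus finitely many such terms.\<close>

lemma spectral_seq_tendsto_0:
  assumes Q: "compact_form Q" and S: "spectral_seq Q e \<mu>"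
  shows "\<mu> \<longlonglongrightarrow> 0"
proof (rule LIMSEQ_I)
  fix r :: real assume r: "r > 0"
  note S = spectral_seqD[OF S]
  from Q half_gt_zero[OF r] obtain m :: nat and L where L: "\<And>i. i < m \<Longrightarrow> bounded_functional (L i)"
    and QL: "\<And>f. f \<in> V \<Longrightarrow> Q f f \<le> r / 2 * B f f + (\<Sum>i<m. (L i f)\<^sup>2)"
    unfolding compact_form_def by blast
  have "(\<lambda>n. L i (e n)) \<longlonglongrightarrow> 0" if i: "i < m" for i
  proof -
    obtain C where C: "\<And>f. f \<in> V \<Longrightarrow> (L i f)\<^sup>2 \<le> C * B f f"
      using L[OF i] unfolding bounded_functional_def by blast
    have "summable (\<lambda>n. (L i (e n))\<^sup>2)"
    proof (rule bounded_imp_summable[where B = C])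
      show "(\<Sum>k\<le>n. (L i (e k))\<^sup>2) \<le> C" for n
        using Bessel[OF S(1,2) C L[OF i], of "Suc n"] by (simp only: lessThan_Suc_atMost)
    qed simp
    then have "(\<lambda>n. (L i (e n))\<^sup>2) \<longlonglongrightarrow> 0" by (rule summable_LIMSEQ_zero)
    then show ?thesis by simp
  qed
  then have "(\<lambda>n. \<Sum>i<m. (L i (e n))\<^sup>2) \<longlonglongrightarrow> (\<Sum>i<m. 0\<^sup>2)"
    by (intro tendsto_sum tendsto_power) auto
  then have "(\<lambda>n. \<Sum>i<m. (L i (e n))\<^sup>2) \<longlonglongrightarrow> 0" by simp
  from LIMSEQ_D[OF this half_gt_zero[OF r]] obtain N where
    N: "\<And>n. n \<ge> N \<Longrightarrow> norm ((\<Sum>i<m. (L i (e n))\<^sup>2) - 0) < r / 2" by blast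
  have "norm (\<mu> n - 0) < r" if "n \<ge> N" for n
  proof -
    have "\<mu> n \<le> r / 2 + (\<Sum>i<m. (L i (e n))\<^sup>2)"
      using QL[OF S(1)[of n]] S(4)[OF S(1)[of n], of n] S(2)[of n n] by simp
    moreover have "(\<Sum>i<m. (L i (e n))\<^sup>2) < r / 2" using N[OF that] by simp
    ultimately show ?thesis using S(3)[of n] by simp
  qed
  then show "\<exists>no. \<forall>n\<ge>no. norm (\<mu> n - 0) < r" by blast
qed

lemma spectral_seq_finite_level:
  assumes "compact_form Q" "spectral_seq Q e \<mu>" "l > 0"
  shows "finite {k. l \<le> \<mu> k}"
proof -
  obtain N where N: "\<And>n. n \<ge> N \<Longrightarrow> norm (\<mu> n - 0) < l"
    using LIMSEQ_D[OF spectral_seq_tendsto_0[OF assms(1,2)] assms(3)] by blast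
  have "{k. l \<le> \<mu> k} \<subseteq> {..<N}"
  proof
    fix k assume "k \<in> {k. l \<le> \<mu> k}"
    then show "k \<in> {..<N}" using N[of k] by (cases "k < N") auto
  qed
  then show ?thesis using finite_subset by blast
qed

text \<open>The remainder \<open>h\<close> is an eigenvector for \<open>l\<close> that is orthogonal to the whole sequence. If it were not
null, it would compete in every maximization, so that \<open>l \<le> \<mu> k\<close> for all \<open>k\<close>, although
\<open>\<mu>\<close> tends to \<open>0\<close>.\<close>

lemma eigenvector_expansion:
  assumes Q: "compact_form Q" and S: "spectral_seq Q e \<mu>" and l: "l > 0"
    and f: "f \<in> V" "\<And>g. g \<in> V \<Longrightarrow> Q f g = l * B f g"
  defines "h \<equiv> f - (\<Sum>k | \<mu> k = l. B f (e k) *\<^sub>R e k)"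
  shows "B h h = 0"
proof -
  have Qs: "sym_form V Q" using Q by (simp add: compact_form_def bounded_form_def)
  interpret Q: sym_form V Q by (rule Qs)
  note SD = spectral_seqD[OF S]
  have fin: "finite {k. \<mu> k = l}"
    by (rule finite_subset[OF _ spectral_seq_finite_level[OF Q S l]]) auto
  have h: "h \<in> V" unfolding h_def using f SD(1) by (intro mem) auto
  have Qh: "Q h g = l * B h g" if g: "g \<in> V" for g
  proof -
    have "Q (\<Sum>k | \<mu> k = l. B f (e k) *\<^sub>R e k) g = l * B (\<Sum>k | \<mu> k = l. B f (e k) *\<^sub>R e k) g"
      using g SD(1,4) by (simp add: sum_left Q.sum_left mem scale_left Q.scale_left sum_distrib_left algebra_simps)
    moreover have "(\<Sum>k | \<mu> k = l. B f (e k) *\<^sub>R e k) \<in> V" using SD(1) by (intro mem)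
    ultimately show ?thesis unfolding h_def using f g by (simp add: Q.diff_left diff_left algebra_simps)
  qed
  have orth: "B h (e j) = 0" for j
  proof (cases "\<mu> j = l")
    case True
    have "B (\<Sum>k | \<mu> k = l. B f (e k) *\<^sub>R e k) (e j) = (\<Sum>k | \<mu> k = l. if k = j then B f (e j) else 0)"
      using SD(1) by (simp add: sum_left mem scale_left SD(2) if_distrib cong: if_cong)
    also have "\<dots> = B f (e j)" using fin True by simp
    finally show ?thesis unfolding h_def using f SD(1) by (subst diff_left) (auto intro: mem)
  next
    case False
    have "l * B h (e j) = \<mu> j * B h (e j)"
      using Qh[OF SD(1)[of j]] SD(4)[OF h, of j] Q.commute[OF h SD(1)[of j]] commute[OF h SD(1)[of j]] by metis
    then show ?thesis using False by auto
  qed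
  have "l * B h h \<le> \<mu> k * B h h" for k
    using SD(5)[OF h, of k] orth Qh[OF h] by simp
  moreover have "(\<lambda>k. \<mu> k * B h h) \<longlonglongrightarrow> 0"
    using tendsto_mult_left_zero[OF spectral_seq_tendsto_0[OF Q S]] by simp
  ultimately have "l * B h h \<le> 0" by (intro LIMSEQ_le_const) auto
  then show ?thesis using l nonneg[OF h] by (simp add: mult_le_0_iff)
qed

text \<open>Some vector of positive norm in the span of \<open>e 0, \<dots>, e k\<close> is orthogonal to \<open>e' 0, \<dots>, e' (k - 1)\<close>. On
it \<open>Q\<close> is at least \<open>\<mu> k\<close> and \<open>Q'\<close> at most \<open>\<mu>' k\<close> times \<open>B\<close>.\<close>

lemma spectral_seq_compare:
  assumes S: "spectral_seq Q e \<mu>" and S': "spectral_seq Q' e' \<mu>'"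
    and Q: "sym_form V Q"
    and \<delta>: "\<And>f. f \<in> V \<Longrightarrow> Q f f \<le> Q' f f + \<delta> * B f f"
  shows "\<mu> k \<le> \<mu>' k + \<delta>"
proof -
  interpret Q: sym_form V Q by (rule Q)
  note SD = spectral_seqD[OF S] and SD' = spectral_seqD[OF S']
  obtain c where c: "\<exists>i<Suc k. c i \<noteq> 0" "\<And>j. j < k \<Longrightarrow> (\<Sum>i<Suc k. c i * B (e i) (e' j)) = 0"
    using underdetermined_system[of k "Suc k" "\<lambda>i j. B (e i) (e' j)"] by blast
  define f where "f = (\<Sum>i<Suc k. c i *\<^sub>R e i)"
  have f: "f \<in> V" unfolding f_def using SD(1) by (intro mem)
  have "B f (e' j) = 0" if "j < k" for j
    unfolding f_def using c(2)[OF that] SD(1) SD'(1) by (simp only: sum_left mem scale_left)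
  then have "Q' f f \<le> \<mu>' k * B f f" using SD'(5) f by blast
  moreover have B: "B f f = (\<Sum>i<Suc k. (c i)\<^sup>2)"
    unfolding f_def using SD(1,2) by (subst sum_diag) auto
  have "Q f f = (\<Sum>i<Suc k. (c i)\<^sup>2 * \<mu> i)"
    unfolding f_def using SD(1,2,4) by (subst Q.sum_diag) auto
  moreover have "(\<Sum>i<Suc k. (c i)\<^sup>2 * \<mu> i) \<ge> (\<Sum>i<Suc k. (c i)\<^sup>2 * \<mu> k)"
    by (intro sum_mono mult_left_mono spectral_seq_antimono[OF S]) auto
  moreover have "(\<Sum>i<Suc k. (c i)\<^sup>2 * \<mu> k) = \<mu> k * B f f" by (simp only: B sum_distrib_left mult.commute)
  moreover from c(1) obtain i where "i < Suc k" "c i \<noteq> 0" by blast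
  then have "B f f > 0" unfolding B by (intro sum_pos2[of _ i]) auto
  ultimately have "\<mu> k * B f f \<le> (\<mu>' k + \<delta>) * B f f" using \<delta>[OF f] by (simp add: algebra_simps)
  then show ?thesis using \<open>B f f > 0\<close> by simp
qed

end

text \<open>At the first index where the sequences differ, the larger of the two values occurs there in one
sequence and, by monotonicity, never again in the other, so its multiplicities differ.\<close>

lemma antimono_eq_if_same_multiplicities:
  fixes m m' :: "nat \<Rightarrow> real"
  assumes m: "\<And>k. m k > 0" "\<And>j k. j \<le> k \<Longrightarrow> m k \<le> m j"
    and m': "\<And>k. m' k > 0" "\<And>j k. j \<le> k \<Longrightarrow> m' k \<le> m' j"
    and fin: "\<And>l. l > 0 \<Longrightarrow> finite {k. m k = l}" "\<And>l. l > 0 \<Longrightarrow> finite {k. m' k = l}"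
    and card: "\<And>l. l > 0 \<Longrightarrow> card {k. m k = l} = card {k. m' k = l}"
  shows "m = m'"
proof -
  have step: "\<not> a k > b k" if eq: "\<And>j. j < k \<Longrightarrow> a j = b j" and a: "\<And>k. a k > 0"
    and b: "\<And>j k. j \<le> k \<Longrightarrow> b k \<le> b j" and fa: "\<And>l. l > 0 \<Longrightarrow> finite {k. a k = l}"
    and ca: "\<And>l. l > 0 \<Longrightarrow> card {k. a k = l} = card {k. b k = l}" for a b :: "nat \<Rightarrow> real" and k
  proof
    assume gt: "a k > b k"
    have "{j. b j = a k} \<subset> {j. a j = a k}"
    proof
      show "{j. b j = a k} \<subseteq> {j. a j = a k}"
      proof
        fix j assume j: "j \<in> {j. b j = a k}"
        then have "j < k" using b[of k j] gt by (cases "j < k") auto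
        then show "j \<in> {j. a j = a k}" using eq j by simp
      qed
      show "{j. b j = a k} \<noteq> {j. a j = a k}" using gt by (metis (mono_tags, lifting) less_irrefl mem_Collect_eq)
    qed
    then show False using psubset_card_mono[OF fa[OF a[of k]]] ca[OF a[of k]] by (metis less_irrefl)
  qed
  have "m k = m' k" for k
  proof (induction k rule: less_induct)
    case (less k)
    have "\<not> m k > m' k" by (rule step) (use less m m' fin card in auto)
    moreover have "\<not> m' k > m k" by (rule step) (use less m m' fin card in auto)
    ultimately show ?case by simp
  qed
  then show ?thesis by auto
qed

section \<open>Functions as vectors\<close>

instantiation "fun" :: (type, real_vector) real_vector
begin

definition scaleR_fun :: "real \<Rightarrow> ('a \<Rightarrow> 'b) \<Rightarrow> 'a \<Rightarrow> 'b" where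
  "scaleR_fun c f = (\<lambda>x. c *\<^sub>R f x)"

instance
  by standard (simp_all add: scaleR_fun_def fun_eq_iff scaleR_add_right scaleR_add_left)

end

lemma scaleR_fun_apply [simp]: "(c *\<^sub>R f) x = c *\<^sub>R f x"
  by (simp add: scaleR_fun_def)

lemma sum_fun_apply: "(\<Sum>i\<in>I. f i) x = (\<Sum>i\<in>I. f i x)"
  for f :: "'i \<Rightarrow> 'a \<Rightarrow> 'b::comm_monoid_add"
  by (induction I rule: infinite_finite_induct) auto

section \<open>Square-integrable functions\<close>

lemma integrable_mult_of_squares:
  fixes f g :: "'a \<Rightarrow> real"
  assumes [measurable]: "f \<in> borel_measurable M" "g \<in> borel_measurable M"
    and "integrable M (\<lambda>x. (f x)\<^sup>2)" "integrable M (\<lambda>x. (g x)\<^sup>2)"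
  shows "integrable M (\<lambda>x. f x * g x)"
proof (rule Bochner_Integration.integrable_bound)
  show "integrable M (\<lambda>x. (f x)\<^sup>2 + (g x)\<^sup>2)" using assms by simp
  have "\<bar>a * b\<bar> \<le> a\<^sup>2 + b\<^sup>2" for a b :: real
  proof -
    have "2 * (\<bar>a\<bar> * \<bar>b\<bar>) \<le> a\<^sup>2 + b\<^sup>2" using sum_squares_bound[of "\<bar>a\<bar>" "\<bar>b\<bar>"] by (simp add: mult.assoc)
    moreover have "0 \<le> \<bar>a\<bar> * \<bar>b\<bar>" by simp
    ultimately show ?thesis unfolding abs_mult by linarith
  qed
  then show "AE x in M. norm (f x * g x) \<le> norm ((f x)\<^sup>2 + (g x)\<^sup>2)" by simp
qed measurable

lemma integrable_square_add:
  fixes f g :: "'a \<Rightarrow> real"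
  assumes "f \<in> borel_measurable M" "g \<in> borel_measurable M"
    and "integrable M (\<lambda>x. (f x)\<^sup>2)" "integrable M (\<lambda>x. (g x)\<^sup>2)"
  shows "integrable M (\<lambda>x. (f x + g x)\<^sup>2)"
  using assms integrable_mult_of_squares[OF assms]
  by (simp add: power2_sum mult.assoc)

lemma integral_Cauchy_Schwarz:
  fixes f g :: "'a \<Rightarrow> real"
  assumes m: "f \<in> borel_measurable M" "g \<in> borel_measurable M"
    and i: "integrable M (\<lambda>x. (f x)\<^sup>2)" "integrable M (\<lambda>x. (g x)\<^sup>2)"
  shows "\<bar>\<integral>x. f x * g x \<partial>M\<bar> \<le> sqrt (\<integral>x. (f x)\<^sup>2 \<partial>M) * sqrt (\<integral>x. (g x)\<^sup>2 \<partial>M)"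
proof -
  have fg: "integrable M (\<lambda>x. f x * g x)" by (rule integrable_mult_of_squares[OF m i])
  let ?a = "\<integral>x. (f x)\<^sup>2 \<partial>M" and ?b = "\<integral>x. f x * g x \<partial>M" and ?c = "\<integral>x. (g x)\<^sup>2 \<partial>M"
  have q: "0 \<le> ?a - 2 * t * ?b + t\<^sup>2 * ?c" for t
  proof -
    have "0 \<le> (\<integral>x. (f x - t * g x)\<^sup>2 \<partial>M)" by (rule integral_nonneg_AE) simp
    also have "(\<lambda>x. (f x - t * g x)\<^sup>2) = (\<lambda>x. ((f x)\<^sup>2 - (2 * t) * (f x * g x)) + t\<^sup>2 * (g x)\<^sup>2)"
      by (auto simp: power2_eq_square algebra_simps)
    also have "(\<integral>x. ((f x)\<^sup>2 - (2 * t) * (f x * g x)) + t\<^sup>2 * (g x)\<^sup>2 \<partial>M) = ?a - 2 * t * ?b + t\<^sup>2 * ?c"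
      using fg i by simp
    finally show ?thesis .
  qed
  have c0: "?c \<ge> 0" by simp
  have "?b\<^sup>2 \<le> ?a * ?c"
  proof (cases "?c = 0")
    case True
    have "?b = 0"
    proof (rule ccontr)
      assume b: "?b \<noteq> 0"
      then show False using q[of "(?a + 1) / (2 * ?b)"] True by (auto simp: field_simps)
    qed
    then show ?thesis by (simp add: True)
  next
    case False
    then have "0 < ?c" using c0 by linarith
    then show ?thesis using q[of "?b / ?c"] by (simp add: field_simps power2_eq_square)
  qed
  then show ?thesis using real_le_rsqrt[of "\<bar>?b\<bar>" "?a * ?c"] by (simp add: real_sqrt_mult)
qed

text \<open>Fatou's lemma, in the form in which limits of bounded sequences inherit the bound.\<close>

lemma nn_integral_square_le_of_tendsto:
  fixes h :: "nat \<Rightarrow> 'a \<Rightarrow> real"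
  assumes [measurable]: "\<And>j. h j \<in> borel_measurable M"
    and lim: "AE x in M. (\<lambda>j. h j x) \<longlonglongrightarrow> g x"
    and le: "\<And>j. j \<ge> J \<Longrightarrow> (\<integral>\<^sup>+x. ennreal ((h j x)\<^sup>2) \<partial>M) \<le> c"
  shows "(\<integral>\<^sup>+x. ennreal ((g x)\<^sup>2) \<partial>M) \<le> c"
proof -
  have "(\<integral>\<^sup>+x. ennreal ((g x)\<^sup>2) \<partial>M) = (\<integral>\<^sup>+x. liminf (\<lambda>j. ennreal ((h j x)\<^sup>2)) \<partial>M)"
  proof (rule nn_integral_cong_AE)
    show "AE x in M. ennreal ((g x)\<^sup>2) = liminf (\<lambda>j. ennreal ((h j x)\<^sup>2))"
      using lim
    proof eventually_elim
      case (elim x)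
      have "(\<lambda>j. ennreal ((h j x)\<^sup>2)) \<longlonglongrightarrow> ennreal ((g x)\<^sup>2)"
        by (intro tendsto_ennrealI tendsto_power elim)
      then show ?case using lim_imp_Liminf[OF sequentially_bot] by metis
    qed
  qed
  also have "\<dots> \<le> liminf (\<lambda>j. \<integral>\<^sup>+x. ennreal ((h j x)\<^sup>2) \<partial>M)"
    by (rule nn_integral_liminf) measurable
  also have "\<dots> \<le> c"
  proof -
    have "liminf (\<lambda>j. \<integral>\<^sup>+x. ennreal ((h j x)\<^sup>2) \<partial>M) \<le> limsup (\<lambda>j. \<integral>\<^sup>+x. ennreal ((h j x)\<^sup>2) \<partial>M)"
      by (rule Liminf_le_Limsup) simp
    also have "\<dots> \<le> c" by (rule Limsup_bounded) (use le eventually_sequentially in auto)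
    finally show ?thesis .
  qed
  finally show ?thesis .
qed

lemma integrable_square_iff_nn_integral:
  fixes f :: "'a \<Rightarrow> real"
  assumes "f \<in> borel_measurable M"
  shows "integrable M (\<lambda>x. (f x)\<^sup>2) \<longleftrightarrow> (\<integral>\<^sup>+x. ennreal ((f x)\<^sup>2) \<partial>M) < \<infinity>"
  using assms by (subst integrable_iff_bounded) auto

section \<open>Lebesgue measure on the product space\<close>

lemma AE_lebesgue_iff: "(AE x in lebesgue. P x) \<longleftrightarrow> (AE x in lborel. P x)"
  by (rule AE_completion_iff)

lemma pair_sigma_finite_lborel: "pair_sigma_finite lborel lborel"
  by (simp add: pair_sigma_finite_def lborel.sigma_finite_measure_axioms)

lemma AE_lebesgue_fst:
  fixes P :: "'a::euclidean_space \<Rightarrow> bool"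
  assumes "AE x in lebesgue. P x"
  shows "AE z :: 'a \<times> 'b::euclidean_space in lebesgue. P (fst z)"
proof -
  obtain N where N: "N \<in> null_sets lborel" "{x. \<not> P x} \<subseteq> N"
    using assms[unfolded AE_lebesgue_iff] unfolding eventually_ae_filter by auto
  have "N \<times> (UNIV :: 'b set) \<in> null_sets (lborel \<Otimes>\<^sub>M lborel)"
    using N(1) by (auto simp: null_sets_def lborel.emeasure_pair_measure_Times)
  then have "N \<times> (UNIV :: 'b set) \<in> null_sets lborel" by (simp add: lborel_prod)
  then show ?thesis unfolding AE_lebesgue_iff by (rule AE_I') (use N in auto)
qed

lemma AE_lebesgue_snd:
  fixes P :: "'b::euclidean_space \<Rightarrow> bool"
  assumes "AE x in lebesgue. P x"
  shows "AE z :: 'a::euclidean_space \<times> 'b in lebesgue. P (snd z)"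
proof -
  obtain N where N: "N \<in> null_sets lborel" "{x. \<not> P x} \<subseteq> N"
    using assms[unfolded AE_lebesgue_iff] unfolding eventually_ae_filter by auto
  have "(UNIV :: 'a set) \<times> N \<in> null_sets (lborel \<Otimes>\<^sub>M lborel)"
    using N(1) by (auto simp: null_sets_def lborel.emeasure_pair_measure_Times)
  then have "(UNIV :: 'a set) \<times> N \<in> null_sets lborel" by (simp add: lborel_prod)
  then show ?thesis unfolding AE_lebesgue_iff by (rule AE_I') (use N in auto)
qed

lemma lebesgue_borel_version:
  fixes u :: "'a::euclidean_space \<Rightarrow> real"
  assumes "u \<in> borel_measurable lebesgue"
  shows "\<exists>v\<in>borel_measurable borel. AE x in lebesgue. u x = v x"
  using completion_ex_borel_measurable_real[OF assms] by (simp add: AE_lebesgue_iff)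

lemma borel_imp_lebesgue:
  "f \<in> borel_measurable borel \<Longrightarrow> f \<in> borel_measurable lebesgue"
  by (rule measurable_completion) simp

text \<open>The completed product measure is larger than the product of the completed measures, so measurability
of \<open>u (fst z)\<close> is obtained from a Borel function that agrees with \<open>u\<close> almost everywhere.\<close>

lemma borel_measurable_lebesgue_fst:
  fixes u :: "'a::euclidean_space \<Rightarrow> real"
  assumes "u \<in> borel_measurable lebesgue"
  shows "(\<lambda>z :: 'a \<times> 'b::euclidean_space. u (fst z)) \<in> borel_measurable lebesgue"
proof -
  obtain v where v: "v \<in> borel_measurable borel" "AE x in lebesgue. u x = v x"
    using lebesgue_borel_version[OF assms] by blast
  have "(\<lambda>z :: 'a \<times> 'b. v (fst z)) \<in> borel_measurable lebesgue"
    using v(1) by (intro borel_imp_lebesgue) (simp add: borel_prod[symmetric])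
  then show ?thesis
    by (rule borel_measurable_AE) (use AE_lebesgue_fst[OF v(2)] in \<open>auto simp: eq_commute\<close>)
qed

lemma borel_measurable_lebesgue_snd:
  fixes u :: "'b::euclidean_space \<Rightarrow> real"
  assumes "u \<in> borel_measurable lebesgue"
  shows "(\<lambda>z :: 'a::euclidean_space \<times> 'b. u (snd z)) \<in> borel_measurable lebesgue"
proof -
  obtain v where v: "v \<in> borel_measurable borel" "AE x in lebesgue. u x = v x"
    using lebesgue_borel_version[OF assms] by blast
  have "(\<lambda>z :: 'a \<times> 'b. v (snd z)) \<in> borel_measurable lebesgue"
    using v(1) by (intro borel_imp_lebesgue) (simp add: borel_prod[symmetric])
  then show ?thesis
    by (rule borel_measurable_AE) (use AE_lebesgue_snd[OF v(2)] in \<open>auto simp: eq_commute\<close>)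
qed

lemma nn_integral_lebesgue_prod:
  fixes F :: "'a::euclidean_space \<times> 'b::euclidean_space \<Rightarrow> ennreal"
  assumes "F \<in> borel_measurable borel"
  shows "(\<integral>\<^sup>+z. F z \<partial>lebesgue) = (\<integral>\<^sup>+x. \<integral>\<^sup>+y. F (x, y) \<partial>lborel \<partial>lborel)"
proof -
  have "(\<integral>\<^sup>+z. F z \<partial>lebesgue) = (\<integral>\<^sup>+z. F z \<partial>(lborel \<Otimes>\<^sub>M lborel))"
    by (simp add: nn_integral_completion lborel_prod)
  also have "\<dots> = (\<integral>\<^sup>+x. \<integral>\<^sup>+y. F (x, y) \<partial>lborel \<partial>lborel)"
    using assms by (intro lborel.nn_integral_fst[symmetric]) (simp add: lborel_prod)
  finally show ?thesis .
qed

section \<open>The fractional Sobolev space as a complete semi-inner-product space\<close>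

text \<open>Distributing the kernel evenly between the two factors turns \<open>H0s_inner\<close> into an \<open>L\<^sup>2\<close> inner product,
for which linearity and the Cauchy-Schwarz inequality are immediate.\<close>

definition fgrad :: "real \<Rightarrow> ('a::euclidean_space \<Rightarrow> real) \<Rightarrow> 'a \<times> 'a \<Rightarrow> real" where
  "fgrad s u z = (u (fst z) - u (snd z)) / sqrt (norm (fst z - snd z) powr (real DIM('a) + 2 * s))"

lemma fgrad_mult:
  "fgrad s u z * fgrad s v z =
    (u (fst z) - u (snd z)) * (v (fst z) - v (snd z)) / norm (fst z - snd z) powr (real DIM('a) + 2 * s)"
  for z :: "'a::euclidean_space \<times> 'a"
  by (simp add: fgrad_def times_divide_times_eq flip: real_sqrt_mult power2_eq_square)

lemma fgrad_square:
  "(fgrad s u z)\<^sup>2 = (u (fst z) - u (snd z))\<^sup>2 / norm (fst z - snd z) powr (real DIM('a) + 2 * s)"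
  for z :: "'a::euclidean_space \<times> 'a"
  by (simp add: power2_eq_square fgrad_mult)

lemma fgrad_add: "fgrad s (u + v) z = fgrad s u z + fgrad s v z"
  and fgrad_scale: "fgrad s (c *\<^sub>R u) z = c * fgrad s u z"
  and fgrad_zero: "fgrad s (\<lambda>x. 0) z = 0"
  by (simp_all add: fgrad_def add_divide_distrib diff_divide_distrib algebra_simps)

lemma H0s_inner_fgrad: "H0s_inner s u v = (\<integral>z. fgrad s u z * fgrad s v z \<partial>lebesgue)"
  by (simp add: H0s_inner_def fgrad_mult case_prod_unfold)

lemma H0s_inner_self: "H0s_inner s u u = (\<integral>z. (fgrad s u z)\<^sup>2 \<partial>lebesgue)"
  by (simp add: H0s_inner_fgrad power2_eq_square)

lemma Hs_iff:
  "u \<in> Hs s \<longleftrightarrow> u \<in> borel_measurable lebesgue \<and> integrable lebesgue (\<lambda>x. (u x)\<^sup>2) \<and>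
     integrable lebesgue (\<lambda>z. (fgrad s u z)\<^sup>2)"
  by (simp add: Hs_def fgrad_square case_prod_unfold)

lemma borel_measurable_fgrad_borel:
  fixes u :: "'a::euclidean_space \<Rightarrow> real"
  assumes [measurable]: "u \<in> borel_measurable borel"
  shows "fgrad s u \<in> borel_measurable borel"
  unfolding fgrad_def[abs_def] borel_prod[symmetric] by measurable

lemma borel_measurable_fgrad:
  fixes u :: "'a::euclidean_space \<Rightarrow> real"
  assumes "u \<in> borel_measurable lebesgue"
  shows "fgrad s u \<in> borel_measurable lebesgue"
proof -
  have [measurable]: "(\<lambda>z :: 'a \<times> 'a. u (fst z)) \<in> borel_measurable lebesgue"
    "(\<lambda>z :: 'a \<times> 'a. u (snd z)) \<in> borel_measurable lebesgue"
    by (rule borel_measurable_lebesgue_fst borel_measurable_lebesgue_snd assms)+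
  have [measurable]: "(\<lambda>z :: 'a \<times> 'a. sqrt (norm (fst z - snd z) powr (real DIM('a) + 2 * s))) \<in> borel_measurable lebesgue"
    by (rule borel_imp_lebesgue) (simp add: borel_prod[symmetric])
  show ?thesis unfolding fgrad_def[abs_def] by measurable
qed

lemma AE_fgrad_cong:
  assumes "AE x in lebesgue. u x = v x"
  shows "AE z in lebesgue. fgrad s u z = fgrad s v z"
  using AE_lebesgue_fst[OF assms] AE_lebesgue_snd[OF assms]
  by eventually_elim (simp add: fgrad_def)

lemma Hs_cong_AE:
  assumes u: "u \<in> Hs s" and uv: "AE x in lebesgue. u x = v x"
  shows "v \<in> Hs s"
proof -
  have v: "v \<in> borel_measurable lebesgue"
    using u uv by (auto simp: Hs_iff intro: borel_measurable_AE)
  have "integrable lebesgue (\<lambda>x. (v x)\<^sup>2)"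
    by (rule integrable_cong_AE_imp[where g = "\<lambda>x. (u x)\<^sup>2"]) (use u v uv in \<open>auto simp: Hs_iff\<close>)
  moreover have "integrable lebesgue (\<lambda>z. (fgrad s v z)\<^sup>2)"
    by (rule integrable_cong_AE_imp[where g = "\<lambda>x. (fgrad s u x)\<^sup>2"])
      (use u borel_measurable_fgrad[OF v] AE_fgrad_cong[OF uv, of s] in \<open>auto simp: Hs_iff\<close>)
  ultimately show ?thesis using v by (simp add: Hs_iff)
qed

lemma H0s_cong_AE:
  assumes u: "u \<in> H0s s \<Omega>" and uv: "AE x in lebesgue. u x = v x"
  shows "v \<in> H0s s \<Omega>"
  using u Hs_cong_AE[OF _ uv] uv unfolding H0s_def by auto

lemma H0s_inner_cong_AE:
  assumes m: "u \<in> borel_measurable lebesgue" "u' \<in> borel_measurable lebesgue"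
    "v \<in> borel_measurable lebesgue" "v' \<in> borel_measurable lebesgue"
    and ae: "AE x in lebesgue. u x = u' x" "AE x in lebesgue. v x = v' x"
  shows "H0s_inner s u v = H0s_inner s u' v'"
  unfolding H0s_inner_fgrad
proof (rule integral_cong_AE)
  show "AE z in lebesgue. fgrad s u z * fgrad s v z = fgrad s u' z * fgrad s v' z"
    using AE_fgrad_cong[OF ae(1), of s] AE_fgrad_cong[OF ae(2), of s] by eventually_elim simp
qed (use m[THEN borel_measurable_fgrad, of s] in auto)

lemma H0s_D:
  assumes "u \<in> H0s s \<Omega>"
  shows "u \<in> borel_measurable lebesgue" "integrable lebesgue (\<lambda>x. (u x)\<^sup>2)"
    "fgrad s u \<in> borel_measurable lebesgue" "integrable lebesgue (\<lambda>z. (fgrad s u z)\<^sup>2)"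
    "AE x in lebesgue. x \<notin> \<Omega> \<longrightarrow> u x = 0"
  using assms borel_measurable_fgrad by (auto simp: H0s_def Hs_iff)

lemma integrable_fgrad_mult:
  "u \<in> H0s s \<Omega> \<Longrightarrow> v \<in> H0s s \<Omega> \<Longrightarrow> integrable lebesgue (\<lambda>z. fgrad s u z * fgrad s v z)"
  by (intro integrable_mult_of_squares H0s_D)

lemma subspace_H0s: "subspace (H0s s \<Omega>)"
  unfolding subspace_def
proof (intro conjI ballI allI)
  show "0 \<in> H0s s \<Omega>" by (simp add: H0s_def Hs_iff fgrad_zero zero_fun_def)
next
  fix u v assume u: "u \<in> H0s s \<Omega>" and v: "v \<in> H0s s \<Omega>"
  have "integrable lebesgue (\<lambda>x. ((u + v) x)\<^sup>2)"
    using integrable_square_add[OF H0s_D(1)[OF u] H0s_D(1)[OF v] H0s_D(2)[OF u] H0s_D(2)[OF v]] by simp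
  moreover have "integrable lebesgue (\<lambda>z. (fgrad s (u + v) z)\<^sup>2)"
    using integrable_square_add[OF H0s_D(3)[OF u] H0s_D(3)[OF v] H0s_D(4)[OF u] H0s_D(4)[OF v]]
    by (simp add: fgrad_add)
  moreover have "(u + v) \<in> borel_measurable lebesgue"
    using H0s_D(1)[OF u] H0s_D(1)[OF v] by (simp add: plus_fun_def)
  moreover have "AE x in lebesgue. x \<notin> \<Omega> \<longrightarrow> (u + v) x = 0"
    using H0s_D(5)[OF u] H0s_D(5)[OF v] by eventually_elim simp
  ultimately show "u + v \<in> H0s s \<Omega>" by (simp add: H0s_def Hs_iff)
next
  fix c u assume u: "u \<in> H0s s \<Omega>"
  have "integrable lebesgue (\<lambda>x. ((c *\<^sub>R u) x)\<^sup>2)" using H0s_D(2)[OF u] by (simp add: power_mult_distrib)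
  moreover have "integrable lebesgue (\<lambda>z. (fgrad s (c *\<^sub>R u) z)\<^sup>2)"
    using H0s_D(4)[OF u] by (simp add: fgrad_scale power_mult_distrib)
  moreover have "(c *\<^sub>R u) \<in> borel_measurable lebesgue" using H0s_D(1)[OF u] by (simp add: scaleR_fun_def)
  moreover have "AE x in lebesgue. x \<notin> \<Omega> \<longrightarrow> (c *\<^sub>R u) x = 0" using H0s_D(5)[OF u] by eventually_elim simp
  ultimately show "c *\<^sub>R u \<in> H0s s \<Omega>" by (simp add: H0s_def Hs_iff)
qed

lemma pos_form_H0s: "pos_form (H0s s \<Omega>) (H0s_inner s)"
proof unfold_locales
  show "subspace (H0s s \<Omega>)" by (rule subspace_H0s)
  fix f g h and c :: real assume f: "f \<in> H0s s \<Omega>" and g: "g \<in> H0s s \<Omega>"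
  show "H0s_inner s (f + g) h = H0s_inner s f h + H0s_inner s g h" if h: "h \<in> H0s s \<Omega>"
    using integrable_fgrad_mult[OF f h] integrable_fgrad_mult[OF g h]
    by (simp add: H0s_inner_fgrad fgrad_add distrib_right)
  show "H0s_inner s (c *\<^sub>R f) g = c * H0s_inner s f g"
    by (simp add: H0s_inner_fgrad fgrad_scale mult.assoc)
  show "H0s_inner s f g = H0s_inner s g f" by (simp add: H0s_inner_fgrad mult.commute)
  show "0 \<le> H0s_inner s f f" by (simp add: H0s_inner_self)
qed

lemma energy_nn_integral:
  "u \<in> H0s s \<Omega> \<Longrightarrow> (\<integral>\<^sup>+z. ennreal ((fgrad s u z)\<^sup>2) \<partial>lebesgue) = ennreal (H0s_inner s u u)"
  unfolding H0s_inner_self by (rule nn_integral_eq_integral) (auto dest: H0s_D)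

locale fractional_setting =
  fixes s :: real and \<Omega> :: "'a::euclidean_space set"
  assumes s: "0 < s" "s < 1" and open_\<Omega>: "open \<Omega>" and bounded_\<Omega>: "bounded \<Omega>"
begin

abbreviation "V \<equiv> H0s s \<Omega>"
abbreviation "B \<equiv> H0s_inner s :: ('a \<Rightarrow> real) \<Rightarrow> ('a \<Rightarrow> real) \<Rightarrow> real"

sublocale pos_form V B by (rule pos_form_H0s)

lemma \<Omega>_borel [measurable]: "\<Omega> \<in> sets borel" using open_\<Omega> by simp

lemma \<Omega>_lebesgue [measurable]: "\<Omega> \<in> sets lebesgue" using \<Omega>_borel by simp

lemma emeasure_\<Omega>_finite: "emeasure lebesgue \<Omega> < \<infinity>"
  using bounded_\<Omega> emeasure_bounded_finite[of \<Omega>] by (simp add: emeasure_completion)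

text \<open>Iterated integrals require Borel functions; all quantities of interest are invariant under this
change of representative.\<close>

lemma borel_representative:
  assumes "u \<in> V"
  shows "\<exists>v\<in>V. v \<in> borel_measurable borel \<and> (\<forall>x. x \<notin> \<Omega> \<longrightarrow> v x = 0) \<and> (AE x in lebesgue. u x = v x)"
proof -
  obtain w where w[measurable]: "w \<in> borel_measurable borel" and uw: "AE x in lebesgue. u x = w x"
    using lebesgue_borel_version[OF H0s_D(1)[OF assms]] by blast
  define v where "v x = indicator \<Omega> x * w x" for x
  have "v \<in> borel_measurable borel" unfolding v_def[abs_def] by measurable
  moreover have uv: "AE x in lebesgue. u x = v x"
    using uw H0s_D(5)[OF assms] by eventually_elim (auto simp: v_def indicator_def)
  moreover have "v \<in> V" by (rule H0s_cong_AE[OF assms uv])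
  ultimately show ?thesis by (intro bexI[of _ v]) (auto simp: v_def)
qed

lemma B_cong_AE:
  assumes "u \<in> V" "v \<in> V" "AE x in lebesgue. u x = u' x" "AE x in lebesgue. v x = v' x"
  shows "B u v = B u' v'"
  using assms H0s_cong_AE[OF assms(1,3)] H0s_cong_AE[OF assms(2,4)]
  by (intro H0s_inner_cong_AE) (auto dest: H0s_D)

text \<open>Members of the space vanish on a ball outside \<open>\<Omega>\<close>, so the interaction of \<open>\<Omega>\<close> with that ball alone
contributes a multiple of \<open>\<integral> u\<^sup>2\<close> to the energy.\<close>

lemma Poincare: "\<exists>C>0. \<forall>u\<in>V. (\<integral>x. (u x)\<^sup>2 \<partial>lebesgue) \<le> C * B u u"
proof -
  obtain R where R: "R > 0" "\<And>x. x \<in> \<Omega> \<Longrightarrow> norm x < R"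
    using bounded_\<Omega> by (auto simp: bounded_pos_less)
  obtain b :: 'a where b: "b \<in> Basis" using nonempty_Basis by blast
  \<comment> \<open>The unit ball around p lies outside the ball of radius R, and its distances to points of that ball stay below 2 R + 2.\<close>
  define p where "p = (R + 1) *\<^sub>R b"
  have np: "norm p = R + 1" using b R by (simp add: p_def)
  define D where "D = (2 * R + 2) powr (real DIM('a) + 2 * s)"
  have D: "D > 0" using R by (simp add: D_def)
  define \<beta> where "\<beta> = measure lborel (ball p 1)"
  have \<beta>: "\<beta> > 0" using content_ball_gt_0_iff[of p 1] by (simp add: \<beta>_def)
  have e\<beta>: "emeasure lborel (ball p 1) = ennreal \<beta>"
    unfolding \<beta>_def using emeasure_lborel_ball_finite[of p 1]
    by (intro emeasure_eq_ennreal_measure) auto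
  have main: "(\<integral>x. (v x)\<^sup>2 \<partial>lebesgue) * (\<beta> / D) \<le> B v v"
    if v: "v \<in> V" and vm[measurable]: "v \<in> borel_measurable borel" and v0: "\<And>x. x \<notin> \<Omega> \<Longrightarrow> v x = 0" for v
  proof -
    have fm: "fgrad s v \<in> borel_measurable borel" by (rule borel_measurable_fgrad_borel[OF vm])
    have pw: "(v x)\<^sup>2 / D * indicator (ball p 1) y \<le> (fgrad s v (x, y))\<^sup>2" for x y
    proof (cases "x \<in> \<Omega> \<and> y \<in> ball p 1")
      case True
      then have "norm p < norm y + 1" using norm_triangle_ineq2[of p y] by (auto simp: dist_norm)
      then have y: "R < norm y" using np by simp
      have y2: "norm y < R + 2" using True np norm_triangle_ineq2[of y p] by (auto simp: dist_norm norm_minus_commute)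
      have "y \<notin> \<Omega>" using R(2)[of y] y by auto
      then have vy: "v y = 0" by (rule v0)
      have "norm x < R" using R True by auto
      then have "x \<noteq> y" "norm (x - y) \<le> 2 * R + 2" using y y2 norm_triangle_ineq4[of x y] by auto
      then have pos: "0 < norm (x - y) powr (real DIM('a) + 2 * s)" and le: "norm (x - y) powr (real DIM('a) + 2 * s) \<le> D"
        unfolding D_def using s by (auto intro!: powr_mono2)
      have "(v x)\<^sup>2 / D \<le> (v x)\<^sup>2 / norm (x - y) powr (real DIM('a) + 2 * s)"
        using pos le D by (intro divide_left_mono) auto
      then show ?thesis using True by (simp add: fgrad_square vy)
    next
      case False
      then show ?thesis by (auto simp: v0)
    qed
    have "ennreal (B v v) = (\<integral>\<^sup>+x. \<integral>\<^sup>+y. ennreal ((fgrad s v (x, y))\<^sup>2) \<partial>lborel \<partial>lborel)"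
      using fm by (subst energy_nn_integral[OF v, symmetric], subst nn_integral_lebesgue_prod) auto
    also have "\<dots> \<ge> (\<integral>\<^sup>+x. \<integral>\<^sup>+y. ennreal ((v x)\<^sup>2 / D) * indicator (ball p 1) y \<partial>lborel \<partial>lborel)"
    proof (intro nn_integral_mono)
      fix x y :: 'a
      show "ennreal ((v x)\<^sup>2 / D) * indicator (ball p 1) y \<le> ennreal ((fgrad s v (x, y))\<^sup>2)"
        using pw[of x y] ennreal_leI[OF pw[of x y]] D by (auto simp: indicator_def)
    qed
    also have "(\<integral>\<^sup>+x. \<integral>\<^sup>+y. ennreal ((v x)\<^sup>2 / D) * indicator (ball p 1) y \<partial>lborel \<partial>lborel) =
        (\<integral>\<^sup>+x. ennreal ((v x)\<^sup>2) * ennreal (\<beta> / D) \<partial>lborel)"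
    proof (rule nn_integral_cong)
      fix x
      have "(\<integral>\<^sup>+y. ennreal ((v x)\<^sup>2 / D) * indicator (ball p 1) y \<partial>lborel) = ennreal ((v x)\<^sup>2 / D) * ennreal \<beta>"
        using e\<beta> by (subst nn_integral_cmult_indicator) auto
      also have "\<dots> = ennreal ((v x)\<^sup>2) * ennreal (\<beta> / D)"
        using D \<beta> by (simp flip: ennreal_mult)
      finally show "(\<integral>\<^sup>+y. ennreal ((v x)\<^sup>2 / D) * indicator (ball p 1) y \<partial>lborel) = ennreal ((v x)\<^sup>2) * ennreal (\<beta> / D)" .
    qed
    also have "\<dots> = (\<integral>\<^sup>+x. ennreal ((v x)\<^sup>2) \<partial>lborel) * ennreal (\<beta> / D)"
      by (rule nn_integral_multc) measurable
    also have "(\<integral>\<^sup>+x. ennreal ((v x)\<^sup>2) \<partial>lborel) = ennreal (\<integral>x. (v x)\<^sup>2 \<partial>lebesgue)"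
      using nn_integral_eq_integral[OF H0s_D(2)[OF v]] by (simp add: nn_integral_completion)
    finally show ?thesis using \<beta> D nonneg[OF v] by (simp flip: ennreal_mult add: ennreal_le_iff)
  qed
  have "(\<integral>x. (u x)\<^sup>2 \<partial>lebesgue) \<le> D / \<beta> * B u u" if u: "u \<in> V" for u
  proof -
    obtain v where v: "v \<in> V" "v \<in> borel_measurable borel" "\<And>x. x \<notin> \<Omega> \<Longrightarrow> v x = 0"
      and uv: "AE x in lebesgue. u x = v x" using borel_representative[OF u] by blast
    have "(\<integral>x. (u x)\<^sup>2 \<partial>lebesgue) = (\<integral>x. (v x)\<^sup>2 \<partial>lebesgue)"
      by (rule integral_cong_AE) (use H0s_D(1)[OF u] H0s_D(1)[OF v(1)] uv in auto)
    moreover have "B u u = B v v" by (rule B_cong_AE[OF u u uv uv])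
    ultimately show ?thesis using main[OF v] \<beta> D by (simp add: field_simps)
  qed
  then show ?thesis using \<beta> D by (intro exI[of _ "D / \<beta>"]) auto
qed

definition "Poincare_const = (SOME C. C > 0 \<and> (\<forall>u\<in>V. (\<integral>x. (u x)\<^sup>2 \<partial>lebesgue) \<le> C * B u u))"

lemma Poincare_const_pos: "Poincare_const > 0"
  and Poincare_ineq: "u \<in> V \<Longrightarrow> (\<integral>x. (u x)\<^sup>2 \<partial>lebesgue) \<le> Poincare_const * B u u"
proof -
  have "Poincare_const > 0 \<and> (\<forall>u\<in>V. (\<integral>x. (u x)\<^sup>2 \<partial>lebesgue) \<le> Poincare_const * B u u)"
    unfolding Poincare_const_def by (rule someI_ex) (use Poincare in blast)
  then show "Poincare_const > 0"
    "u \<in> V \<Longrightarrow> (\<integral>x. (u x)\<^sup>2 \<partial>lebesgue) \<le> Poincare_const * B u u" by auto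
qed

lemma B_eq_0_iff:
  assumes u: "u \<in> V"
  shows "B u u = 0 \<longleftrightarrow> (AE x in lebesgue. u x = 0)"
proof
  assume "B u u = 0"
  then have "(\<integral>x. (u x)\<^sup>2 \<partial>lebesgue) \<le> 0" using Poincare_ineq[OF u] by simp
  moreover have "0 \<le> (\<integral>x. (u x)\<^sup>2 \<partial>lebesgue)" by (rule integral_nonneg_AE) simp
  ultimately have "(\<integral>x. (u x)\<^sup>2 \<partial>lebesgue) = 0" by simp
  moreover have "(\<integral>x. (u x)\<^sup>2 \<partial>lebesgue) = 0 \<longleftrightarrow> (AE x in lebesgue. (u x)\<^sup>2 = 0)"
    by (rule integral_nonneg_eq_0_iff_AE[OF H0s_D(2)[OF u]]) simp
  ultimately have "AE x in lebesgue. (u x)\<^sup>2 = 0" by blast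
  then show "AE x in lebesgue. u x = 0" by eventually_elim simp
next
  assume *: "AE x in lebesgue. u x = 0"
  have "B u u = B (\<lambda>x. 0) (\<lambda>x. 0)" by (rule B_cong_AE[OF u u * *])
  also have "\<dots> = 0" by (simp add: H0s_inner_fgrad fgrad_zero)
  finally show "B u u = 0" .
qed

lemma nn_integral_square_le:
  "u \<in> V \<Longrightarrow> (\<integral>\<^sup>+x. ennreal ((u x)\<^sup>2) \<partial>lebesgue) \<le> ennreal (Poincare_const * B u u)"
  using nn_integral_eq_integral[OF H0s_D(2)[of u s \<Omega>]] Poincare_ineq[of u] by (simp add: ennreal_leI)

text \<open>A subsequence with geometrically decreasing increments converges almost everywhere, because the
increments are summable in \<open>L\<^sup>1(\<Omega>)\<close>. Fatou's lemma, applied to the fractional gradients, turns this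
into convergence in energy of the whole sequence.\<close>

lemma complete_H0s:
  fixes f :: "nat \<Rightarrow> 'a \<Rightarrow> real"
  assumes f: "\<And>n. f n \<in> V"
    and Cauchy: "\<And>e. e > 0 \<Longrightarrow> \<exists>N. \<forall>m\<ge>N. \<forall>n\<ge>N. B (f m - f n) (f m - f n) < e"
  shows "\<exists>g\<in>V. (\<lambda>n. B (f n - g) (f n - g)) \<longlonglongrightarrow> 0"
proof -
  have [measurable]: "f n \<in> borel_measurable lebesgue" for n by (rule H0s_D(1)[OF f])
  have "\<forall>k. \<exists>N. \<forall>m\<ge>N. \<forall>n\<ge>N. B (f m - f n) (f m - f n) < (1 / 4) ^ k"
    using Cauchy by simp
  then obtain N where N: "\<And>k m n. m \<ge> N k \<Longrightarrow> n \<ge> N k \<Longrightarrow> B (f m - f n) (f m - f n) < (1 / 4) ^ k"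
    by metis
  define r where "r k = (\<Sum>i\<le>k. N i) + k" for k
  have rN: "N k \<le> r k" "N k \<le> r (Suc k)" "k \<le> r k" for k
  proof -
    have "N k \<le> (\<Sum>i\<le>k. N i)" by (rule member_le_sum) auto
    then show "N k \<le> r k" "N k \<le> r (Suc k)" "k \<le> r k" by (auto simp: r_def)
  qed
  define d where "d k = f (r (Suc k)) - f (r k)" for k
  have dV: "d k \<in> V" for k unfolding d_def by (intro mem f)
  have dB: "B (d k) (d k) < (1 / 4) ^ k" for k unfolding d_def by (rule N) (rule rN)+
  define C where "C = Poincare_const"
  have C: "C > 0" by (simp add: C_def Poincare_const_pos)
  let ?m = "measure lebesgue \<Omega>"
  have m: "emeasure lebesgue \<Omega> = ennreal ?m"
    using emeasure_\<Omega>_finite by (intro emeasure_eq_ennreal_measure) auto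
  have [measurable]: "d k \<in> borel_measurable lebesgue" for k by (rule H0s_D(1)[OF dV])
  have dL1: "(\<integral>\<^sup>+x. ennreal \<bar>d k x\<bar> \<partial>lebesgue) \<le> ennreal ((?m + C) * (1 / 2) ^ k)" for k
  proof -
    \<comment> \<open>The weights are chosen such that the constant, integrated over the domain, and the square, bounded by the energy, are both geometrically small.\<close>
    have am_gm: "\<bar>t\<bar> \<le> (1 / 2) ^ k + 2 ^ k * t\<^sup>2" for t :: real
    proof -
      have "0 \<le> ((1 / 2) ^ k - \<bar>t\<bar>)\<^sup>2" by simp
      then have "2 * (1/2) ^ k * \<bar>t\<bar> \<le> ((1 / 2) ^ k)\<^sup>2 + t\<^sup>2" by (simp add: power2_diff)
      then have "2 ^ k * (2 * (1/2) ^ k * \<bar>t\<bar>) \<le> 2 ^ k * (((1 / 2) ^ k)\<^sup>2 + t\<^sup>2)" by simp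
      moreover have "2 ^ k * (2 * (1/2) ^ k * \<bar>t\<bar>) = 2 * \<bar>t\<bar>" by (simp add: power_one_over)
      moreover have "2 ^ k * (((1 / 2) ^ k)\<^sup>2 + t\<^sup>2) = (1/2) ^ k + 2 ^ k * t\<^sup>2"
        by (simp add: power_one_over power2_eq_square field_simps)
      ultimately show ?thesis by simp
    qed
    have "(\<integral>\<^sup>+x. ennreal \<bar>d k x\<bar> \<partial>lebesgue) \<le>
        (\<integral>\<^sup>+x. ennreal ((1 / 2) ^ k) * indicator \<Omega> x + ennreal (2 ^ k) * ennreal ((d k x)\<^sup>2) \<partial>lebesgue)"
    proof (rule nn_integral_mono_AE)
      show "AE x in lebesgue. ennreal \<bar>d k x\<bar> \<le>
          ennreal ((1 / 2) ^ k) * indicator \<Omega> x + ennreal (2 ^ k) * ennreal ((d k x)\<^sup>2)"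
        using H0s_D(5)[OF dV[of k]]
      proof eventually_elim
        case (elim x)
        have "ennreal \<bar>d k x\<bar> \<le> ennreal ((1 / 2) ^ k + 2 ^ k * (d k x)\<^sup>2)" by (intro ennreal_leI am_gm)
        also have "\<dots> = ennreal ((1 / 2) ^ k) + ennreal (2 ^ k) * ennreal ((d k x)\<^sup>2)"
          by (simp flip: ennreal_mult ennreal_plus)
        finally show ?case using elim by (cases "x \<in> \<Omega>") auto
      qed
    qed
    also have "\<dots> = ennreal ((1 / 2) ^ k) * emeasure lebesgue \<Omega> +
        ennreal (2 ^ k) * (\<integral>\<^sup>+x. ennreal ((d k x)\<^sup>2) \<partial>lebesgue)"
      by (simp add: nn_integral_add nn_integral_cmult nn_integral_cmult_indicator)
    also have "\<dots> \<le> ennreal ((1 / 2) ^ k) * ennreal ?m + ennreal (2 ^ k) * ennreal (C * (1 / 4) ^ k)"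
    proof (intro add_mono mult_left_mono)
      have "(\<integral>\<^sup>+x. ennreal ((d k x)\<^sup>2) \<partial>lebesgue) \<le> ennreal (C * B (d k) (d k))"
        using nn_integral_square_le[OF dV] by (simp add: C_def)
      also have "\<dots> \<le> ennreal (C * (1 / 4) ^ k)"
        using dB[of k] C by (intro ennreal_leI mult_left_mono) auto
      finally show "(\<integral>\<^sup>+x. ennreal ((d k x)\<^sup>2) \<partial>lebesgue) \<le> ennreal (C * (1 / 4) ^ k)" .
    qed (simp_all add: m)
    also have "\<dots> = ennreal ((1 / 2) ^ k * ?m + 2 ^ k * (C * (1 / 4) ^ k))"
      using C by (simp flip: ennreal_mult ennreal_plus)
    also have "(1 / 2) ^ k * ?m + 2 ^ k * (C * (1 / 4) ^ k) = (?m + C) * (1 / 2) ^ k"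
    proof -
      have "(2::real) ^ k * (1 / 4) ^ k = (1 / 2) ^ k" by (simp flip: power_mult_distrib)
      then show ?thesis by (simp add: algebra_simps)
    qed
    finally show ?thesis .
  qed
  have "(\<integral>\<^sup>+x. (\<Sum>k. ennreal \<bar>d k x\<bar>) \<partial>lebesgue) = (\<Sum>k. \<integral>\<^sup>+x. ennreal \<bar>d k x\<bar> \<partial>lebesgue)"
    by (rule nn_integral_suminf) measurable
  also have "\<dots> \<le> (\<Sum>k. ennreal ((?m + C) * (1 / 2) ^ k))"
    by (intro suminf_le dL1) auto
  also have "\<dots> < \<infinity>"
  proof -
    have "summable (\<lambda>k. (?m + C) * (1 / 2) ^ k)" by (intro summable_mult summable_geometric) simp
    then have "(\<Sum>k. ennreal ((?m + C) * (1 / 2) ^ k)) = ennreal (\<Sum>k. (?m + C) * (1 / 2) ^ k)"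
      using C by (intro suminf_ennreal2) auto
    then show ?thesis by simp
  qed
  finally have "(\<integral>\<^sup>+x. (\<Sum>k. ennreal \<bar>d k x\<bar>) \<partial>lebesgue) \<noteq> \<infinity>" by simp
  then have "AE x in lebesgue. (\<Sum>k. ennreal \<bar>d k x\<bar>) \<noteq> \<infinity>"
    by (intro nn_integral_noteq_infinite) auto
  then have conv: "AE x in lebesgue. convergent (\<lambda>k. f (r k) x)"
  proof eventually_elim
    case (elim x)
    then have "summable (\<lambda>k. \<bar>d k x\<bar>)" by (intro summable_suminf_not_top) auto
    then have "summable (\<lambda>k. f (r (Suc k)) x - f (r k) x)"
      using summable_rabs_cancel by (auto simp: d_def)
    then have "convergent (\<lambda>n. \<Sum>k<n. f (r (Suc k)) x - f (r k) x)" by (simp add: summable_iff_convergent)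
    then have "convergent (\<lambda>n. f (r n) x - f (r 0) x)" 
      using sum_lessThan_telescope[of "\<lambda>k. f (r k) x"] by simp
    then show ?case
      using convergent_add[of "\<lambda>n. f (r n) x - f (r 0) x" "\<lambda>n. f (r 0) x"] convergent_const by auto
  qed
  define g where "g x = lim (\<lambda>k. f (r k) x)" for x
  have lim: "AE x in lebesgue. (\<lambda>k. f (r k) x) \<longlonglongrightarrow> g x"
    using conv by eventually_elim (simp add: g_def convergent_LIMSEQ_iff)
  have [measurable]: "g \<in> borel_measurable lebesgue"
    unfolding g_def[abs_def] by (rule borel_measurable_lim_metric) measurable
  have g0: "AE x in lebesgue. x \<notin> \<Omega> \<longrightarrow> g x = 0"
  proof -
    have "AE x in lebesgue. \<forall>k. x \<notin> \<Omega> \<longrightarrow> f (r k) x = 0"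
      unfolding AE_all_countable using H0s_D(5)[OF f] by blast
    with lim show ?thesis
    proof eventually_elim
      case (elim x)
      then show ?case by (auto simp: LIMSEQ_const_iff)
    qed
  qed
  have key: "f n - g \<in> V \<and> B (f n - g) (f n - g) \<le> e"
    if e: "e > 0" and M: "\<And>m. m \<ge> M \<Longrightarrow> B (f m - f n) (f m - f n) < e" for e n M
  proof -
    have le: "B (f n - f (r j)) (f n - f (r j)) \<le> e" if "j \<ge> M" for j
    proof -
      have "r j \<ge> M" using that rN(3)[of j] by linarith
      then have "B (f (r j) - f n) (f (r j) - f n) < e" by (rule M)
      then show ?thesis using f by (simp add: diff_diff commute[of "f n" "f (r j)"])
    qed
    have 1: "(\<integral>\<^sup>+x. ennreal (((f n - g) x)\<^sup>2) \<partial>lebesgue) \<le> ennreal (C * e)"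
    proof (rule nn_integral_square_le_of_tendsto[where h = "\<lambda>j. f n - f (r j)" and J = M])
      show "(f n - f (r j)) \<in> borel_measurable lebesgue" for j by (rule H0s_D(1)[OF mem_diff[OF f f]])
      show "AE x in lebesgue. (\<lambda>j. (f n - f (r j)) x) \<longlonglongrightarrow> (f n - g) x"
        using lim by eventually_elim (auto intro!: tendsto_intros)
      fix j assume "j \<ge> M"
      have "(\<integral>\<^sup>+x. ennreal (((f n - f (r j)) x)\<^sup>2) \<partial>lebesgue) \<le> ennreal (C * B (f n - f (r j)) (f n - f (r j)))"
        unfolding C_def by (intro nn_integral_square_le mem f)
      also have "\<dots> \<le> ennreal (C * e)" using le[OF \<open>j \<ge> M\<close>] C by (intro ennreal_leI mult_left_mono) auto
      finally show "(\<integral>\<^sup>+x. ennreal (((f n - f (r j)) x)\<^sup>2) \<partial>lebesgue) \<le> ennreal (C * e)" .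
    qed
    have 2: "(\<integral>\<^sup>+z. ennreal ((fgrad s (f n - g) z)\<^sup>2) \<partial>lebesgue) \<le> ennreal e"
    proof (rule nn_integral_square_le_of_tendsto[where h = "\<lambda>j. fgrad s (f n - f (r j))" and J = M])
      show "fgrad s (f n - f (r j)) \<in> borel_measurable lebesgue" for j by (rule H0s_D(3)[OF mem_diff[OF f f]])
      show "AE z in lebesgue. (\<lambda>j. fgrad s (f n - f (r j)) z) \<longlonglongrightarrow> fgrad s (f n - g) z"
        using AE_lebesgue_fst[OF lim] AE_lebesgue_snd[OF lim]
      proof eventually_elim
        case (elim z)
        then show ?case unfolding fgrad_def divide_inverse by (auto intro!: tendsto_intros)
      qed
      fix j assume "j \<ge> M"
      show "(\<integral>\<^sup>+z. ennreal ((fgrad s (f n - f (r j)) z)\<^sup>2) \<partial>lebesgue) \<le> ennreal e"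
        using energy_nn_integral[OF mem_diff[OF f f], of n "r j"] le[OF \<open>j \<ge> M\<close>] by (simp add: ennreal_leI)
    qed
    have ms: "(f n - g) \<in> borel_measurable lebesgue" unfolding fun_diff_def by measurable
    have "integrable lebesgue (\<lambda>x. ((f n - g) x)\<^sup>2)"
      unfolding integrable_square_iff_nn_integral[OF ms] using le_less_trans[OF 1] by simp
    moreover have "integrable lebesgue (\<lambda>z. (fgrad s (f n - g) z)\<^sup>2)"
      unfolding integrable_square_iff_nn_integral[OF borel_measurable_fgrad[OF ms]] using le_less_trans[OF 2] by simp
    moreover have "AE x in lebesgue. x \<notin> \<Omega> \<longrightarrow> (f n - g) x = 0"
      using g0 H0s_D(5)[OF f[of n]] by eventually_elim auto
    ultimately have fg: "f n - g \<in> V" using ms by (simp add: H0s_def Hs_iff)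
    then show ?thesis using 2 e energy_nn_integral[OF fg] by (simp add: ennreal_le_iff)
  qed
  obtain M0 where "\<forall>m\<ge>M0. \<forall>n\<ge>M0. B (f m - f n) (f m - f n) < 1" using Cauchy[of 1] by auto
  then have "f M0 - g \<in> V" using key[of 1 M0 M0] by auto
  then have "f M0 - (f M0 - g) \<in> V" by (rule mem_diff[OF f])
  moreover have "f M0 - (f M0 - g) = g" by (simp add: fun_eq_iff)
  ultimately have gV: "g \<in> V" by simp
  have "(\<lambda>n. B (f n - g) (f n - g)) \<longlonglongrightarrow> 0"
  proof (rule LIMSEQ_I)
    fix e :: real assume e: "e > 0"
    obtain M where M: "\<forall>m\<ge>M. \<forall>n\<ge>M. B (f m - f n) (f m - f n) < e / 2"
      using Cauchy[of "e / 2"] e by auto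
    have "norm (B (f n - g) (f n - g) - 0) < e" if "n \<ge> M" for n
    proof -
      have "B (f n - g) (f n - g) \<le> e / 2" using key[of "e / 2" M n] e M that by auto
      then show ?thesis using nonneg[OF mem_diff[OF f gV], of n] e by simp
    qed
    then show "\<exists>no. \<forall>n\<ge>no. norm (B (f n - g) (f n - g) - 0) < e" by blast
  qed
  then show ?thesis using gV by blast
qed

sublocale semi_hilbert V B
  by unfold_locales (rule complete_H0s)

end

section \<open>Averages over small cubes\<close>

text \<open>Half-open cubes of side \<open>h\<close>, indexed by the integer parts of the coordinates divided by \<open>h\<close>. What is
used later is that the measure is comparable to the \<open>N\<close>-th power of the diameter.\<close>

lemma fine_partition:
  fixes \<Omega> :: "'a::euclidean_space set"
  assumes \<Omega>: "bounded \<Omega>" and h: "0 < h"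
  shows "\<exists>\<Q>. finite \<Q> \<and> disjoint \<Q> \<and> \<Omega> \<subseteq> \<Union>\<Q> \<and>
     (\<forall>Q\<in>\<Q>. Q \<in> sets borel \<and> emeasure lborel Q = ennreal (h ^ DIM('a)) \<and>
        (\<forall>x\<in>Q. \<forall>y\<in>Q. norm (x - y) \<le> real DIM('a) * h))"
proof -
  define cell where "cell k = {y :: 'a. \<forall>b\<in>Basis. \<lfloor>(y \<bullet> b) / h\<rfloor> = k b}" for k :: "'a \<Rightarrow> int"
  define idx where "idx x = restrict (\<lambda>b. \<lfloor>(x \<bullet> b) / h\<rfloor>) Basis" for x :: 'a
  define \<Q> where "\<Q> = (\<lambda>x. cell (idx x)) ` \<Omega>"
  have cell_idx: "y \<in> cell (idx x) \<longleftrightarrow> (\<forall>b\<in>Basis. \<lfloor>(y \<bullet> b) / h\<rfloor> = \<lfloor>(x \<bullet> b) / h\<rfloor>)" for x y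
    by (auto simp: cell_def idx_def)
  obtain R where R: "R > 0" "\<And>x. x \<in> \<Omega> \<Longrightarrow> norm x < R"
    using \<Omega> by (auto simp: bounded_pos_less)
  have "idx x \<in> Basis \<rightarrow>\<^sub>E {\<lfloor>- R / h\<rfloor>..\<lfloor>R / h\<rfloor>}" if x: "x \<in> \<Omega>" for x
  proof -
    have "\<lfloor>(x \<bullet> b) / h\<rfloor> \<in> {\<lfloor>- R / h\<rfloor>..\<lfloor>R / h\<rfloor>}" if b: "b \<in> Basis" for b
    proof -
      have "\<bar>x \<bullet> b\<bar> \<le> R" using Basis_le_norm[OF b, of x] R(2)[OF x] by simp
      then have "- R \<le> x \<bullet> b" "x \<bullet> b \<le> R" by linarith+
      then have "- R / h \<le> (x \<bullet> b) / h" "(x \<bullet> b) / h \<le> R / h"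
        using h by (intro divide_right_mono; simp)+
      then show ?thesis by (simp add: floor_mono)
    qed
    then show ?thesis by (auto simp: idx_def)
  qed
  then have "idx ` \<Omega> \<subseteq> Basis \<rightarrow>\<^sub>E {\<lfloor>- R / h\<rfloor>..\<lfloor>R / h\<rfloor>}" by blast
  then have "finite (idx ` \<Omega>)" by (rule finite_subset) (intro finite_PiE finite_Basis finite_atLeastAtMost_int)
  then have fin: "finite \<Q>" unfolding \<Q>_def by (simp flip: image_image)
  have disj: "disjoint \<Q>"
  proof (rule disjointI)
    fix P Q assume "P \<in> \<Q>" "Q \<in> \<Q>" "P \<noteq> Q"
    then show "P \<inter> Q = {}" unfolding \<Q>_def using cell_idx by auto
  qed
  have cover: "\<Omega> \<subseteq> \<Union>\<Q>" unfolding \<Q>_def using cell_idx by auto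
  have floor_iff: "\<lfloor>t / h\<rfloor> = k \<longleftrightarrow> of_int k * h \<le> t \<and> t < (of_int k + 1) * h" for t k
    using h by (simp add: floor_eq_iff pos_le_divide_eq pos_divide_less_eq)
  have cell: "cell k \<in> sets borel \<and> emeasure lborel (cell k) = ennreal (h ^ DIM('a)) \<and>
        (\<forall>x\<in>cell k. \<forall>y\<in>cell k. norm (x - y) \<le> real DIM('a) * h)" for k
  proof (intro conjI ballI)
    define l where "l = (\<Sum>b\<in>Basis. (of_int (k b) * h) *\<^sub>R b :: 'a)"
    define u where "u = (\<Sum>b\<in>Basis. ((of_int (k b) + 1) * h) *\<^sub>R b :: 'a)"
    have lb: "l \<bullet> b = of_int (k b) * h" and ub: "u \<bullet> b = (of_int (k b) + 1) * h" if "b \<in> Basis" for b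
      using that by (simp_all add: l_def u_def)
    have ceq: "cell k = {y. \<forall>b\<in>Basis. of_int (k b) * h \<le> y \<bullet> b \<and> y \<bullet> b < (of_int (k b) + 1) * h}"
      by (simp add: cell_def floor_iff)
    show meas: "cell k \<in> sets borel"
    proof -
      have "cell k = (\<Inter>b\<in>Basis. {y. of_int (k b) * h \<le> y \<bullet> b} \<inter> {y. y \<bullet> b < (of_int (k b) + 1) * h})"
        by (auto simp: ceq)
      also have "\<dots> \<in> sets borel" by (intro sets.finite_INT sets.Int) auto
      finally show ?thesis .
    qed
    have sub: "box l u \<subseteq> cell k" "cell k \<subseteq> cbox l u"
      by (auto simp: ceq box_def cbox_def lb ub less_imp_le)
    have lu: "b \<in> Basis \<Longrightarrow> l \<bullet> b \<le> u \<bullet> b" for b using h by (simp add: lb ub algebra_simps)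
    have prod: "(\<Prod>b\<in>Basis. (u - l) \<bullet> b) = h ^ DIM('a)"
      by (simp add: inner_diff_left lb ub algebra_simps)
    have "emeasure lborel (box l u) = ennreal (h ^ DIM('a))" "emeasure lborel (cbox l u) = ennreal (h ^ DIM('a))"
      using emeasure_lborel_box[OF lu] emeasure_lborel_cbox[OF lu] by (simp_all only: prod)
    moreover have "emeasure lborel (box l u) \<le> emeasure lborel (cell k)"
      "emeasure lborel (cell k) \<le> emeasure lborel (cbox l u)"
      using sub meas by (auto intro!: emeasure_mono)
    ultimately show "emeasure lborel (cell k) = ennreal (h ^ DIM('a))" by simp
    fix x y assume xy: "x \<in> cell k" "y \<in> cell k"
    have "norm (x - y) \<le> (\<Sum>b\<in>Basis. \<bar>(x - y) \<bullet> b\<bar>)" by (rule norm_le_l1)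
    also have "\<dots> \<le> (\<Sum>b\<in>(Basis::'a set). h)"
    proof (rule sum_mono)
      fix b :: 'a assume b: "b \<in> Basis"
      have "of_int (k b) * h \<le> x \<bullet> b" "x \<bullet> b < (of_int (k b) + 1) * h"
        "of_int (k b) * h \<le> y \<bullet> b" "y \<bullet> b < (of_int (k b) + 1) * h"
        using xy b by (auto simp: ceq)
      then show "\<bar>(x - y) \<bullet> b\<bar> \<le> h" by (simp add: inner_diff_left algebra_simps)
    qed
    finally show "norm (x - y) \<le> real DIM('a) * h" by simp
  qed
  have "\<forall>Q\<in>\<Q>. Q \<in> sets borel \<and> emeasure lborel Q = ennreal (h ^ DIM('a)) \<and>
        (\<forall>x\<in>Q. \<forall>y\<in>Q. norm (x - y) \<le> real DIM('a) * h)"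
    unfolding \<Q>_def using cell by blast
  then show ?thesis using fin disj cover by blast
qed

text \<open>The double integral of \<open>(u x - u y)\<^sup>2\<close> over \<open>Q \<times> Q\<close> is \<open>2 m\<^sup>2\<close> times the variance of \<open>u\<close> on \<open>Q\<close>.\<close>

lemma double_integral_variance:
  fixes u :: "'a::euclidean_space \<Rightarrow> real"
  assumes u[measurable]: "u \<in> borel_measurable borel" and u2: "integrable lborel (\<lambda>x. (u x)\<^sup>2)"
    and Q[measurable]: "Q \<in> sets borel" and m: "emeasure lborel Q = ennreal m" "0 \<le> m"
  shows "(\<integral>\<^sup>+x. \<integral>\<^sup>+y. ennreal (indicator Q x * indicator Q y * (u x - u y)\<^sup>2) \<partial>lborel \<partial>lborel) =
     ennreal (2 * (m * (\<integral>x. indicator Q x * (u x)\<^sup>2 \<partial>lborel) - (\<integral>x. indicator Q x * u x \<partial>lborel)\<^sup>2))"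
proof -
  define S where "S = (\<integral>x. indicator Q x * u x \<partial>lborel)"
  define T where "T = (\<integral>x. indicator Q x * (u x)\<^sup>2 \<partial>lborel)"
  have i1: "integrable lborel (indicator Q :: 'a \<Rightarrow> real)"
    using m by (intro integrable_real_indicator) auto
  have i1': "measure lborel Q = m" using m by (simp add: measure_def)
  have i3: "integrable lborel (\<lambda>x. indicator Q x * (u x)\<^sup>2)"
    by (rule Bochner_Integration.integrable_bound[OF u2]) (auto simp: indicator_def)
  have ind2: "(indicator Q x :: real)\<^sup>2 = indicator Q x" for x by (simp add: indicator_def)
  have i2: "integrable lborel (\<lambda>x. indicator Q x * u x)"
    by (rule integrable_mult_of_squares) (use i1 u2 in \<open>auto simp: ind2\<close>)
  define I where "I x = (u x)\<^sup>2 * m - 2 * u x * S + T" for x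
  have inner: "(\<integral>\<^sup>+y. ennreal (indicator Q x * indicator Q y * (u x - u y)\<^sup>2) \<partial>lborel) = ennreal (indicator Q x * I x)"
    and pos: "0 \<le> indicator Q x * I x" for x
  proof -
    have eq: "indicator Q x * indicator Q y * (u x - u y)\<^sup>2 = indicator Q x *
        ((u x)\<^sup>2 * indicator Q y - 2 * u x * (indicator Q y * u y) + indicator Q y * (u y)\<^sup>2)" for y
      by (simp add: power2_diff algebra_simps)
    have int: "integrable lborel (\<lambda>y. indicator Q x * indicator Q y * (u x - u y)\<^sup>2)"
      unfolding eq using i1 i2 i3 by simp
    have val: "(\<integral>y. indicator Q x * indicator Q y * (u x - u y)\<^sup>2 \<partial>lborel) = indicator Q x * I x"
      unfolding eq using i1 i2 i3 by (simp add: I_def S_def T_def i1')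
    show "(\<integral>\<^sup>+y. ennreal (indicator Q x * indicator Q y * (u x - u y)\<^sup>2) \<partial>lborel) = ennreal (indicator Q x * I x)"
      unfolding val[symmetric] by (rule nn_integral_eq_integral[OF int]) simp
    show "0 \<le> indicator Q x * I x" unfolding val[symmetric] by (rule integral_nonneg_AE) simp
  qed
  have eqI: "indicator Q x * I x = m * (indicator Q x * (u x)\<^sup>2) - 2 * S * (indicator Q x * u x) + T * indicator Q x" for x
    by (simp add: I_def algebra_simps)
  have "(\<integral>\<^sup>+x. ennreal (indicator Q x * I x) \<partial>lborel) = ennreal (\<integral>x. indicator Q x * I x \<partial>lborel)"
    by (rule nn_integral_eq_integral) (use pos i1 i2 i3 in \<open>auto simp: eqI\<close>)
  also have "(\<integral>x. indicator Q x * I x \<partial>lborel) = 2 * (m * T - S\<^sup>2)"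
  proof -
    have "(\<integral>x. indicator Q x * I x \<partial>lborel) = m * T - 2 * S * S + T * m"
      unfolding eqI using i1 i2 i3 by (simp add: i1' S_def[symmetric] T_def[symmetric])
    then show ?thesis by (simp add: power2_eq_square algebra_simps)
  qed
  finally show ?thesis by (simp add: inner S_def T_def)
qed

context fractional_setting
begin

text \<open>On a cube \<open>Q\<close> of side \<open>h\<close> the kernel is at least a constant times \<open>h\<close> to the power \<open>- (N + 2 s)\<close>, so the
energy on \<open>Q \<times> Q\<close> dominates the double integral of \<open>(u x - u y)\<^sup>2\<close>, which is twice the measure
\<open>h ^ N\<close> of \<open>Q\<close> times the summand for \<open>Q\<close>. The sets \<open>Q \<times> Q\<close> are disjoint, so the energies add up to
at most the total one. What remains is the factor \<open>h powr (2 s)\<close>, small for small cubes.\<close>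

lemma cube_fluctuation:
  assumes h: "0 < h" and fin: "finite \<Q>" and disj: "disjoint \<Q>"
    and Q: "\<And>Q. Q \<in> \<Q> \<Longrightarrow> Q \<in> sets borel" "\<And>Q. Q \<in> \<Q> \<Longrightarrow> emeasure lborel Q = ennreal (h ^ DIM('a))"
      "\<And>Q x y. \<lbrakk>Q \<in> \<Q>; x \<in> Q; y \<in> Q\<rbrakk> \<Longrightarrow> norm (x - y) \<le> real DIM('a) * h"
    and u: "u \<in> V"
  shows "(\<Sum>Q\<in>\<Q>. (\<integral>x. indicator Q x * (u x)\<^sup>2 \<partial>lebesgue)
            - (\<integral>x. indicator Q x * u x \<partial>lebesgue)\<^sup>2 / h ^ DIM('a))
         \<le> real DIM('a) powr (real DIM('a) + 2 * s) * h powr (2 * s) * B u u"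
proof -
  define m where "m = h ^ DIM('a)"
  have m: "m > 0" using h by (simp add: m_def)
  obtain v where v: "v \<in> V" and vm[measurable]: "v \<in> borel_measurable borel"
    and uv: "AE x in lebesgue. u x = v x" using borel_representative[OF u] by blast
  have v2: "integrable lborel (\<lambda>x. (v x)\<^sup>2)"
    using H0s_D(2)[OF v] by (subst integrable_completion[symmetric]) auto
  define S where "S Q = (\<integral>x. indicator Q x * v x \<partial>lborel)" for Q
  define T where "T Q = (\<integral>x. indicator Q x * (v x)\<^sup>2 \<partial>lborel)" for Q
  have ST: "(\<integral>x. indicator Q x * u x \<partial>lebesgue) = S Q" "(\<integral>x. indicator Q x * (u x)\<^sup>2 \<partial>lebesgue) = T Q"
    if "Q \<in> \<Q>" for Q
  proof -
    have Qb: "Q \<in> sets borel" and Ql: "Q \<in> sets lebesgue" using Q(1)[OF that] by auto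
    have mu: "(\<lambda>x. indicator Q x * w x) \<in> borel_measurable lebesgue"
      "(\<lambda>x. indicator Q x * (w x)\<^sup>2) \<in> borel_measurable lebesgue" if "w \<in> V" for w
      using Ql H0s_D(1)[OF that] by (auto intro!: borel_measurable_times borel_measurable_indicator)
    have "(\<integral>x. indicator Q x * u x \<partial>lebesgue) = (\<integral>x. indicator Q x * v x \<partial>lebesgue)"
      by (rule integral_cong_AE[OF mu(1)[OF u] mu(1)[OF v]]) (use uv in eventually_elim, simp)
    also have "\<dots> = S Q" unfolding S_def by (rule integral_completion) (use Qb vm in auto)
    finally show "(\<integral>x. indicator Q x * u x \<partial>lebesgue) = S Q" .
    have "(\<integral>x. indicator Q x * (u x)\<^sup>2 \<partial>lebesgue) = (\<integral>x. indicator Q x * (v x)\<^sup>2 \<partial>lebesgue)"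
      by (rule integral_cong_AE[OF mu(2)[OF u] mu(2)[OF v]]) (use uv in eventually_elim, simp)
    also have "\<dots> = T Q" unfolding T_def by (rule integral_completion) (use Qb vm in auto)
    finally show "(\<integral>x. indicator Q x * (u x)\<^sup>2 \<partial>lebesgue) = T Q" .
  qed
  define K where "K = (real DIM('a) * h) powr (real DIM('a) + 2 * s)"
  have K: "K \<ge> 0" by (simp add: K_def)
  have fm: "fgrad s v \<in> borel_measurable borel" by (rule borel_measurable_fgrad_borel[OF vm])
  have pw: "indicator Q x * indicator Q y * (v x - v y)\<^sup>2 \<le> K * (indicator (Q \<times> Q) (x, y) * (fgrad s v (x, y))\<^sup>2)"
    if "Q \<in> \<Q>" for Q x y
  proof (cases "x \<in> Q \<and> y \<in> Q \<and> x \<noteq> y")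
    case True
    define n where "n = norm (x - y) powr (real DIM('a) + 2 * s)"
    have n: "0 < n" using True by (simp add: n_def)
    have "n \<le> K"
      unfolding K_def n_def using Q(3)[OF that] True s by (intro powr_mono2) auto
    then have "n * (v x - v y)\<^sup>2 \<le> K * (v x - v y)\<^sup>2" by (rule mult_right_mono) simp
    then have "(v x - v y)\<^sup>2 \<le> K * ((v x - v y)\<^sup>2 / n)" using n by (simp add: pos_le_divide_eq mult.commute)
    then show ?thesis using True by (simp add: fgrad_square n_def)
  next
    case False
    then show ?thesis using K by (auto simp: fgrad_square)
  qed
  have nonneg_term: "0 \<le> m * T Q - (S Q)\<^sup>2" and
    term_le: "ennreal (2 * (m * T Q - (S Q)\<^sup>2)) \<le>
      ennreal K * (\<integral>\<^sup>+z. ennreal (indicator (Q \<times> Q) z * (fgrad s v z)\<^sup>2) \<partial>lebesgue)" if "Q \<in> \<Q>" for Q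
  proof -
    have [measurable]: "Q \<in> sets borel" by (rule Q(1)[OF that])
    have QQ: "Q \<times> Q \<in> sets borel"
      unfolding borel_prod[symmetric] using Q(1)[OF that] by auto
    have "ennreal (2 * (m * T Q - (S Q)\<^sup>2)) =
        (\<integral>\<^sup>+x. \<integral>\<^sup>+y. ennreal (indicator Q x * indicator Q y * (v x - v y)\<^sup>2) \<partial>lborel \<partial>lborel)"
      unfolding S_def T_def using Q(2)[OF that] m
      by (intro double_integral_variance[symmetric] vm v2) (auto simp: m_def)
    also have "\<dots> \<le> (\<integral>\<^sup>+x. \<integral>\<^sup>+y. ennreal (K * (indicator (Q \<times> Q) (x, y) * (fgrad s v (x, y))\<^sup>2)) \<partial>lborel \<partial>lborel)"
      by (intro nn_integral_mono ennreal_leI pw[OF that])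
    also have "\<dots> = (\<integral>\<^sup>+z. ennreal (K * (indicator (Q \<times> Q) z * (fgrad s v z)\<^sup>2)) \<partial>lebesgue)"
      using fm QQ by (subst nn_integral_lebesgue_prod) auto
    also have "\<dots> = ennreal K * (\<integral>\<^sup>+z. ennreal (indicator (Q \<times> Q) z * (fgrad s v z)\<^sup>2) \<partial>lebesgue)"
    proof -
      have "(\<lambda>z. ennreal (indicator (Q \<times> Q) z * (fgrad s v z)\<^sup>2)) \<in> borel_measurable lebesgue"
        by (rule measurable_completion) (use fm QQ in simp)
      then show ?thesis using K by (simp add: ennreal_mult nn_integral_cmult)
    qed
    finally show "ennreal (2 * (m * T Q - (S Q)\<^sup>2)) \<le>
      ennreal K * (\<integral>\<^sup>+z. ennreal (indicator (Q \<times> Q) z * (fgrad s v z)\<^sup>2) \<partial>lebesgue)" .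
    have iQ: "integrable lborel (indicator Q :: 'a \<Rightarrow> real)"
      using Q(2)[OF that] by (intro integrable_real_indicator) auto
    have ind2: "(indicator Q x :: real)\<^sup>2 = indicator Q x" for x by (simp add: indicator_def)
    have "\<bar>\<integral>x. indicator Q x * (indicator Q x * v x) \<partial>lborel\<bar> \<le>
        sqrt (\<integral>x. (indicator Q x)\<^sup>2 \<partial>lborel) * sqrt (\<integral>x. (indicator Q x * v x)\<^sup>2 \<partial>lborel)"
    proof (rule integral_Cauchy_Schwarz)
      show "integrable lborel (\<lambda>x. (indicator Q x * v x)\<^sup>2)"
        by (rule Bochner_Integration.integrable_bound[OF v2]) (auto simp: indicator_def)
    qed (use iQ in \<open>auto simp: ind2\<close>)
    moreover have "indicator Q x * (indicator Q x * v x) = indicator Q x * v x"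
      "(indicator Q x * v x)\<^sup>2 = indicator Q x * (v x)\<^sup>2" for x by (auto simp: indicator_def)
    moreover have "measure lborel Q = m" using Q(2)[OF that] m by (simp add: measure_def m_def)
    ultimately have "\<bar>S Q\<bar> \<le> sqrt (m * T Q)" by (simp add: ind2 S_def T_def real_sqrt_mult)
    moreover have "0 \<le> m * T Q" unfolding T_def using m by (auto intro!: mult_nonneg_nonneg integral_nonneg_AE)
    ultimately have "(S Q)\<^sup>2 \<le> m * T Q"
      by (metis abs_ge_zero power2_abs power_mono real_sqrt_pow2)
    then show "0 \<le> m * T Q - (S Q)\<^sup>2" by simp
  qed
  have "ennreal (\<Sum>Q\<in>\<Q>. 2 * (m * T Q - (S Q)\<^sup>2)) = (\<Sum>Q\<in>\<Q>. ennreal (2 * (m * T Q - (S Q)\<^sup>2)))"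
    using nonneg_term by (intro sum_ennreal[symmetric]) auto
  also have "\<dots> \<le> (\<Sum>Q\<in>\<Q>. ennreal K * (\<integral>\<^sup>+z. ennreal (indicator (Q \<times> Q) z * (fgrad s v z)\<^sup>2) \<partial>lebesgue))"
    by (intro sum_mono term_le)
  also have "\<dots> = ennreal K * (\<integral>\<^sup>+z. (\<Sum>Q\<in>\<Q>. ennreal (indicator (Q \<times> Q) z * (fgrad s v z)\<^sup>2)) \<partial>lebesgue)"
  proof -
    have "(\<lambda>z. ennreal (indicator (Q \<times> Q) z * (fgrad s v z)\<^sup>2)) \<in> borel_measurable lebesgue" if "Q \<in> \<Q>" for Q
    proof -
      have "Q \<times> Q \<in> sets borel" unfolding borel_prod[symmetric] using Q(1)[OF that] by auto
      then show ?thesis by (intro measurable_completion) (use fm in simp)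
    qed
    then show ?thesis by (subst nn_integral_sum) (auto simp: sum_distrib_left)
  qed
  also have "\<dots> \<le> ennreal K * (\<integral>\<^sup>+z. ennreal ((fgrad s v z)\<^sup>2) \<partial>lebesgue)"
  proof (intro mult_left_mono nn_integral_mono)
    fix z
    have "(\<Sum>Q\<in>\<Q>. indicator (Q \<times> Q) z :: real) \<le> 1"
    proof (cases "\<exists>P\<in>\<Q>. z \<in> P \<times> P")
      case True
      then obtain P where P: "P \<in> \<Q>" "z \<in> P \<times> P" by auto
      have "(\<Sum>Q\<in>\<Q>. indicator (Q \<times> Q) z :: real) = (\<Sum>Q\<in>\<Q>. if Q = P then 1 else 0)"
        using P disj by (intro sum.cong) (auto simp: indicator_def disjoint_def)
      then show ?thesis using fin P by simp
    next
      case False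
      then have "(\<Sum>Q\<in>\<Q>. indicator (Q \<times> Q) z :: real) = 0" by (intro sum.neutral) (auto simp: indicator_def)
      then show ?thesis by simp
    qed
    then have "(\<Sum>Q\<in>\<Q>. indicator (Q \<times> Q) z) * (fgrad s v z)\<^sup>2 \<le> 1 * (fgrad s v z)\<^sup>2"
      by (intro mult_right_mono) auto
    then have "(\<Sum>Q\<in>\<Q>. indicator (Q \<times> Q) z * (fgrad s v z)\<^sup>2) \<le> (fgrad s v z)\<^sup>2"
      by (simp add: sum_distrib_right)
    then show "(\<Sum>Q\<in>\<Q>. ennreal (indicator (Q \<times> Q) z * (fgrad s v z)\<^sup>2)) \<le> ennreal ((fgrad s v z)\<^sup>2)"
      by (subst sum_ennreal) (auto intro: ennreal_leI)
  qed simp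
  also have "\<dots> = ennreal (K * B v v)"
    using energy_nn_integral[OF v] K nonneg[OF v] by (simp add: ennreal_mult)
  finally have "(\<Sum>Q\<in>\<Q>. 2 * (m * T Q - (S Q)\<^sup>2)) \<le> K * B v v"
    using K nonneg[OF v] by (simp add: ennreal_le_iff)
  moreover have "(\<Sum>Q\<in>\<Q>. 2 * (m * T Q - (S Q)\<^sup>2)) = 2 * (m * (\<Sum>Q\<in>\<Q>. T Q - (S Q)\<^sup>2 / m))"
    using m by (simp add: sum_distrib_left right_diff_distrib mult.assoc)
  moreover have "0 \<le> m * (\<Sum>Q\<in>\<Q>. T Q - (S Q)\<^sup>2 / m)"
    using nonneg_term m by (intro mult_nonneg_nonneg sum_nonneg) (simp_all add: field_simps)
  ultimately have "m * (\<Sum>Q\<in>\<Q>. T Q - (S Q)\<^sup>2 / m) \<le> K * B v v"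
    by linarith
  moreover have "K = m * (real DIM('a) powr (real DIM('a) + 2 * s) * h powr (2 * s))"
    using h by (simp add: K_def m_def powr_mult powr_add powr_realpow algebra_simps)
  ultimately have "m * (\<Sum>Q\<in>\<Q>. T Q - (S Q)\<^sup>2 / m) \<le>
      m * (real DIM('a) powr (real DIM('a) + 2 * s) * h powr (2 * s) * B v v)" by (simp only: mult.assoc)
  then have "(\<Sum>Q\<in>\<Q>. T Q - (S Q)\<^sup>2 / m) \<le>
      real DIM('a) powr (real DIM('a) + 2 * s) * h powr (2 * s) * B v v"
    using m by (simp only: mult_le_cancel_left_pos)
  moreover have "B v v = B u u" by (rule B_cong_AE[OF u u uv uv, symmetric])
  ultimately show ?thesis by (simp add: ST m_def cong: sum.cong)
qed

end

section \<open>Compactness of the embedding into square-integrable functions\<close>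

context fractional_setting
begin

lemma cube_approximation:
  assumes \<epsilon>: "0 < \<epsilon>"
  shows "\<exists>\<Q> m. 0 < m \<and> finite \<Q> \<and> disjoint \<Q> \<and>
     (\<forall>Q\<in>\<Q>. Q \<in> sets lebesgue \<and> emeasure lebesgue Q = ennreal m) \<and> \<Omega> \<subseteq> \<Union>\<Q> \<and>
     (\<forall>u\<in>V. (\<Sum>Q\<in>\<Q>. (\<integral>x. indicator Q x * (u x)\<^sup>2 \<partial>lebesgue) - (\<integral>x. indicator Q x * u x \<partial>lebesgue)\<^sup>2 / m)
            \<le> \<epsilon> * B u u)"
proof -
  define D where "D = real DIM('a) powr (real DIM('a) + 2 * s)"
  have D: "D > 0" by (simp add: D_def)
  \<comment> \<open>the side length for which the constant in the fluctuation estimate is the given one\<close>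
  define h where "h = (\<epsilon> / D) powr (1 / (2 * s))"
  have h: "h > 0" using \<epsilon> D by (simp add: h_def)
  have hs: "h powr (2 * s) = \<epsilon> / D" unfolding h_def using s \<epsilon> D by (simp add: powr_powr)
  from fine_partition[OF bounded_\<Omega> h] obtain \<Q> where *: "finite \<Q>" "disjoint \<Q>" "\<Omega> \<subseteq> \<Union>\<Q>"
    "\<forall>Q\<in>\<Q>. Q \<in> sets borel \<and> emeasure lborel Q = ennreal (h ^ DIM('a)) \<and>
        (\<forall>x\<in>Q. \<forall>y\<in>Q. norm (x - y) \<le> real DIM('a) * h)" by (elim exE conjE)
  then have \<Q>: "finite \<Q>" "disjoint \<Q>" "\<Omega> \<subseteq> \<Union>\<Q>"
    "\<And>Q. Q \<in> \<Q> \<Longrightarrow> Q \<in> sets borel" "\<And>Q. Q \<in> \<Q> \<Longrightarrow> emeasure lborel Q = ennreal (h ^ DIM('a))"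
    "\<And>Q x y. \<lbrakk>Q \<in> \<Q>; x \<in> Q; y \<in> Q\<rbrakk> \<Longrightarrow> norm (x - y) \<le> real DIM('a) * h"
    by simp_all
  have "(\<Sum>Q\<in>\<Q>. (\<integral>x. indicator Q x * (u x)\<^sup>2 \<partial>lebesgue) - (\<integral>x. indicator Q x * u x \<partial>lebesgue)\<^sup>2 / h ^ DIM('a))
      \<le> \<epsilon> * B u u" if "u \<in> V" for u
    using cube_fluctuation[OF h \<Q>(1,2,4,5,6) that] D
    unfolding D_def[symmetric] hs by simp
  moreover have "Q \<in> sets lebesgue \<and> emeasure lebesgue Q = ennreal (h ^ DIM('a))" if "Q \<in> \<Q>" for Q
    using \<Q>(4,5)[OF that] by simp
  moreover have "0 < h ^ DIM('a)" using h by simp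
  ultimately show ?thesis using \<Q>(1-3)
    by (intro exI[of _ \<Q>] exI[of _ "h ^ DIM('a)"] conjI ballI) blast+
qed

context
  fixes Q :: "'a set" and m :: real
  assumes Q: "Q \<in> sets lebesgue" "emeasure lebesgue Q = ennreal m" and m: "0 < m"
begin

lemma integrable_indicator_cube: "integrable lebesgue (indicator Q :: 'a \<Rightarrow> real)"
  using Q by (intro integrable_real_indicator) auto

lemma measure_cube: "measure lebesgue Q = m"
  using Q m by (simp add: measure_def)

lemma integrable_on_cube:
  assumes "u \<in> V"
  shows "integrable lebesgue (\<lambda>x. indicator Q x * u x)"
    and "integrable lebesgue (\<lambda>x. indicator Q x * (u x)\<^sup>2)"
proof -
  have ind2: "(indicator Q x :: real)\<^sup>2 = indicator Q x" for x by (simp add: indicator_def)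
  show "integrable lebesgue (\<lambda>x. indicator Q x * u x)"
    by (rule integrable_mult_of_squares)
      (use Q H0s_D[OF assms] integrable_indicator_cube in \<open>auto simp: ind2\<close>)
  show "integrable lebesgue (\<lambda>x. indicator Q x * (u x)\<^sup>2)"
    by (rule Bochner_Integration.integrable_bound[OF H0s_D(2)[OF assms]])
      (use Q H0s_D(1)[OF assms] in \<open>auto simp: indicator_def intro!: borel_measurable_times borel_measurable_indicator\<close>)
qed

lemma cube_integral_square_le:
  assumes "u \<in> V"
  shows "(\<integral>x. indicator Q x * u x \<partial>lebesgue)\<^sup>2 \<le> m * (\<integral>x. (u x)\<^sup>2 \<partial>lebesgue)"
proof -
  have ind2: "(indicator Q x :: real)\<^sup>2 = indicator Q x" for x by (simp add: indicator_def)
  have "\<bar>\<integral>x. indicator Q x * u x \<partial>lebesgue\<bar> \<le>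
      sqrt (\<integral>x. (indicator Q x)\<^sup>2 \<partial>lebesgue) * sqrt (\<integral>x. (u x)\<^sup>2 \<partial>lebesgue)"
    by (rule integral_Cauchy_Schwarz)
      (use Q H0s_D[OF assms] integrable_indicator_cube in \<open>auto simp: ind2\<close>)
  also have "\<dots> = sqrt (m * (\<integral>x. (u x)\<^sup>2 \<partial>lebesgue))"
    by (simp add: ind2 measure_cube real_sqrt_mult)
  finally have "\<bar>\<integral>x. indicator Q x * u x \<partial>lebesgue\<bar>\<^sup>2 \<le> (sqrt (m * (\<integral>x. (u x)\<^sup>2 \<partial>lebesgue)))\<^sup>2"
    by (intro power_mono) auto
  moreover have "0 \<le> m * (\<integral>x. (u x)\<^sup>2 \<partial>lebesgue)"
    using m by (intro mult_nonneg_nonneg integral_nonneg_AE) auto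
  ultimately show ?thesis by (simp only: power2_abs real_sqrt_pow2)
qed

lemma bounded_functional_cube:
  "bounded_functional (\<lambda>u. (\<integral>x. indicator Q x * u x \<partial>lebesgue) / sqrt m)"
  unfolding bounded_functional_def
proof (intro conjI ballI allI exI)
  fix f g assume f: "f \<in> V" and g: "g \<in> V"
  show "(\<integral>x. indicator Q x * (f + g) x \<partial>lebesgue) / sqrt m =
      (\<integral>x. indicator Q x * f x \<partial>lebesgue) / sqrt m + (\<integral>x. indicator Q x * g x \<partial>lebesgue) / sqrt m"
    using integrable_on_cube(1)[OF f] integrable_on_cube(1)[OF g] by (simp add: distrib_left add_divide_distrib)
next
  fix c :: real and f assume f: "f \<in> V"
  have "(\<integral>x. indicator Q x * (c *\<^sub>R f) x \<partial>lebesgue) = c * (\<integral>x. indicator Q x * f x \<partial>lebesgue)"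
    by (simp add: mult.left_commute[of _ c])
  then show "(\<integral>x. indicator Q x * (c *\<^sub>R f) x \<partial>lebesgue) / sqrt m = c * ((\<integral>x. indicator Q x * f x \<partial>lebesgue) / sqrt m)"
    by simp
next
  fix f assume f: "f \<in> V"
  have "(\<integral>x. indicator Q x * f x \<partial>lebesgue)\<^sup>2 \<le> m * (Poincare_const * B f f)"
    using cube_integral_square_le[OF f] mult_left_mono[OF Poincare_ineq[OF f], of m] m by linarith
  then show "((\<integral>x. indicator Q x * f x \<partial>lebesgue) / sqrt m)\<^sup>2 \<le> Poincare_const * B f f"
    using m by (simp add: power_divide pos_divide_le_eq mult.commute)
qed

end

lemma integral_square_eq_sum_cubes:
  assumes fin: "finite \<Q>" and disj: "disjoint \<Q>" and cover: "\<Omega> \<subseteq> \<Union>\<Q>" and m: "0 < m"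
    and Q: "\<And>Q. Q \<in> \<Q> \<Longrightarrow> Q \<in> sets lebesgue \<and> emeasure lebesgue Q = ennreal m" and u: "u \<in> V"
  shows "(\<integral>x. (u x)\<^sup>2 \<partial>lebesgue) = (\<Sum>Q\<in>\<Q>. \<integral>x. indicator Q x * (u x)\<^sup>2 \<partial>lebesgue)"
proof -
  have "(\<Sum>Q\<in>\<Q>. \<integral>x. indicator Q x * (u x)\<^sup>2 \<partial>lebesgue) = (\<integral>x. (\<Sum>Q\<in>\<Q>. indicator Q x * (u x)\<^sup>2) \<partial>lebesgue)"
    by (rule Bochner_Integration.integral_sum[symmetric]) (use integrable_on_cube(2)[OF _ _ m u] Q in blast)
  also have "\<dots> = (\<integral>x. (u x)\<^sup>2 \<partial>lebesgue)"
  proof (rule integral_cong_AE)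
    show "(\<lambda>x. \<Sum>Q\<in>\<Q>. indicator Q x * (u x)\<^sup>2) \<in> borel_measurable lebesgue"
      using Q H0s_D(1)[OF u] by (intro borel_measurable_sum borel_measurable_times borel_measurable_indicator) auto
    show "AE x in lebesgue. (\<Sum>Q\<in>\<Q>. indicator Q x * (u x)\<^sup>2) = (u x)\<^sup>2"
      using H0s_D(5)[OF u]
    proof eventually_elim
      case (elim x)
      show ?case
      proof (cases "x \<in> \<Union>\<Q>")
        case True
        then obtain P where P: "P \<in> \<Q>" "x \<in> P" by auto
        have "(\<Sum>Q\<in>\<Q>. indicator Q x * (u x)\<^sup>2) = (\<Sum>Q\<in>\<Q>. if Q = P then (u x)\<^sup>2 else 0)"
          using P disj by (intro sum.cong) (auto simp: indicator_def disjoint_def)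
        then show ?thesis using fin P by simp
      next
        case False
        then show ?thesis using elim cover by auto
      qed
    qed
  qed (use H0s_D(1)[OF u] in auto)
  finally show ?thesis by simp
qed

text \<open>This replaces the Rellich compactness theorem: bounded sequences whose finitely many averages converge
are nearly Cauchy in \<open>L\<^sup>2\<close>. The functionals are the integrals over the cubes of a fine partition.\<close>

lemma L2_compactness:
  assumes \<epsilon>: "0 < \<epsilon>"
  shows "\<exists>(n::nat) L. (\<forall>i<n. bounded_functional (L i)) \<and>
     (\<forall>u\<in>V. (\<integral>x. (u x)\<^sup>2 \<partial>lebesgue) \<le> \<epsilon> * B u u + (\<Sum>i<n. (L i u)\<^sup>2))"
proof -
  from cube_approximation[OF \<epsilon>] obtain \<Q> m where m: "0 < m" and fin: "finite \<Q>" and disj: "disjoint \<Q>"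
    and Q: "\<And>Q. Q \<in> \<Q> \<Longrightarrow> Q \<in> sets lebesgue \<and> emeasure lebesgue Q = ennreal m" and cover: "\<Omega> \<subseteq> \<Union>\<Q>"
    and est: "\<And>u. u \<in> V \<Longrightarrow> (\<Sum>Q\<in>\<Q>. (\<integral>x. indicator Q x * (u x)\<^sup>2 \<partial>lebesgue)
        - (\<integral>x. indicator Q x * u x \<partial>lebesgue)\<^sup>2 / m) \<le> \<epsilon> * B u u" by blast
  obtain q where q: "bij_betw q {..<card \<Q>} \<Q>"
    using ex_bij_betw_nat_finite[OF fin] by (auto simp: atLeast0LessThan)
  define L where "L i u = (\<integral>x. indicator (q i) x * u x \<partial>lebesgue) / sqrt m" for i and u :: "'a \<Rightarrow> real"
  have "bounded_functional (L i)" if "i < card \<Q>" for i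
  proof -
    have "q i \<in> \<Q>" using q that by (auto simp: bij_betw_def)
    then show ?thesis unfolding L_def[abs_def] using bounded_functional_cube[OF _ _ m] Q by blast
  qed
  moreover have "(\<integral>x. (u x)\<^sup>2 \<partial>lebesgue) \<le> \<epsilon> * B u u + (\<Sum>i<card \<Q>. (L i u)\<^sup>2)" if u: "u \<in> V" for u
  proof -
    have "(\<Sum>i<card \<Q>. (L i u)\<^sup>2) = (\<Sum>Q\<in>\<Q>. (\<integral>x. indicator Q x * u x \<partial>lebesgue)\<^sup>2 / m)"
      using sum.reindex_bij_betw[OF q, of "\<lambda>Q. (\<integral>x. indicator Q x * u x \<partial>lebesgue)\<^sup>2 / m"] m
      by (simp add: L_def power_divide)
    then show ?thesis
      using est[OF u] integral_square_eq_sum_cubes[OF fin disj cover m Q u] by (simp add: sum_subtractf)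
  qed
  ultimately show ?thesis by blast
qed

section \<open>Weighted forms\<close>

text \<open>The weight is extended by zero, so that all integrals run over the whole space.\<close>

definition weight :: "('a \<Rightarrow> real) \<Rightarrow> 'a \<Rightarrow> real" where
  "weight \<rho> x = indicator \<Omega> x * \<rho> x"

definition form :: "('a \<Rightarrow> real) \<Rightarrow> ('a \<Rightarrow> real) \<Rightarrow> ('a \<Rightarrow> real) \<Rightarrow> real" where
  "form r f g = (\<integral>x. r x * (f x * g x) \<partial>lebesgue)"

definition bounded_weight :: "('a \<Rightarrow> real) \<Rightarrow> real \<Rightarrow> bool" where
  "bounded_weight r C \<longleftrightarrow> r \<in> borel_measurable lebesgue \<and> 0 \<le> C \<and> (AE x in lebesgue. \<bar>r x\<bar> \<le> C)"

lemma integral_lebesgue_on_eq: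
  "(LINT x|lebesgue_on \<Omega>. \<rho> x * g x) = (\<integral>x. weight \<rho> x * g x \<partial>lebesgue)"
  by (subst integral_restrict_space) (auto simp: weight_def mult.assoc)

lemma form_eq: "(LINT x|lebesgue_on \<Omega>. \<rho> x * f x * g x) = form (weight \<rho>) f g"
  using integral_lebesgue_on_eq[of \<rho> "\<lambda>x. f x * g x"] by (simp add: form_def mult.assoc)

lemma weight_measurable:
  "\<rho> \<in> borel_measurable (lebesgue_on \<Omega>) \<Longrightarrow> weight \<rho> \<in> borel_measurable lebesgue"
  by (subst (asm) borel_measurable_restrict_space_iff) (auto simp: weight_def[abs_def])

lemma Linf_bounded_weight:
  assumes "\<rho> \<in> Linf \<Omega>"
  shows "\<exists>C. bounded_weight (weight \<rho>) C"
proof -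
  obtain C where "AE x in lebesgue_on \<Omega>. \<bar>\<rho> x\<bar> \<le> C" using assms by (auto simp: Linf_def)
  then have "AE x in lebesgue. x \<in> \<Omega> \<longrightarrow> \<bar>\<rho> x\<bar> \<le> C" by (subst (asm) AE_restrict_space_iff) auto
  then have "AE x in lebesgue. \<bar>weight \<rho> x\<bar> \<le> max 0 C"
    by eventually_elim (auto simp: weight_def indicator_def)
  moreover have "weight \<rho> \<in> borel_measurable lebesgue" using assms by (auto simp: Linf_def intro: weight_measurable)
  ultimately show ?thesis by (auto simp: bounded_weight_def intro!: exI[of _ "max 0 C"])
qed

lemma integrable_weight_mult:
  assumes r: "bounded_weight r C" and f: "f \<in> borel_measurable lebesgue" "integrable lebesgue (\<lambda>x. (f x)\<^sup>2)"
    and g: "g \<in> borel_measurable lebesgue" "integrable lebesgue (\<lambda>x. (g x)\<^sup>2)"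
  shows "integrable lebesgue (\<lambda>x. r x * (f x * g x))"
proof (rule Bochner_Integration.integrable_bound)
  show "integrable lebesgue (\<lambda>x. C * (f x * g x))"
    using integrable_mult_of_squares[OF f(1) g(1) f(2) g(2)] by simp
  show "(\<lambda>x. r x * (f x * g x)) \<in> borel_measurable lebesgue"
    using r f g by (auto simp: bounded_weight_def)
  have "AE x in lebesgue. \<bar>r x\<bar> \<le> C" using r by (simp add: bounded_weight_def)
  then show "AE x in lebesgue. norm (r x * (f x * g x)) \<le> norm (C * (f x * g x))"
    by eventually_elim (auto simp: abs_mult intro!: mult_right_mono)
qed

lemma form_le:
  assumes r: "bounded_weight r C" and f: "f \<in> borel_measurable lebesgue" "integrable lebesgue (\<lambda>x. (f x)\<^sup>2)"
    and g: "g \<in> borel_measurable lebesgue" "integrable lebesgue (\<lambda>x. (g x)\<^sup>2)"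
  shows "\<bar>form r f g\<bar> \<le> C * (sqrt (\<integral>x. (f x)\<^sup>2 \<partial>lebesgue) * sqrt (\<integral>x. (g x)\<^sup>2 \<partial>lebesgue))"
proof -
  have C: "0 \<le> C" "AE x in lebesgue. \<bar>r x\<bar> \<le> C" using r by (auto simp: bounded_weight_def)
  have i: "integrable lebesgue (\<lambda>x. \<bar>f x\<bar> * \<bar>g x\<bar>)"
    using integrable_mult_of_squares[OF f(1) g(1) f(2) g(2)] by (simp flip: abs_mult)
  have "\<bar>form r f g\<bar> \<le> (\<integral>x. \<bar>r x * (f x * g x)\<bar> \<partial>lebesgue)"
    unfolding form_def by (rule integral_abs_bound)
  also have "\<dots> \<le> (\<integral>x. C * (\<bar>f x\<bar> * \<bar>g x\<bar>) \<partial>lebesgue)"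
  proof (rule integral_mono_AE)
    show "integrable lebesgue (\<lambda>x. \<bar>r x * (f x * g x)\<bar>)"
      using integrable_weight_mult[OF assms] by (rule integrable_abs)
    show "AE x in lebesgue. \<bar>r x * (f x * g x)\<bar> \<le> C * (\<bar>f x\<bar> * \<bar>g x\<bar>)"
      using C(2) by eventually_elim (auto simp: abs_mult intro!: mult_right_mono)
  qed (use i in simp)
  also have "\<dots> = C * (\<integral>x. \<bar>f x\<bar> * \<bar>g x\<bar> \<partial>lebesgue)" by simp
  also have "\<dots> \<le> C * (sqrt (\<integral>x. (f x)\<^sup>2 \<partial>lebesgue) * sqrt (\<integral>x. (g x)\<^sup>2 \<partial>lebesgue))"
  proof (rule mult_left_mono[OF _ C(1)])
    have "\<bar>\<integral>x. \<bar>f x\<bar> * \<bar>g x\<bar> \<partial>lebesgue\<bar> \<le>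
        sqrt (\<integral>x. \<bar>f x\<bar>\<^sup>2 \<partial>lebesgue) * sqrt (\<integral>x. \<bar>g x\<bar>\<^sup>2 \<partial>lebesgue)"
      by (rule integral_Cauchy_Schwarz) (use f g in auto)
    then show "(\<integral>x. \<bar>f x\<bar> * \<bar>g x\<bar> \<partial>lebesgue) \<le> sqrt (\<integral>x. (f x)\<^sup>2 \<partial>lebesgue) * sqrt (\<integral>x. (g x)\<^sup>2 \<partial>lebesgue)"
      by simp
  qed
  finally show ?thesis .
qed

lemma form_quadratic_le:
  assumes "bounded_weight r C" "f \<in> V"
  shows "\<bar>form r f f\<bar> \<le> C * (\<integral>x. (f x)\<^sup>2 \<partial>lebesgue)"
proof -
  have "0 \<le> (\<integral>x. (f x)\<^sup>2 \<partial>lebesgue)" by (intro integral_nonneg_AE) simp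
  then show ?thesis
    using form_le[OF assms(1) H0s_D(1,2)[OF assms(2)] H0s_D(1,2)[OF assms(2)]] by simp
qed

lemma sym_form_form:
  assumes r: "bounded_weight r C"
  shows "sym_form V (form r)"
proof unfold_locales
  fix f g h assume f: "f \<in> V" and g: "g \<in> V"
  show "form r (f + g) h = form r f h + form r g h" if h: "h \<in> V"
    using integrable_weight_mult[OF r H0s_D(1,2)[OF f] H0s_D(1,2)[OF h]]
      integrable_weight_mult[OF r H0s_D(1,2)[OF g] H0s_D(1,2)[OF h]]
    by (simp add: form_def distrib_left distrib_right)
  show "form r (c *\<^sub>R f) g = c * form r f g" for c
  proof -
    have "form r (c *\<^sub>R f) g = (\<integral>x. c * (r x * (f x * g x)) \<partial>lebesgue)"
      unfolding form_def by (rule Bochner_Integration.integral_cong) simp_all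
    then show ?thesis by (simp add: form_def)
  qed
  show "form r f g = form r g f" by (simp add: form_def mult.commute[of "f _"])
qed (rule V)

text \<open>A bounded weight dominates the form by a multiple of the \<open>L\<^sup>2\<close> norm, whose compactness estimate is then
rescaled.\<close>

lemma compact_form_form:
  assumes r: "bounded_weight r C"
  shows "compact_form (form r)"
  unfolding compact_form_def bounded_form_def
proof (intro conjI allI impI)
  show "sym_form V (form r)" by (rule sym_form_form[OF r])
  have C: "0 \<le> C" using r by (simp add: bounded_weight_def)
  have "\<bar>form r f f\<bar> \<le> (C * Poincare_const) * B f f" if "f \<in> V" for f
    using form_quadratic_le[OF r that] mult_left_mono[OF Poincare_ineq[OF that] C] by (simp add: mult.assoc)
  then show "\<exists>D. \<forall>f\<in>V. \<bar>form r f f\<bar> \<le> D * B f f" by blast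
  fix \<epsilon> :: real assume \<epsilon>: "\<epsilon> > 0"
  obtain n :: nat and L where L: "\<And>i. i < n \<Longrightarrow> bounded_functional (L i)"
    and est: "\<And>u. u \<in> V \<Longrightarrow> (\<integral>x. (u x)\<^sup>2 \<partial>lebesgue) \<le> \<epsilon> / (C + 1) * B u u + (\<Sum>i<n. (L i u)\<^sup>2)"
    using L2_compactness[of "\<epsilon> / (C + 1)"] \<epsilon> C by auto
  define K where "K i f = sqrt (C + 1) * L i f" for i f
  have "bounded_functional (K i)" if i: "i < n" for i
  proof -
    obtain D where "\<forall>f\<in>V. (L i f)\<^sup>2 \<le> D * B f f" using L[OF i] unfolding bounded_functional_def by blast
    then have "\<forall>f\<in>V. (K i f)\<^sup>2 \<le> ((C + 1) * D) * B f f"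
      using C by (simp add: K_def power_mult_distrib mult.assoc mult_left_mono)
    then have "\<exists>E. \<forall>f\<in>V. (K i f)\<^sup>2 \<le> E * B f f" by blast
    then show ?thesis using L[OF i] unfolding bounded_functional_def by (simp add: K_def distrib_left)
  qed
  moreover have "form r f f \<le> \<epsilon> * B f f + (\<Sum>i<n. (K i f)\<^sup>2)" if f: "f \<in> V" for f
  proof -
    have "0 \<le> (\<integral>x. (f x)\<^sup>2 \<partial>lebesgue)" by (intro integral_nonneg_AE) simp
    then have "form r f f \<le> (C + 1) * (\<integral>x. (f x)\<^sup>2 \<partial>lebesgue)"
      using form_quadratic_le[OF r f] unfolding distrib_right by linarith
    also have "\<dots> \<le> (C + 1) * (\<epsilon> / (C + 1) * B f f + (\<Sum>i<n. (L i f)\<^sup>2))"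
      using est[OF f] C by (intro mult_left_mono) auto
    also have "\<dots> = \<epsilon> * B f f + (\<Sum>i<n. (K i f)\<^sup>2)"
      using C by (simp add: K_def power_mult_distrib sum_distrib_left distrib_left)
    finally show ?thesis .
  qed
  ultimately show "\<exists>(n::nat) L. (\<forall>i<n. bounded_functional (L i)) \<and>
        (\<forall>f\<in>V. form r f f \<le> \<epsilon> * B f f + (\<Sum>i<n. (L i f)\<^sup>2))" by blast
qed

text \<open>Let \<open>P\<close> be the function that equals the average of \<open>f\<close> on every cube of a fine partition. Then
\<open>\<integral> r f\<^sup>2 = \<integral> r (f - P) (f + P) + \<integral> r P\<^sup>2\<close>. The first term is small uniformly in \<open>r\<close>, because \<open>f - P\<close>
is small in \<open>L\<^sup>2\<close>; the second one is a combination of the finitely many integrals of \<open>r\<close> over cubes,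
with coefficients bounded by the energy.\<close>

lemma form_uniformly_small:
  fixes r :: "nat \<Rightarrow> 'a \<Rightarrow> real"
  assumes r: "\<And>n. bounded_weight (r n) M"
    and lim: "\<And>A. A \<in> sets lebesgue \<Longrightarrow> emeasure lebesgue A < \<infinity> \<Longrightarrow> (\<lambda>n. \<integral>x. r n x * indicator A x \<partial>lebesgue) \<longlonglongrightarrow> 0"
    and \<epsilon>: "0 < \<epsilon>"
  shows "\<exists>N. \<forall>n\<ge>N. \<forall>f\<in>V. \<bar>form (r n) f f\<bar> \<le> \<epsilon> * B f f"
proof -
  define Cp where "Cp = Poincare_const"
  have Cp: "Cp > 0" by (simp add: Cp_def Poincare_const_pos)
  have M: "0 \<le> M" using r[of 0] by (simp add: bounded_weight_def)
  \<comment> \<open>Chosen such that the first term is at most half of the bound: the squared norms of f - P and f + P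
    are at most \<epsilon>1 B f f and (8 Cp + 2) B f f.\<close>
  define \<epsilon>1 where "\<epsilon>1 = min 1 ((\<epsilon> / 2)\<^sup>2 / ((M + 1)\<^sup>2 * (8 * Cp + 2)))"
  have \<epsilon>1: "0 < \<epsilon>1" "\<epsilon>1 \<le> 1" using \<epsilon> M Cp by (auto simp: \<epsilon>1_def)
  from cube_approximation[OF \<epsilon>1(1)] obtain \<Q> m where m: "0 < m" and fin: "finite \<Q>" and disj: "disjoint \<Q>"
    and Q: "\<And>Q. Q \<in> \<Q> \<Longrightarrow> Q \<in> sets lebesgue \<and> emeasure lebesgue Q = ennreal m" and cover: "\<Omega> \<subseteq> \<Union>\<Q>"
    and est: "\<And>u. u \<in> V \<Longrightarrow> (\<Sum>Q\<in>\<Q>. (\<integral>x. indicator Q x * (u x)\<^sup>2 \<partial>lebesgue)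
        - (\<integral>x. indicator Q x * u x \<partial>lebesgue)\<^sup>2 / m) \<le> \<epsilon>1 * B u u" by blast
  have "(\<lambda>n. \<Sum>Q\<in>\<Q>. \<bar>\<integral>x. r n x * indicator Q x \<partial>lebesgue\<bar>) \<longlonglongrightarrow> (\<Sum>Q\<in>\<Q>. 0)"
  proof (intro tendsto_sum tendsto_rabs_zero lim)
    fix Q assume "Q \<in> \<Q>"
    from Q[OF this] show "Q \<in> sets lebesgue" "emeasure lebesgue Q < \<infinity>"
      by (simp_all del: emeasure_completion)
  qed
  then have "(\<lambda>n. \<Sum>Q\<in>\<Q>. \<bar>\<integral>x. r n x * indicator Q x \<partial>lebesgue\<bar>) \<longlonglongrightarrow> 0" by simp
  from LIMSEQ_D[OF this, of "\<epsilon> * m / (2 * Cp)"] obtain N where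
    N: "\<And>n. n \<ge> N \<Longrightarrow> (\<Sum>Q\<in>\<Q>. \<bar>\<integral>x. r n x * indicator Q x \<partial>lebesgue\<bar>) < \<epsilon> * m / (2 * Cp)"
    using \<epsilon> m Cp by auto
  have "\<bar>form (r n) f f\<bar> \<le> \<epsilon> * B f f" if n: "n \<ge> N" and f: "f \<in> V" for n f
  proof -
    note fD = H0s_D(1,2)[OF f]
    have Bf: "0 \<le> B f f" by (rule nonneg[OF f])
    define S where "S Q = (\<integral>x. indicator Q x * f x \<partial>lebesgue)" for Q
    define T where "T Q = (\<integral>x. indicator Q x * (f x)\<^sup>2 \<partial>lebesgue)" for Q
    define P where "P x = (\<Sum>Q\<in>\<Q>. S Q / m * indicator Q x)" for x
    have Pm: "P \<in> borel_measurable lebesgue" unfolding P_def[abs_def]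
      using Q by (intro borel_measurable_sum borel_measurable_times borel_measurable_indicator) auto
    have P_in: "P x = S A / m" if "A \<in> \<Q>" "x \<in> A" for x A
    proof -
      have "P x = (\<Sum>Q\<in>\<Q>. if Q = A then S A / m else 0)" unfolding P_def
        using that disj by (intro sum.cong) (auto simp: indicator_def disjoint_def)
      then show ?thesis using fin that by simp
    qed
    have P_out: "P x = 0" if "x \<notin> \<Union>\<Q>" for x
      unfolding P_def using that by (intro sum.neutral) auto
    have sum_in: "(\<Sum>Q\<in>\<Q>. F Q * indicator Q x) = F A" if "A \<in> \<Q>" "x \<in> A" for x A and F :: "'a set \<Rightarrow> real"
    proof -
      have "(\<Sum>Q\<in>\<Q>. F Q * indicator Q x) = (\<Sum>Q\<in>\<Q>. if Q = A then F A else 0)"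
        using that disj by (intro sum.cong) (auto simp: indicator_def disjoint_def)
      then show ?thesis using fin that by simp
    qed
    have sum_out: "(\<Sum>Q\<in>\<Q>. F Q * indicator Q x) = 0" if "x \<notin> \<Union>\<Q>" for x and F :: "'a set \<Rightarrow> real"
      using that by (intro sum.neutral) auto
    have P2: "(P x)\<^sup>2 = (\<Sum>Q\<in>\<Q>. (S Q / m)\<^sup>2 * indicator Q x)" for x
      by (cases "x \<in> \<Union>\<Q>") (auto simp: P_in P_out sum_in sum_out)
    have iQ: "integrable lebesgue (indicator Q :: 'a \<Rightarrow> real)" "measure lebesgue Q = m" if "Q \<in> \<Q>" for Q
      using integrable_indicator_cube[of Q m] measure_cube[of Q m] Q[OF that] m by auto
    have P2i: "integrable lebesgue (\<lambda>x. (P x)\<^sup>2)"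
      unfolding P2 using iQ by (intro Bochner_Integration.integrable_sum integrable_mult_right) auto
    define d where "d x = f x - P x" for x
    have dm: "d \<in> borel_measurable lebesgue" unfolding d_def[abs_def] using Pm fD by simp
    \<comment> \<open>Outside the cubes both sides vanish, as f does.\<close>
    have d2: "AE x in lebesgue. (d x)\<^sup>2 = (\<Sum>Q\<in>\<Q>. (f x - S Q / m)\<^sup>2 * indicator Q x)"
      using H0s_D(5)[OF f]
    proof eventually_elim
      case (elim x)
      show ?case
      proof (cases "x \<in> \<Union>\<Q>")
        case True
        then obtain A where A: "A \<in> \<Q>" "x \<in> A" by auto
        show ?thesis using sum_in[OF A, of "\<lambda>Q. (f x - S Q / m)\<^sup>2"] P_in[OF A] by (simp add: d_def)
      next
        case False
        then show ?thesis using elim cover sum_out[OF False, of "\<lambda>Q. (f x - S Q / m)\<^sup>2"] P_out[OF False]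
          by (auto simp: d_def)
      qed
    qed
    have eqQ: "(f x - S Q / m)\<^sup>2 * indicator Q x = indicator Q x * (f x)\<^sup>2 -
        2 * (S Q / m) * (indicator Q x * f x) + (S Q / m)\<^sup>2 * indicator Q x" for x Q
      by (simp add: power2_diff algebra_simps)
    have int_Q: "integrable lebesgue (\<lambda>x. (f x - S Q / m)\<^sup>2 * indicator Q x)"
      and val_Q: "(\<integral>x. (f x - S Q / m)\<^sup>2 * indicator Q x \<partial>lebesgue) = T Q - (S Q)\<^sup>2 / m" if "Q \<in> \<Q>" for Q
    proof -
      have i: "integrable lebesgue (\<lambda>x. indicator Q x * f x)" "integrable lebesgue (\<lambda>x. indicator Q x * (f x)\<^sup>2)"
        using integrable_on_cube[of Q m f] Q[OF that] m f by auto
      show "integrable lebesgue (\<lambda>x. (f x - S Q / m)\<^sup>2 * indicator Q x)"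
        unfolding eqQ using i iQ[OF that] by simp
      have "(\<integral>x. (f x - S Q / m)\<^sup>2 * indicator Q x \<partial>lebesgue) = T Q - 2 * (S Q / m) * S Q + (S Q / m)\<^sup>2 * m"
        unfolding eqQ using i iQ[OF that] by (simp add: S_def[symmetric] T_def[symmetric])
      also have "\<dots> = T Q - (S Q)\<^sup>2 / m" using m by (simp add: field_simps power2_eq_square)
      finally show "(\<integral>x. (f x - S Q / m)\<^sup>2 * indicator Q x \<partial>lebesgue) = T Q - (S Q)\<^sup>2 / m" .
    qed
    have sm: "(\<lambda>x. \<Sum>Q\<in>\<Q>. (f x - S Q / m)\<^sup>2 * indicator Q x) \<in> borel_measurable lebesgue"
      using int_Q by (intro borel_measurable_sum borel_measurable_integrable) auto
    have d2i: "integrable lebesgue (\<lambda>x. (d x)\<^sup>2)"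
      by (rule integrable_cong_AE_imp[where g = "\<lambda>x. \<Sum>Q\<in>\<Q>. (f x - S Q / m)\<^sup>2 * indicator Q x"])
        (use int_Q dm d2 in \<open>auto simp: eq_commute intro!: Bochner_Integration.integrable_sum\<close>)
    have "(\<integral>x. (d x)\<^sup>2 \<partial>lebesgue) = (\<integral>x. (\<Sum>Q\<in>\<Q>. (f x - S Q / m)\<^sup>2 * indicator Q x) \<partial>lebesgue)"
      by (rule integral_cong_AE) (use dm sm d2 in auto)
    also have "\<dots> = (\<Sum>Q\<in>\<Q>. T Q - (S Q)\<^sup>2 / m)"
      using int_Q by (subst Bochner_Integration.integral_sum) (auto simp: val_Q)
    also have "\<dots> \<le> \<epsilon>1 * B f f" using est[OF f] by (simp add: S_def T_def)
    finally have d_le: "(\<integral>x. (d x)\<^sup>2 \<partial>lebesgue) \<le> \<epsilon>1 * B f f" .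
    define e where "e x = f x + P x" for x
    have em: "e \<in> borel_measurable lebesgue" unfolding e_def[abs_def] using Pm fD by simp
    have e2i: "integrable lebesgue (\<lambda>x. (e x)\<^sup>2)"
      unfolding e_def by (rule integrable_square_add) (use fD Pm P2i in auto)
    have "(\<integral>x. (e x)\<^sup>2 \<partial>lebesgue) \<le> (\<integral>x. 8 * (f x)\<^sup>2 + 2 * (d x)\<^sup>2 \<partial>lebesgue)"
    proof (rule integral_mono)
      fix x
      \<comment> \<open>This form of f + P bounds its norm by those of f and of f - P.\<close>
      have "e x = 2 * f x - d x" by (simp add: e_def d_def)
      moreover have "(2 * a - b)\<^sup>2 \<le> 8 * a\<^sup>2 + 2 * b\<^sup>2" for a b :: real
        using zero_le_power2[of "2 * a + b"] by (simp add: power2_eq_square algebra_simps)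
      ultimately show "(e x)\<^sup>2 \<le> 8 * (f x)\<^sup>2 + 2 * (d x)\<^sup>2" by simp
    qed (use e2i d2i fD in auto)
    also have "\<dots> = 8 * (\<integral>x. (f x)\<^sup>2 \<partial>lebesgue) + 2 * (\<integral>x. (d x)\<^sup>2 \<partial>lebesgue)" using d2i fD by simp
    also have "\<dots> \<le> 8 * (Cp * B f f) + 2 * (1 * B f f)"
      using Poincare_ineq[OF f] d_le mult_right_mono[OF \<epsilon>1(2) Bf] by (simp add: Cp_def)
    finally have e_le: "(\<integral>x. (e x)\<^sup>2 \<partial>lebesgue) \<le> (8 * Cp + 2) * B f f" by (simp add: algebra_simps)
    have split: "form (r n) f f = form (r n) d e + (\<integral>x. r n x * (P x)\<^sup>2 \<partial>lebesgue)"
    proof -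
      have i1: "integrable lebesgue (\<lambda>x. r n x * (d x * e x))" by (rule integrable_weight_mult[OF r dm d2i em e2i])
      have i2: "integrable lebesgue (\<lambda>x. r n x * (P x)\<^sup>2)"
        using integrable_weight_mult[OF r Pm P2i Pm P2i] by (simp add: power2_eq_square)
      have "r n x * (f x * f x) = r n x * (d x * e x) + r n x * (P x)\<^sup>2" for x
        by (simp add: d_def e_def power2_eq_square algebra_simps)
      then show ?thesis using i1 i2 by (simp add: form_def)
    qed
    have "\<bar>form (r n) d e\<bar> \<le> M * (sqrt (\<integral>x. (d x)\<^sup>2 \<partial>lebesgue) * sqrt (\<integral>x. (e x)\<^sup>2 \<partial>lebesgue))"
      by (rule form_le[OF r dm d2i em e2i])
    also have "\<dots> \<le> (M + 1) * (sqrt (\<epsilon>1 * B f f) * sqrt ((8 * Cp + 2) * B f f))"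
      using M d_le e_le Bf \<epsilon>1 by (intro mult_mono real_sqrt_le_mono mult_nonneg_nonneg real_sqrt_ge_zero integral_nonneg_AE) auto
    also have "\<dots> = sqrt ((M + 1)\<^sup>2 * \<epsilon>1 * (8 * Cp + 2)) * B f f"
    proof -
      have "sqrt (\<epsilon>1 * B f f) * sqrt ((8 * Cp + 2) * B f f) = sqrt (\<epsilon>1 * (8 * Cp + 2) * (B f f * B f f))"
        by (simp flip: real_sqrt_mult add: algebra_simps)
      also have "\<dots> = sqrt (\<epsilon>1 * (8 * Cp + 2)) * B f f" using Bf by (simp add: real_sqrt_mult)
      finally show ?thesis using M by (simp add: real_sqrt_mult)
    qed
    also have "\<dots> \<le> \<epsilon> / 2 * B f f"
    proof (rule mult_right_mono[OF _ Bf])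
      have "(M + 1)\<^sup>2 * \<epsilon>1 * (8 * Cp + 2) \<le> (M + 1)\<^sup>2 * ((\<epsilon> / 2)\<^sup>2 / ((M + 1)\<^sup>2 * (8 * Cp + 2))) * (8 * Cp + 2)"
        using Cp by (intro mult_right_mono mult_left_mono) (auto simp: \<epsilon>1_def)
      also have "\<dots> = (\<epsilon> / 2)\<^sup>2"
      proof -
        have "a * (c / (a * b)) * b = c" if "a \<noteq> 0" "b \<noteq> 0" for a b c :: real using that by simp
        moreover have "(M + 1)\<^sup>2 \<noteq> 0" "8 * Cp + 2 \<noteq> 0" using M Cp by auto
        ultimately show ?thesis by blast
      qed
      finally have "sqrt ((M + 1)\<^sup>2 * \<epsilon>1 * (8 * Cp + 2)) \<le> sqrt ((\<epsilon> / 2)\<^sup>2)" by (rule real_sqrt_le_mono)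
      then show "sqrt ((M + 1)\<^sup>2 * \<epsilon>1 * (8 * Cp + 2)) \<le> \<epsilon> / 2" using \<epsilon> by simp
    qed
    finally have 1: "\<bar>form (r n) d e\<bar> \<le> \<epsilon> / 2 * B f f" .
    have ri: "integrable lebesgue (\<lambda>x. r n x * indicator Q x)" if "Q \<in> \<Q>" for Q
    proof -
      have ind2: "(indicator Q x :: real)\<^sup>2 = indicator Q x" "indicator Q x * indicator Q x = (indicator Q x :: real)" for x
        by (simp_all add: indicator_def)
      show ?thesis
        using integrable_weight_mult[OF r, of "indicator Q" "indicator Q" n] Q[OF that] iQ(1)[OF that]
        by (simp add: ind2)
    qed
    have "(\<integral>x. r n x * (P x)\<^sup>2 \<partial>lebesgue) = (\<integral>x. (\<Sum>Q\<in>\<Q>. (S Q / m)\<^sup>2 * (r n x * indicator Q x)) \<partial>lebesgue)"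
      by (simp add: P2 sum_distrib_left mult.left_commute)
    also have "\<dots> = (\<Sum>Q\<in>\<Q>. (S Q / m)\<^sup>2 * (\<integral>x. r n x * indicator Q x \<partial>lebesgue))"
      using ri by (subst Bochner_Integration.integral_sum) auto
    finally have "\<bar>\<integral>x. r n x * (P x)\<^sup>2 \<partial>lebesgue\<bar> \<le> (\<Sum>Q\<in>\<Q>. \<bar>(S Q / m)\<^sup>2 * (\<integral>x. r n x * indicator Q x \<partial>lebesgue)\<bar>)"
      by (simp only: sum_abs)
    also have "\<dots> \<le> (\<Sum>Q\<in>\<Q>. (Cp * B f f / m) * \<bar>\<integral>x. r n x * indicator Q x \<partial>lebesgue\<bar>)"
    proof (rule sum_mono)
      fix Q assume QQ: "Q \<in> \<Q>"
      have "(S Q)\<^sup>2 \<le> m * (\<integral>x. (f x)\<^sup>2 \<partial>lebesgue)"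
        unfolding S_def using cube_integral_square_le[of Q m f] Q[OF QQ] m f by blast
      also have "\<dots> \<le> m * (Cp * B f f)" using Poincare_ineq[OF f] m by (simp add: Cp_def)
      finally have "(S Q)\<^sup>2 / m\<^sup>2 \<le> m * (Cp * B f f) / m\<^sup>2" by (rule divide_right_mono) simp
      then have "(S Q / m)\<^sup>2 \<le> Cp * B f f / m" using m by (simp add: power_divide power2_eq_square)
      then show "\<bar>(S Q / m)\<^sup>2 * (\<integral>x. r n x * indicator Q x \<partial>lebesgue)\<bar> \<le>
          (Cp * B f f / m) * \<bar>\<integral>x. r n x * indicator Q x \<partial>lebesgue\<bar>"
        unfolding abs_mult by (intro mult_right_mono) auto
    qed
    also have "\<dots> = (Cp * B f f / m) * (\<Sum>Q\<in>\<Q>. \<bar>\<integral>x. r n x * indicator Q x \<partial>lebesgue\<bar>)"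
      by (simp add: sum_distrib_left)
    also have "\<dots> \<le> (Cp * B f f / m) * (\<epsilon> * m / (2 * Cp))"
      using N[OF n] Cp Bf m by (intro mult_left_mono) auto
    also have "\<dots> = \<epsilon> / 2 * B f f" using Cp m by (simp add: field_simps)
    finally show ?thesis using 1 split by linarith
  qed
  then show ?thesis by blast
qed

end

section \<open>Uniform boundedness of sequences of essentially bounded functions\<close>

text \<open>Let \<open>(3 / 2) C\<close> be the least value of the form \<open>c (3 / 2) ^ k\<close> that bounds \<open>\<bar>h\<bar>\<close> almost everywhere. Then
\<open>\<bar>h\<bar> > C\<close> on a set of positive measure, and the normalized indicator of this set, with the sign of
\<open>h\<close>, is the test function. The ratio \<open>3 / 2\<close> between upper and lower bound is small enough for the
series below.\<close>

lemma near_norming_test_function: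
  fixes h :: "'a \<Rightarrow> real"
  assumes M: "finite_measure M" and h[measurable]: "h \<in> borel_measurable M"
    and bd: "AE x in M. \<bar>h x\<bar> \<le> D" and nb: "\<not> (AE x in M. \<bar>h x\<bar> \<le> c)" and c: "0 < c"
  shows "\<exists>C e. c \<le> C \<and> (AE x in M. \<bar>h x\<bar> \<le> 3 / 2 * C) \<and> e \<in> borel_measurable M \<and>
     integrable M e \<and> (\<integral>x. \<bar>e x\<bar> \<partial>M) \<le> 1 \<and> C \<le> (\<integral>x. h x * e x \<partial>M)"
proof -
  interpret finite_measure M by fact
  define P where "P k \<longleftrightarrow> (AE x in M. \<bar>h x\<bar> \<le> c * (3 / 2) ^ k)" for k :: nat
  obtain k0 :: nat where "D / c < (3 / 2) ^ k0" using real_arch_pow[of "3/2" "D / c"] by auto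
  then have "D \<le> c * (3 / 2) ^ k0" using c by (simp add: field_simps)
  then have "P k0" unfolding P_def using bd by (auto elim: eventually_mono)
  then have P: "P (LEAST k. P k)" by (rule LeastI)
  moreover have "\<not> P 0" using nb by (simp add: P_def)
  ultimately have "(LEAST k. P k) \<noteq> 0" by metis
  then obtain k where k: "(LEAST k. P k) = Suc k" using not0_implies_Suc by blast
  have nk: "\<not> P k" using k not_less_Least[of k P] by simp
  define C where "C = c * (3 / 2) ^ k"
  have "1 \<le> (3 / 2 :: real) ^ k" by (rule one_le_power) simp
  then have C: "c \<le> C" "C > 0" using c by (auto simp: C_def)
  have up: "AE x in M. \<bar>h x\<bar> \<le> 3 / 2 * C" 
  proof -
    have "P (Suc k)" using P k by simp
    moreover have "c * (3 / 2) ^ Suc k = 3 / 2 * C" by (simp add: C_def)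
    ultimately show ?thesis unfolding P_def by (simp only:)
  qed
  have lo: "\<not> (AE x in M. \<bar>h x\<bar> \<le> C)" using nk by (simp add: P_def C_def)
  define A where "A = {x \<in> space M. C < \<bar>h x\<bar>}"
  have A[measurable]: "A \<in> sets M" unfolding A_def by measurable
  have "A \<notin> null_sets M"
  proof
    assume "A \<in> null_sets M"
    then have "AE x in M. x \<notin> A" by (rule AE_not_in)
    then have "AE x in M. \<bar>h x\<bar> \<le> C" using AE_space by eventually_elim (auto simp: A_def)
    then show False using lo by blast
  qed
  then have mA: "measure M A > 0"
    using A by (simp add: null_sets_def emeasure_eq_measure zero_less_measure_iff)
  define e where "e x = sgn (h x) * indicator A x / measure M A" for x
  have em[measurable]: "e \<in> borel_measurable M" unfolding e_def[abs_def] by measurable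
  have iA: "integrable M (indicator A :: 'a \<Rightarrow> real)" by (simp add: emeasure_eq_measure)
  have abs_e: "\<bar>e x\<bar> = indicator A x / measure M A" for x
    using C mA by (auto simp: e_def indicator_def A_def abs_mult sgn_if)
  have ie: "integrable M e"
  proof -
    have "integrable M (\<lambda>x. \<bar>e x\<bar>)" unfolding abs_e using iA by simp
    then show ?thesis by (subst (asm) integrable_abs_iff) measurable
  qed
  have "(\<integral>x. \<bar>e x\<bar> \<partial>M) \<le> 1" unfolding abs_e using mA by simp
  moreover have "C \<le> (\<integral>x. h x * e x \<partial>M)"
  proof -
    have he: "h x * e x = \<bar>h x\<bar> * (indicator A x / measure M A)" for x
      by (simp add: e_def abs_sgn mult.assoc)
    have "C = (\<integral>x. C * (indicator A x / measure M A) \<partial>M)" using mA by simp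
    also have "\<dots> \<le> (\<integral>x. h x * e x \<partial>M)"
    proof (rule integral_mono_AE)
      show "integrable M (\<lambda>x. C * (indicator A x / measure M A))" using iA by simp
      show "integrable M (\<lambda>x. h x * e x)"
      proof (rule Bochner_Integration.integrable_bound[where f = "\<lambda>x. D * e x"])
        show "AE x in M. norm (h x * e x) \<le> norm (D * e x)"
          using bd by eventually_elim (auto simp: abs_mult intro!: mult_right_mono)
      qed (use ie in auto)
      show "AE x in M. C * (indicator A x / measure M A) \<le> h x * e x"
        unfolding he using mA by (intro AE_I2) (auto simp: indicator_def A_def divide_right_mono)
    qed
    finally show ?thesis .
  qed
  ultimately show ?thesis using C up ie em by blast
qed

text \<open>A gliding hump. If the essential suprema were unbounded, choose functions with bounds \<open>C j \<ge> 4 ^ j\<close> and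
near-extremal test functions \<open>e j\<close>, and let \<open>g\<close> be the sum of \<open>\<plusminus> (1 / 3) ^ j e j\<close>. With the sign that
prevents cancellation against the earlier terms, the partial sum up to \<open>j\<close> has an integral of size at
least \<open>(1 / 3) ^ j C j\<close> against the \<open>j\<close>-th function, while the tail contributes at most \<open>3 / 4\<close> of
this. What is left grows like \<open>(4 / 3) ^ j\<close>.\<close>

theorem uniform_boundedness_Linf:
  fixes h :: "nat \<Rightarrow> 'a \<Rightarrow> real"
  assumes M: "finite_measure M" and h: "\<And>n. h n \<in> borel_measurable M"
    and bd: "\<And>n. \<exists>D. AE x in M. \<bar>h n x\<bar> \<le> D"
    and pt: "\<And>g. integrable M g \<Longrightarrow> \<exists>K. \<forall>n. \<bar>\<integral>x. h n x * g x \<partial>M\<bar> \<le> K"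
  shows "\<exists>K. \<forall>n. AE x in M. \<bar>h n x\<bar> \<le> K"
proof (rule ccontr)
  assume contr: "\<nexists>K. \<forall>n. AE x in M. \<bar>h n x\<bar> \<le> K"
  define R where "R j n C e \<longleftrightarrow> 4 ^ j \<le> C \<and> (AE x in M. \<bar>h n x\<bar> \<le> 3 / 2 * C) \<and> e \<in> borel_measurable M \<and>
     integrable M e \<and> (\<integral>x. \<bar>e x\<bar> \<partial>M) \<le> 1 \<and> C \<le> (\<integral>x. h n x * e x \<partial>M)" for j n :: nat and C e
  have "\<exists>n C e. R j n C e" for j
  proof -
    obtain n where n: "\<not> (AE x in M. \<bar>h n x\<bar> \<le> 4 ^ j)" using contr by blast
    obtain D where "AE x in M. \<bar>h n x\<bar> \<le> D" using bd by blast
    from near_norming_test_function[OF M h this n] show ?thesis unfolding R_def by auto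
  qed
  then obtain n C e where R: "\<And>j. R j (n j) (C j) (e j)" by metis
  have C: "\<And>j. 4 ^ j \<le> C j" and up: "\<And>j. AE x in M. \<bar>h (n j) x\<bar> \<le> 3 / 2 * C j"
    and em: "\<And>j. e j \<in> borel_measurable M" and ie: "\<And>j. integrable M (e j)"
    and e1: "\<And>j. (\<integral>x. \<bar>e j x\<bar> \<partial>M) \<le> 1" and Ce: "\<And>j. C j \<le> (\<integral>x. h (n j) x * e j x \<partial>M)"
    using R unfolding R_def by blast+
  have C0: "C j > 0" for j using C[of j] by (rule less_le_trans[rotated]) simp
  define U where "U j = 3 / 2 * C j" for j
  have U0: "U j > 0" and upU: "AE x in M. \<bar>h (n j) x\<bar> \<le> U j" for j
    using C0[of j] up[of j] unfolding U_def by simp_all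
  define T where "T j g = (\<integral>x. h (n j) x * g x \<partial>M)" for j and g :: "'a \<Rightarrow> real"
  have iT: "integrable M (\<lambda>x. h (n j) x * g x)" if "integrable M g" for j g
  proof (rule Bochner_Integration.integrable_bound[where f = "\<lambda>x. U j * g x"])
    show "AE x in M. norm (h (n j) x * g x) \<le> norm (U j * g x)"
      using upU[of j] by eventually_elim (use U0[of j] in \<open>auto simp: abs_mult intro!: mult_right_mono\<close>)
  qed (use that h in auto)
  define S where "S = rec_nat (\<lambda>x. 0 :: real)
    (\<lambda>j S x. S x + (if T j S \<ge> 0 then 1 else - 1) * (1 / 3) ^ j * e j x)"
  define \<sigma> :: "nat \<Rightarrow> real" where "\<sigma> j = (if T j (S j) \<ge> 0 then 1 else - 1)" for j
  have S0: "S 0 = (\<lambda>x. 0)" by (simp add: S_def)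
  have SSuc: "S (Suc j) = (\<lambda>x. S j x + \<sigma> j * (1 / 3) ^ j * e j x)" for j
    by (simp add: S_def \<sigma>_def)
  define d where "d j x = \<sigma> j * (1 / 3) ^ j * e j x" for j x
  have abs_d: "\<bar>d j x\<bar> = (1 / 3) ^ j * \<bar>e j x\<bar>" for j x by (simp add: d_def \<sigma>_def abs_mult)
  have id: "integrable M (d j)" for j unfolding d_def using ie by simp
  have dm: "d j \<in> borel_measurable M" for j using id by blast
  have d1: "(\<integral>x. \<bar>d j x\<bar> \<partial>M) \<le> (1 / 3) ^ j" for j
    unfolding abs_d using e1[of j] by simp
  have Sd: "S j x = (\<Sum>i<j. d i x)" for j x
    by (induction j) (simp_all add: S0 SSuc d_def)
  have TS: "T k (S j) = (\<Sum>i<j. T k (d i))" for j k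
    unfolding T_def Sd sum_distrib_left by (rule Bochner_Integration.integral_sum) (rule iT[OF id])
  have sum_d: "AE x in M. summable (\<lambda>i. \<bar>d i x\<bar>)"
  proof -
    have "(\<integral>\<^sup>+x. (\<Sum>i. ennreal \<bar>d i x\<bar>) \<partial>M) = (\<Sum>i. \<integral>\<^sup>+x. ennreal \<bar>d i x\<bar> \<partial>M)"
      using dm by (intro nn_integral_suminf) auto
    also have "\<dots> \<le> (\<Sum>i. ennreal ((1 / 3) ^ i))"
    proof (intro suminf_le)
      fix i
      have "(\<integral>\<^sup>+x. ennreal \<bar>d i x\<bar> \<partial>M) = ennreal (\<integral>x. \<bar>d i x\<bar> \<partial>M)"
        using id by (intro nn_integral_eq_integral) auto
      then show "(\<integral>\<^sup>+x. ennreal \<bar>d i x\<bar> \<partial>M) \<le> ennreal ((1 / 3) ^ i)" using d1[of i] by (simp add: ennreal_leI)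
    qed auto
    also have "\<dots> = ennreal (\<Sum>i. (1 / 3) ^ i)" by (intro suminf_ennreal2) (auto intro: summable_geometric)
    also have "\<dots> < \<infinity>" by simp
    finally have "(\<integral>\<^sup>+x. (\<Sum>i. ennreal \<bar>d i x\<bar>) \<partial>M) \<noteq> \<infinity>" by simp
    then have "AE x in M. (\<Sum>i. ennreal \<bar>d i x\<bar>) \<noteq> \<infinity>"
      by (rule nn_integral_noteq_infinite[rotated]) (use dm in measurable)
    then show ?thesis by eventually_elim (intro summable_suminf_not_top; simp)
  qed
  define g where "g x = (\<Sum>i. d i x)" for x
  have ig: "integrable M g" unfolding g_def
  proof (rule integrable_suminf[OF id])
    show "AE x in M. summable (\<lambda>i. norm (d i x))" using sum_d by simp
    show "summable (\<lambda>i. \<integral>x. norm (d i x) \<partial>M)"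
      by (rule summable_comparison_test'[where g = "\<lambda>i. (1 / 3) ^ i" and N = 0])
        (use d1 in \<open>auto intro: summable_geometric\<close>)
  qed
  have Td: "\<bar>T j (d i)\<bar> \<le> U j * (1 / 3) ^ i" for j i
  proof -
    have "\<bar>T j (d i)\<bar> \<le> (\<integral>x. \<bar>h (n j) x * d i x\<bar> \<partial>M)" unfolding T_def by (rule integral_abs_bound)
    also have "\<dots> \<le> (\<integral>x. U j * \<bar>d i x\<bar> \<partial>M)"
    proof (rule integral_mono_AE)
      show "AE x in M. \<bar>h (n j) x * d i x\<bar> \<le> U j * \<bar>d i x\<bar>"
        using upU[of j] by eventually_elim (auto simp: abs_mult intro!: mult_right_mono)
    qed (use iT[OF id] id in auto)
    also have "\<dots> = U j * (\<integral>x. \<bar>d i x\<bar> \<partial>M)" by simp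
    also have "\<dots> \<le> U j * (1 / 3) ^ i" using d1[of i] U0[of j] by (intro mult_left_mono) auto
    finally show ?thesis .
  qed
  have sums_geo: "summable (\<lambda>i. U j * (1 / 3) ^ i)" for j by (intro summable_mult summable_geometric) simp
  have Tg: "(\<lambda>i. T j (d i)) sums T j g" for j
  proof -
    have "(\<lambda>i. \<integral>x. h (n j) x * d i x \<partial>M) sums (\<integral>x. (\<Sum>i. h (n j) x * d i x) \<partial>M)"
    proof (rule sums_integral[OF iT[OF id]])
      show "AE x in M. summable (\<lambda>i. norm (h (n j) x * d i x))"
        using sum_d by eventually_elim (auto simp: abs_mult intro: summable_mult)
      show "summable (\<lambda>i. \<integral>x. norm (h (n j) x * d i x) \<partial>M)"
      proof (rule summable_comparison_test'[OF sums_geo[of j], of 0])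
        fix i :: nat
        have "(\<integral>x. norm (h (n j) x * d i x) \<partial>M) \<le> (\<integral>x. U j * \<bar>d i x\<bar> \<partial>M)"
        proof (rule integral_mono_AE)
          show "AE x in M. norm (h (n j) x * d i x) \<le> U j * \<bar>d i x\<bar>"
            using upU[of j] by eventually_elim (auto simp: abs_mult intro!: mult_right_mono)
        qed (use iT[OF id] id in auto)
        also have "\<dots> = U j * (\<integral>x. \<bar>d i x\<bar> \<partial>M)" by simp
        also have "\<dots> \<le> U j * (1 / 3) ^ i" using d1[of i] U0[of j] by (intro mult_left_mono) auto
        finally show "norm (\<integral>x. norm (h (n j) x * d i x) \<partial>M) \<le> U j * (1 / 3) ^ i"
          by (simp add: abs_of_nonneg integral_nonneg_AE)
      qed
    qed
    moreover have "(\<integral>x. (\<Sum>i. h (n j) x * d i x) \<partial>M) = T j g"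
      unfolding T_def
    proof (rule integral_cong_AE)
      show "AE x in M. (\<Sum>i. h (n j) x * d i x) = h (n j) x * g x"
        using sum_d
      proof eventually_elim
        case (elim x)
        then have "summable (\<lambda>i. d i x)" by (rule summable_rabs_cancel)
        then show ?case unfolding g_def by (rule suminf_mult)
      qed
    qed (intro borel_measurable_suminf borel_measurable_times h dm borel_measurable_integrable[OF ig])+
    ultimately show ?thesis unfolding T_def by simp
  qed
  have large: "1 / 4 * (4 / 3) ^ j \<le> \<bar>T j g\<bar>" for j
  proof -
    have 1: "(1 / 3) ^ j * C j \<le> \<bar>T j (S (Suc j))\<bar>"
    proof -
      have "T j (S (Suc j)) = T j (S j) + T j (d j)" by (simp add: TS)
      moreover have "T j (d j) = \<sigma> j * ((1 / 3) ^ j * T j (e j))"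
        unfolding T_def d_def by (simp add: mult.assoc mult.left_commute[of "h _ _"])
      moreover have "(1 / 3) ^ j * C j \<le> (1 / 3) ^ j * T j (e j)"
        using Ce[of j] by (intro mult_left_mono) (auto simp: T_def)
      moreover have "0 < (1 / 3) ^ j * C j" using C0[of j] by simp
      moreover have "0 \<le> T j (S j) \<and> \<sigma> j = 1 \<or> T j (S j) < 0 \<and> \<sigma> j = - 1" by (auto simp: \<sigma>_def)
      then have "0 \<le> T j (S j) \<and> T j (d j) = (1 / 3) ^ j * T j (e j) \<or>
          T j (S j) < 0 \<and> T j (d j) = - ((1 / 3) ^ j * T j (e j))"
        using \<open>T j (d j) = \<sigma> j * ((1 / 3) ^ j * T j (e j))\<close> by auto
      ultimately show ?thesis by linarith
    qed
    have sT: "summable (\<lambda>i. T j (d i))" and gT: "T j g = (\<Sum>i. T j (d i))"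
      using Tg[of j] by (auto simp: sums_iff)
    have "T j g = (\<Sum>i. T j (d (i + Suc j))) + T j (S (Suc j))"
      unfolding gT TS by (rule suminf_split_initial_segment[OF sT])
    moreover have "\<bar>\<Sum>i. T j (d (i + Suc j))\<bar> \<le> 3 / 4 * ((1 / 3) ^ j * C j)"
    proof -
      have geo: "(\<lambda>i. U j * (1 / 3) ^ Suc j * (1 / 3) ^ i) sums (U j * (1 / 3) ^ Suc j * (1 / (1 - 1 / 3)))"
        by (intro sums_mult geometric_sums) simp
      have le: "\<bar>T j (d (i + Suc j))\<bar> \<le> U j * (1 / 3) ^ Suc j * (1 / 3) ^ i" for i
        using Td[of j "i + Suc j"] by (simp add: power_add mult_ac)
      have sa: "summable (\<lambda>i. \<bar>T j (d (i + Suc j))\<bar>)"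
        by (rule summable_comparison_test'[OF sums_summable[OF geo], of 0]) (use le in simp)
      have "\<bar>\<Sum>i. T j (d (i + Suc j))\<bar> \<le> (\<Sum>i. \<bar>T j (d (i + Suc j))\<bar>)" by (rule summable_rabs[OF sa])
      also have "\<dots> \<le> (\<Sum>i. U j * (1 / 3) ^ Suc j * (1 / 3) ^ i)"
        by (rule suminf_le[OF le sa sums_summable[OF geo]])
      also have "\<dots> = 3 / 4 * ((1 / 3) ^ j * C j)" unfolding sums_unique[OF geo, symmetric] by (simp add: U_def)
      finally show ?thesis .
    qed
    ultimately have "1 / 4 * ((1 / 3) ^ j * C j) \<le> \<bar>T j g\<bar>" using 1 by linarith
    moreover have "(4 / 3) ^ j \<le> (1 / 3) ^ j * C j"
    proof -
      have "(4 / 3 :: real) ^ j = (1 / 3) ^ j * 4 ^ j" by (simp flip: power_mult_distrib)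
      also have "\<dots> \<le> (1 / 3) ^ j * C j" using C[of j] by (intro mult_left_mono) auto
      finally show ?thesis .
    qed
    ultimately show ?thesis by linarith
  qed
  obtain K where K: "\<And>n. \<bar>\<integral>x. h n x * g x \<partial>M\<bar> \<le> K" using pt[OF ig] by blast
  obtain j :: nat where "4 * K < (4 / 3) ^ j" using real_arch_pow[of "4/3" "4 * K"] by auto
  then show False using large[of j] K[of "n j"] unfolding T_def by linarith
qed

section \<open>Lipschitz functions in the fractional space\<close>

lemma nn_integral_lborel_reflect:
  fixes g :: "'a::euclidean_space \<Rightarrow> ennreal"
  assumes [measurable]: "g \<in> borel_measurable borel"
  shows "(\<integral>\<^sup>+y. g (x - y) \<partial>lborel) = (\<integral>\<^sup>+y. g y \<partial>lborel)"
proof -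
  have "(lborel :: 'a measure) = distr lborel borel (\<lambda>y. x - y)"
    using lborel_affine[of "-1" x] by (simp add: density_1)
  then have "(\<integral>\<^sup>+y. g y \<partial>lborel) = (\<integral>\<^sup>+y. g y \<partial>distr lborel borel (\<lambda>y. x - y))" by simp
  also have "\<dots> = (\<integral>\<^sup>+y. g (x - y) \<partial>lborel)" by (rule nn_integral_distr) auto
  finally show ?thesis by simp
qed

lemma half_power_powr: "(1 / 2 :: real) ^ j = 2 powr (- real j)"
  by (simp add: powr_minus powr_realpow power_one_over inverse_eq_divide)

lemma ennreal_term_le_suminf: "f j \<le> (\<Sum>j. f j)" for f :: "nat \<Rightarrow> ennreal"
  using sum_le_suminf[of f "{j}"] by simp

text \<open>On the shell where \<open>norm z\<close> is about \<open>2 ^ j\<close>, which has measure about \<open>2 ^ (N j)\<close>, the integrand is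
at most a constant times \<open>2 powr (- (N + 2 s) j)\<close> for \<open>j \<ge> 0\<close> and \<open>2 powr ((2 - N - 2 s) j)\<close> for \<open>j < 0\<close>.
This leaves two geometric series, with ratios \<open>2 powr (- 2 s)\<close> and \<open>2 powr (2 s - 2)\<close>.\<close>

lemma kernel_finite:
  fixes s :: real
  assumes s: "0 < s" "s < 1"
  shows "(\<integral>\<^sup>+z. ennreal (min 1 ((norm z)\<^sup>2) / norm z powr (real DIM('a) + 2 * s))
      \<partial>(lborel :: 'a::euclidean_space measure)) < \<infinity>"
proof -
  define N where "N = DIM('a)"
  define e where "e = real N + 2 * s"
  define b where "b = unit_ball_vol (real N)"
  have b: "b \<ge> 0" by (simp add: b_def)
  define k where "k z = min 1 ((norm z)\<^sup>2) / norm z powr e" for z :: 'a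
  define a where "a j = ((1 / 2) ^ j)\<^sup>2 / ((1 / 2) ^ Suc j) powr e" for j :: nat
  define c where "c j = 1 / (2 ^ j) powr e" for j :: nat
  have a0: "a j \<ge> 0" and c0: "c j \<ge> 0" for j by (simp_all add: a_def c_def)
  have e0: "e > 0" using s by (simp add: e_def)
  have pw: "ennreal (k z) \<le> (\<Sum>j. ennreal (a j) * indicator (ball 0 ((1 / 2) ^ j)) z) +
      (\<Sum>j. ennreal (c j) * indicator (ball 0 (2 ^ Suc j)) z)" for z
  proof (cases "z = 0")
    case True
    then show ?thesis by (simp add: k_def)
  next
    case False
    then have nz: "norm z > 0" by simp
    show ?thesis
    proof (cases "norm z < 1")
      case True
      obtain j0 where "(1 / 2) ^ j0 < norm z" using real_arch_pow_inv[OF nz, of "1/2"] by auto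
      moreover have "(1 / 2 :: real) ^ Suc j0 \<le> (1 / 2) ^ j0" by simp
      ultimately have ex: "\<exists>j. (1 / 2) ^ Suc j \<le> norm z" by (meson less_imp_le order.trans)
      define j where "j = (LEAST j. (1 / 2) ^ Suc j \<le> norm z)"
      have j1: "(1 / 2) ^ Suc j \<le> norm z" unfolding j_def by (rule LeastI_ex[OF ex])
      have j2: "norm z < (1 / 2) ^ j"
      proof (cases j)
        case 0
        then show ?thesis using True by simp
      next
        case (Suc i)
        then have "\<not> (1 / 2) ^ Suc i \<le> norm z" using not_less_Least[of i "\<lambda>j. (1 / 2) ^ Suc j \<le> norm z"]
          by (simp add: j_def)
        then show ?thesis using Suc by simp
      qed
      have "k z \<le> (norm z)\<^sup>2 / norm z powr e" unfolding k_def by (intro divide_right_mono) auto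
      also have "\<dots> \<le> ((1 / 2) ^ j)\<^sup>2 / ((1 / 2) ^ Suc j) powr e"
        using j1 j2 nz e0 by (intro frac_le power_mono powr_mono2) auto
      finally have "ennreal (k z) \<le> ennreal (a j) * indicator (ball 0 ((1 / 2) ^ j)) z"
        using j2 by (simp add: a_def ennreal_leI)
      also have "\<dots> \<le> (\<Sum>j. ennreal (a j) * indicator (ball 0 ((1 / 2) ^ j)) z)"
        by (rule ennreal_term_le_suminf)
      finally show ?thesis by (simp add: add_increasing2)
    next
      case False
      obtain j0 where "norm z < 2 ^ j0" using real_arch_pow[of 2 "norm z"] by auto
      moreover have "(2 :: real) ^ j0 \<le> 2 ^ Suc j0" by simp
      ultimately have ex: "\<exists>j. norm z < 2 ^ Suc j" by (meson less_le_trans)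
      define j where "j = (LEAST j. norm z < 2 ^ Suc j)"
      have j1: "norm z < 2 ^ Suc j" unfolding j_def by (rule LeastI_ex[OF ex])
      have j2: "2 ^ j \<le> norm z"
      proof (cases j)
        case 0
        then show ?thesis using False by simp
      next
        case (Suc i)
        then have "\<not> norm z < 2 ^ Suc i" using not_less_Least[of i "\<lambda>j. norm z < 2 ^ Suc j"]
          by (simp add: j_def)
        then show ?thesis using Suc by simp
      qed
      have "k z \<le> 1 / norm z powr e" unfolding k_def by (intro divide_right_mono) auto
      also have "\<dots> \<le> 1 / (2 ^ j) powr e"
        using j2 nz e0 by (intro divide_left_mono powr_mono2) auto
      finally have "ennreal (k z) \<le> ennreal (c j) * indicator (ball 0 (2 ^ Suc j)) z"
        using j1 by (simp add: c_def ennreal_leI)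
      also have "\<dots> \<le> (\<Sum>j. ennreal (c j) * indicator (ball 0 (2 ^ Suc j)) z)"
        by (rule ennreal_term_le_suminf)
      finally show ?thesis by (simp add: add_increasing)
    qed
  qed
  have vol: "emeasure lborel (ball (0::'a) r) = ennreal (b * r ^ N)" if "r \<ge> 0" for r
    using emeasure_ball[of r "0::'a"] that by (simp add: b_def N_def)
  have a_eq: "a j * (b * ((1 / 2) ^ j) ^ N) = (b * 2 powr e) * (2 powr (2 * s - 2)) ^ j" for j
  proof -
    have "a j * ((1 / 2) ^ j) ^ N = 2 powr (- 2 * real j) / 2 powr (- real (Suc j) * e) * 2 powr (- real j * real N)"
      unfolding a_def half_power_powr by (simp add: powr_power powr_powr mult.commute)
    also have "\<dots> = 2 powr (- 2 * real j + real (Suc j) * e - real j * real N)"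
      by (simp add: powr_diff powr_add powr_minus field_simps)
    also have "- 2 * real j + real (Suc j) * e - real j * real N = e + (2 * s - 2) * real j"
      by (simp add: e_def algebra_simps)
    also have "2 powr (e + (2 * s - 2) * real j) = 2 powr e * (2 powr (2 * s - 2)) ^ j"
      by (simp add: powr_add powr_power mult.commute[of "real j"])
    finally show ?thesis by (simp add: mult_ac)
  qed
  have c_eq: "c j * (b * (2 ^ Suc j) ^ N) = (b * 2 powr real N) * (2 powr (- 2 * s)) ^ j" for j
  proof -
    have "(2::real) ^ i = 2 powr real i" for i by (simp add: powr_realpow)
    then have "c j * (2 ^ Suc j) ^ N = 1 / 2 powr (real j * e) * 2 powr (real (Suc j) * real N)"
      unfolding c_def by (simp add: powr_power powr_powr mult.commute del: power_Suc)
    also have "\<dots> = 2 powr (real (Suc j) * real N - real j * e)"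
      by (simp add: powr_diff)
    also have "real (Suc j) * real N - real j * e = real N + (- 2 * s) * real j"
      by (simp add: e_def algebra_simps)
    also have "2 powr (real N + (- 2 * s) * real j) = 2 powr real N * (2 powr (- 2 * s)) ^ j"
      by (simp only: powr_add powr_power) (simp add: mult.commute)
    finally show ?thesis by (simp add: mult_ac)
  qed
  have geo: "(\<Sum>j. ennreal (C * q ^ j)) < \<infinity>" if "0 \<le> C" "0 \<le> q" "q < 1" for C q :: real
  proof -
    have "summable (\<lambda>j. C * q ^ j)" using that by (intro summable_mult summable_geometric) auto
    then have "(\<Sum>j. ennreal (C * q ^ j)) = ennreal (\<Sum>j. C * q ^ j)"
      using that by (intro suminf_ennreal2) auto
    then show ?thesis by simp
  qed
  have "(\<integral>\<^sup>+z. ennreal (k z) \<partial>lborel) \<le>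
      (\<integral>\<^sup>+z. (\<Sum>j. ennreal (a j) * indicator (ball 0 ((1 / 2) ^ j)) z) +
      (\<Sum>j. ennreal (c j) * indicator (ball 0 (2 ^ Suc j)) z) \<partial>(lborel :: 'a measure))"
    by (intro nn_integral_mono pw)
  also have "\<dots> = (\<Sum>j. \<integral>\<^sup>+z. ennreal (a j) * indicator (ball 0 ((1 / 2) ^ j)) z \<partial>(lborel :: 'a measure)) +
      (\<Sum>j. \<integral>\<^sup>+z. ennreal (c j) * indicator (ball 0 (2 ^ Suc j)) z \<partial>(lborel :: 'a measure))"
  proof -
    have m: "(\<lambda>z :: 'a. ennreal C * indicator (ball 0 r) z) \<in> borel_measurable lborel" for C r
      by (intro borel_measurable_times_ennreal borel_measurable_const borel_measurable_indicator) simp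
    have sm: "(\<lambda>z :: 'a. \<Sum>j. ennreal (C j) * indicator (ball 0 (r j)) z) \<in> borel_measurable lborel"
      for C r :: "nat \<Rightarrow> real" by (intro borel_measurable_suminf_order m)
    show ?thesis
      unfolding nn_integral_add[OF sm sm]
      by (intro arg_cong2[where f = "(+)"] nn_integral_suminf m)
  qed
  also have "\<dots> = (\<Sum>j. ennreal ((b * 2 powr e) * (2 powr (2 * s - 2)) ^ j)) +
      (\<Sum>j. ennreal ((b * 2 powr real N) * (2 powr (- 2 * s)) ^ j))"
  proof -
    have "(\<integral>\<^sup>+z. ennreal (a j) * indicator (ball 0 ((1 / 2) ^ j)) z \<partial>(lborel :: 'a measure)) =
        ennreal ((b * 2 powr e) * (2 powr (2 * s - 2)) ^ j)" for j
      unfolding a_eq[symmetric] using a0 b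
      by (subst nn_integral_cmult_indicator) (simp_all add: vol ennreal_mult)
    moreover have "(\<integral>\<^sup>+z. ennreal (c j) * indicator (ball 0 (2 ^ Suc j)) z \<partial>(lborel :: 'a measure)) =
        ennreal ((b * 2 powr real N) * (2 powr (- 2 * s)) ^ j)" for j
      unfolding c_eq[symmetric] using c0 b
      by (subst nn_integral_cmult_indicator) (simp_all add: vol ennreal_mult del: power_Suc)
    ultimately show ?thesis by simp
  qed
  also have "\<dots> < \<infinity>"
  proof -
    have "2 powr (2 * s - 2) < (2::real) powr 0" "2 powr (- 2 * s) < (2::real) powr 0"
      using s by (intro powr_less_mono; simp)+
    then have "(\<Sum>j. ennreal ((b * 2 powr e) * (2 powr (2 * s - 2)) ^ j)) < \<infinity>"
      "(\<Sum>j. ennreal ((b * 2 powr real N) * (2 powr (- 2 * s)) ^ j)) < \<infinity>"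
      using b by (intro geo; simp)+
    then show ?thesis by simp
  qed
  finally show ?thesis by (simp add: k_def e_def N_def)
qed

context fractional_setting
begin

lemma integrable_square_bounded_support:
  fixes f :: "'a \<Rightarrow> real"
  assumes f: "f \<in> borel_measurable lebesgue" and bd: "\<And>x. \<bar>f x\<bar> \<le> M" and out: "\<And>x. x \<notin> \<Omega> \<Longrightarrow> f x = 0"
  shows "integrable lebesgue (\<lambda>x. (f x)\<^sup>2)"
proof (rule Bochner_Integration.integrable_bound)
  show "integrable lebesgue (\<lambda>x. M\<^sup>2 * indicator \<Omega> x)"
    using emeasure_\<Omega>_finite by (intro integrable_mult_right integrable_real_indicator) auto
  have "(f x)\<^sup>2 \<le> M\<^sup>2 * indicator \<Omega> x" for x
    using power_mono[OF bd[of x], of 2] out[of x] by (cases "x \<in> \<Omega>") auto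
  then show "AE x in lebesgue. norm ((f x)\<^sup>2) \<le> norm (M\<^sup>2 * indicator \<Omega> x)" by simp
qed (use f in simp)

text \<open>Squared increments are at most a constant times \<open>min 1 ((norm (x - y))\<^sup>2)\<close> and vanish unless \<open>x\<close> or
\<open>y\<close> is in \<open>\<Omega>\<close>, so the energy is at most twice the measure of \<open>\<Omega>\<close> times the integral of the kernel, up
to a constant.\<close>

lemma Lipschitz_in_H0s:
  fixes f :: "'a \<Rightarrow> real"
  assumes lip: "\<And>x y. \<bar>f x - f y\<bar> \<le> L * norm (x - y)" and bd: "\<And>x. \<bar>f x\<bar> \<le> M"
    and out: "\<And>x. x \<notin> \<Omega> \<Longrightarrow> f x = 0"
  shows "f \<in> V"
proof -
  have "continuous_on UNIV f"
  proof (rule continuous_onI)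
    fix x and e :: real assume e: "e > 0"
    have "dist (f y) (f x) < e" if "dist y x < e / (\<bar>L\<bar> + 1)" for y
    proof -
      have "\<bar>f y - f x\<bar> \<le> (\<bar>L\<bar> + 1) * norm (y - x)"
        by (rule order.trans[OF lip[of y x]]) (rule mult_right_mono, auto)
      also have "\<dots> < e" using that by (simp add: dist_norm pos_less_divide_eq mult.commute)
      finally show ?thesis by (simp add: dist_real_def)
    qed
    moreover have "e / (\<bar>L\<bar> + 1) > 0" using e by simp
    ultimately show "\<exists>d>0. \<forall>y\<in>UNIV. dist y x < d \<longrightarrow> dist (f y) (f x) \<le> e" by (meson less_imp_le)
  qed
  then have fb[measurable]: "f \<in> borel_measurable borel" by (rule borel_measurable_continuous_onI)
  have fl: "f \<in> borel_measurable lebesgue" by (rule borel_imp_lebesgue[OF fb])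
  define k where "k z = min 1 ((norm z)\<^sup>2) / norm z powr (real DIM('a) + 2 * s)" for z :: 'a
  have k0: "k z \<ge> 0" and k_sym: "k (- z) = k z" for z by (simp_all add: k_def)
  have [measurable]: "k \<in> borel_measurable borel" unfolding k_def[abs_def] by measurable
  define A where "A = max (L\<^sup>2) (4 * M\<^sup>2)"
  have A0: "A \<ge> 0" by (simp add: A_def le_max_iff_disj)
  have num: "(f x - f y)\<^sup>2 \<le> A * min 1 ((norm (x - y))\<^sup>2)" for x y
  proof -
    have "(f x - f y)\<^sup>2 \<le> (L * norm (x - y))\<^sup>2"
      using power_mono[OF lip[of x y], of 2] by simp
    also have "\<dots> \<le> A * (norm (x - y))\<^sup>2" unfolding power_mult_distrib A_def by (intro mult_right_mono) auto
    finally have 1: "(f x - f y)\<^sup>2 \<le> A * (norm (x - y))\<^sup>2" .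
    have "\<bar>f x - f y\<bar> \<le> 2 * M" using bd[of x] bd[of y] by linarith
    then have "(f x - f y)\<^sup>2 \<le> (2 * M)\<^sup>2" using power_mono[of "\<bar>f x - f y\<bar>" "2 * M" 2] by simp
    also have "\<dots> \<le> A" by (simp add: A_def power_mult_distrib)
    finally show ?thesis using 1 by (auto simp: min_def)
  qed
  have pw: "(fgrad s f (x, y))\<^sup>2 \<le> A * (indicator \<Omega> x * k (x - y) + indicator \<Omega> y * k (x - y))" for x y
  proof (cases "x \<in> \<Omega> \<or> y \<in> \<Omega>")
    case True
    have "(fgrad s f (x, y))\<^sup>2 \<le> A * k (x - y)"
      using divide_right_mono[OF num[of x y], of "norm (x - y) powr (real DIM('a) + 2 * s)"]
      by (simp add: fgrad_square k_def)
    also have "\<dots> \<le> A * (indicator \<Omega> x * k (x - y) + indicator \<Omega> y * k (x - y))"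
      using True k0[of "x - y"] A0 by (intro mult_left_mono) (auto simp: indicator_def)
    finally show ?thesis .
  next
    case False
    then show ?thesis by (simp add: fgrad_square out)
  qed
  define \<kappa> where "\<kappa> = (\<integral>\<^sup>+z. ennreal (k z) \<partial>lborel)"
  have \<kappa>: "\<kappa> < \<infinity>" unfolding \<kappa>_def k_def by (rule kernel_finite[OF s])
  have t1: "(\<integral>\<^sup>+y. ennreal (k (x - y)) \<partial>lborel) = \<kappa>" for x
    unfolding \<kappa>_def by (rule nn_integral_lborel_reflect) measurable
  have t2: "(\<integral>\<^sup>+x. ennreal (k (x - y)) \<partial>lborel) = \<kappa>" for y
    using t1[of y] k_sym by (metis (no_types, lifting) minus_diff_eq nn_integral_cong)
  have "(\<integral>\<^sup>+z. ennreal ((fgrad s f z)\<^sup>2) \<partial>lebesgue) =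
      (\<integral>\<^sup>+x. \<integral>\<^sup>+y. ennreal ((fgrad s f (x, y))\<^sup>2) \<partial>lborel \<partial>lborel)"
    by (rule nn_integral_lebesgue_prod) (use borel_measurable_fgrad_borel[OF fb] in simp)
  also have "\<dots> \<le> (\<integral>\<^sup>+x. \<integral>\<^sup>+y. ennreal A * (indicator \<Omega> x * ennreal (k (x - y)) + indicator \<Omega> y * ennreal (k (x - y)))
      \<partial>lborel \<partial>lborel)"
  proof (intro nn_integral_mono)
    fix x y
    have "ennreal ((fgrad s f (x, y))\<^sup>2) \<le> ennreal (A * (indicator \<Omega> x * k (x - y) + indicator \<Omega> y * k (x - y)))"
      by (rule ennreal_leI[OF pw])
    also have "\<dots> = ennreal A * (indicator \<Omega> x * ennreal (k (x - y)) + indicator \<Omega> y * ennreal (k (x - y)))"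
      using A0 k0 by (simp add: ennreal_mult indicator_def)
    finally show "ennreal ((fgrad s f (x, y))\<^sup>2) \<le>
        ennreal A * (indicator \<Omega> x * ennreal (k (x - y)) + indicator \<Omega> y * ennreal (k (x - y)))" .
  qed
  also have "\<dots> = ennreal A * ((\<integral>\<^sup>+x. \<integral>\<^sup>+y. indicator \<Omega> x * ennreal (k (x - y)) \<partial>lborel \<partial>lborel) +
      (\<integral>\<^sup>+x. \<integral>\<^sup>+y. indicator \<Omega> y * ennreal (k (x - y)) \<partial>lborel \<partial>lborel))"
    by (simp add: nn_integral_cmult nn_integral_add)
  also have "(\<integral>\<^sup>+x. \<integral>\<^sup>+y. indicator \<Omega> y * ennreal (k (x - y)) \<partial>lborel \<partial>lborel) =
      (\<integral>\<^sup>+y. \<integral>\<^sup>+x. indicator \<Omega> y * ennreal (k (x - y)) \<partial>lborel \<partial>lborel)"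
    by (rule pair_sigma_finite.Fubini'[OF pair_sigma_finite_lborel, symmetric]) measurable
  also have "(\<integral>\<^sup>+x. \<integral>\<^sup>+y. indicator \<Omega> x * ennreal (k (x - y)) \<partial>lborel \<partial>lborel) = \<kappa> * emeasure lborel \<Omega>"
    by (simp add: nn_integral_cmult t1 nn_integral_multc mult.commute)
  also have "(\<integral>\<^sup>+y. \<integral>\<^sup>+x. indicator \<Omega> y * ennreal (k (x - y)) \<partial>lborel \<partial>lborel) = \<kappa> * emeasure lborel \<Omega>"
    by (simp add: nn_integral_cmult t2 nn_integral_multc mult.commute)
  also have "ennreal A * (\<kappa> * emeasure lborel \<Omega> + \<kappa> * emeasure lborel \<Omega>) < \<infinity>"
    using \<kappa> emeasure_\<Omega>_finite by (simp add: ennreal_mult_less_top)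
  finally have "integrable lebesgue (\<lambda>z. (fgrad s f z)\<^sup>2)"
    using integrable_square_iff_nn_integral[OF borel_measurable_fgrad[OF fl]] by blast
  moreover have "integrable lebesgue (\<lambda>x. (f x)\<^sup>2)"
    by (rule integrable_square_bounded_support[OF fl bd out])
  ultimately show ?thesis using fl out by (simp add: H0s_def Hs_iff)
qed

text \<open>Covers the truncations, absolute values and products with bounded functions that are used below.\<close>

lemma H0s_of_increment_bound:
  assumes u: "u \<in> V" and w: "w \<in> V" and v: "v \<in> borel_measurable lebesgue"
    and le: "\<And>x. \<bar>v x\<bar> \<le> c * (\<bar>u x\<bar> + \<bar>w x\<bar>)"
    and inc: "\<And>x y. \<bar>v x - v y\<bar> \<le> c * (\<bar>u x - u y\<bar> + \<bar>w x - w y\<bar>)"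
  shows "v \<in> V"
proof -
  have sq: "p\<^sup>2 \<le> 2 * c\<^sup>2 * (a\<^sup>2 + b\<^sup>2)" if "\<bar>p\<bar> \<le> c * (\<bar>a\<bar> + \<bar>b\<bar>)" for p a b :: real
  proof -
    have "p\<^sup>2 \<le> (c * (\<bar>a\<bar> + \<bar>b\<bar>))\<^sup>2" using power_mono[OF that, of 2] by simp
    also have "\<dots> \<le> c\<^sup>2 * (2 * (a\<^sup>2 + b\<^sup>2))"
      unfolding power_mult_distrib
      by (rule mult_left_mono) (use zero_le_power2[of "\<bar>a\<bar> - \<bar>b\<bar>"] in \<open>simp_all add: power2_sum power2_diff\<close>)
    finally show ?thesis by (simp only: mult.assoc mult.left_commute[of _ 2])
  qed
  have "integrable lebesgue (\<lambda>x. (v x)\<^sup>2)"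
  proof (rule Bochner_Integration.integrable_bound[where f = "\<lambda>x. 2 * c\<^sup>2 * ((u x)\<^sup>2 + (w x)\<^sup>2)"])
    show "AE x in lebesgue. norm ((v x)\<^sup>2) \<le> norm (2 * c\<^sup>2 * ((u x)\<^sup>2 + (w x)\<^sup>2))"
      using sq[OF le] by (intro AE_I2) simp
  qed (use H0s_D[OF u] H0s_D[OF w] v in auto)
  moreover have "integrable lebesgue (\<lambda>z. (fgrad s v z)\<^sup>2)"
  proof (rule Bochner_Integration.integrable_bound[where f = "\<lambda>z. 2 * c\<^sup>2 * ((fgrad s u z)\<^sup>2 + (fgrad s w z)\<^sup>2)"])
    have "(fgrad s v z)\<^sup>2 \<le> 2 * c\<^sup>2 * ((fgrad s u z)\<^sup>2 + (fgrad s w z)\<^sup>2)" for z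
      using divide_right_mono[OF sq[OF inc[of "fst z" "snd z"]], of "norm (fst z - snd z) powr (real DIM('a) + 2 * s)"]
      by (simp only: fgrad_square add_divide_distrib[symmetric] times_divide_eq_right powr_ge_zero simp_thms)
    then show "AE z in lebesgue. norm ((fgrad s v z)\<^sup>2) \<le> norm (2 * c\<^sup>2 * ((fgrad s u z)\<^sup>2 + (fgrad s w z)\<^sup>2))"
      by (intro AE_I2) simp
  qed (use H0s_D[OF u] H0s_D[OF w] borel_measurable_fgrad[OF v] in auto)
  moreover have "AE x in lebesgue. x \<notin> \<Omega> \<longrightarrow> v x = 0"
    using H0s_D(5)[OF u] H0s_D(5)[OF w]
  proof eventually_elim
    case (elim x)
    then show ?case using le[of x] by auto
  qed
  ultimately show ?thesis using v by (simp add: H0s_def Hs_iff)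
qed

end

section \<open>Directions in which a weighted form is positive\<close>

text \<open>Lebesgue measure has no atoms on a coordinate axis: at the supremum of the levels below which \<open>A\<close> is
negligible, a failure of the claim would confine \<open>A\<close> to a hyperplane, up to a negligible set.\<close>

lemma split_by_hyperplane:
  fixes A :: "'a::euclidean_space set"
  assumes A: "bounded A" "\<not> negligible A" and b: "b \<in> Basis"
  shows "\<exists>t. \<not> negligible (A \<inter> {x. x \<bullet> b < t}) \<and> \<not> negligible (A \<inter> {x. t < x \<bullet> b})"
proof (rule ccontr)
  assume contr: "\<nexists>t. \<not> negligible (A \<inter> {x. x \<bullet> b < t}) \<and> \<not> negligible (A \<inter> {x. t < x \<bullet> b})"
  obtain R where R: "\<And>x. x \<in> A \<Longrightarrow> norm x < R" using A(1) by (auto simp: bounded_pos_less)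
  have xb: "- R < x \<bullet> b" "x \<bullet> b < R" if "x \<in> A" for x
    using Basis_le_norm[OF b, of x] R[OF that] by auto
  define T where "T = {t. negligible (A \<inter> {x. x \<bullet> b < t})}"
  have "A \<inter> {x. x \<bullet> b < - R} = {}" using xb by fastforce
  then have T1: "- R \<in> T" by (simp add: T_def)
  have T2: "t \<le> R" if "t \<in> T" for t
  proof (rule ccontr)
    assume "\<not> t \<le> R"
    then have "A \<inter> {x. x \<bullet> b < t} = A" using xb by fastforce
    then show False using that A(2) by (simp add: T_def)
  qed
  then have bdd: "bdd_above T" by (auto simp: bdd_above_def)
  define t where "t = Sup T"
  have left: "negligible (A \<inter> {x. x \<bullet> b < t})"
  proof -
    have "negligible (A \<inter> {x. x \<bullet> b < t - 1 / real (Suc n)})" for n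
    proof -
      have "\<exists>u\<in>T. t - 1 / real (Suc n) < u" unfolding t_def by (rule less_cSupD) (use T1 in auto)
      then obtain u where u: "negligible (A \<inter> {x. x \<bullet> b < u})" "t - 1 / real (Suc n) < u" by (auto simp: T_def)
      show ?thesis by (rule negligible_subset[OF u(1)]) (use u(2) in auto)
    qed
    then have "negligible (\<Union>n. A \<inter> {x. x \<bullet> b < t - 1 / real (Suc n)})" by (intro negligible_countable_Union) auto
    moreover have "A \<inter> {x. x \<bullet> b < t} \<subseteq> (\<Union>n. A \<inter> {x. x \<bullet> b < t - 1 / real (Suc n)})"
    proof
      fix x assume x: "x \<in> A \<inter> {x. x \<bullet> b < t}"
      then obtain n where "1 / real (Suc n) < t - x \<bullet> b" using nat_approx_posE[of "t - x \<bullet> b"] by auto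
      then show "x \<in> (\<Union>n. A \<inter> {x. x \<bullet> b < t - 1 / real (Suc n)})" using x by (auto intro!: exI[of _ n])
    qed
    ultimately show ?thesis by (rule negligible_subset)
  qed
  have right: "negligible (A \<inter> {x. t < x \<bullet> b})"
  proof -
    have "negligible (A \<inter> {x. t + 1 / real (Suc n) < x \<bullet> b})" for n
    proof -
      have "t + 1 / real (Suc n) \<notin> T"
        using cSup_upper[OF _ bdd, of "t + 1 / real (Suc n)"] by (auto simp: t_def[symmetric])
      then show ?thesis using contr by (auto simp: T_def)
    qed
    then have "negligible (\<Union>n. A \<inter> {x. t + 1 / real (Suc n) < x \<bullet> b})" by (intro negligible_countable_Union) auto
    moreover have "A \<inter> {x. t < x \<bullet> b} \<subseteq> (\<Union>n. A \<inter> {x. t + 1 / real (Suc n) < x \<bullet> b})"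
    proof
      fix x assume x: "x \<in> A \<inter> {x. t < x \<bullet> b}"
      then obtain n where "1 / real (Suc n) < x \<bullet> b - t" using nat_approx_posE[of "x \<bullet> b - t"] by auto
      then show "x \<in> (\<Union>n. A \<inter> {x. t + 1 / real (Suc n) < x \<bullet> b})" using x by (auto intro!: exI[of _ n])
    qed
    ultimately show ?thesis by (rule negligible_subset)
  qed
  have "b \<noteq> 0" using b by auto
  then have "negligible {x. b \<bullet> x = t}" by (intro negligible_hyperplane) auto
  then have "negligible ((A \<inter> {x. x \<bullet> b < t}) \<union> (A \<inter> {x. t < x \<bullet> b}) \<union> {x. b \<bullet> x = t})"
    using left right by simp
  then have "negligible A" by (rule negligible_subset) (auto simp: inner_commute)
  then show False using A(2) by simp
qed

lemma disjoint_positive_opens: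
  fixes U :: "'a::euclidean_space set" and r :: "'a \<Rightarrow> real"
  assumes "open U" "bounded U" "\<not> negligible {x \<in> U. 0 < r x}"
  shows "\<exists>W :: nat \<Rightarrow> 'a set. (\<forall>i<k. open (W i) \<and> W i \<subseteq> U \<and> \<not> negligible {x \<in> W i. 0 < r x}) \<and>
           (\<forall>i<k. \<forall>j<k. i \<noteq> j \<longrightarrow> W i \<inter> W j = {})"
  using assms
proof (induction k arbitrary: U)
  case 0
  then show ?case by simp
next
  case (Suc k)
  obtain b :: 'a where b: "b \<in> Basis" using nonempty_Basis by blast
  have "bounded {x \<in> U. 0 < r x}" by (rule bounded_subset[OF Suc.prems(2)]) auto
  from split_by_hyperplane[OF this Suc.prems(3) b] obtain t
    where t: "\<not> negligible ({x \<in> U. 0 < r x} \<inter> {x. x \<bullet> b < t})" "\<not> negligible ({x \<in> U. 0 < r x} \<inter> {x. t < x \<bullet> b})"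
    by blast
  define L where "L = U \<inter> {x. x \<bullet> b < t}"
  define R where "R = U \<inter> {x. t < x \<bullet> b}"
  have oL: "open L" and oR: "open R" unfolding L_def R_def
    using Suc.prems(1) by (auto intro!: open_Int open_Collect_less continuous_intros)
  have "{x \<in> U. 0 < r x} \<inter> {x. x \<bullet> b < t} = {x \<in> L. 0 < r x}"
    "{x \<in> U. 0 < r x} \<inter> {x. t < x \<bullet> b} = {x \<in> R. 0 < r x}" by (auto simp: L_def R_def)
  then have nL: "\<not> negligible {x \<in> L. 0 < r x}" and nR: "\<not> negligible {x \<in> R. 0 < r x}" using t by simp_all
  have "bounded L" by (rule bounded_subset[OF Suc.prems(2)]) (auto simp: L_def)
  from Suc.IH[OF oL this nL] obtain W :: "nat \<Rightarrow> 'a set"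
    where *: "\<forall>i<k. open (W i) \<and> W i \<subseteq> L \<and> \<not> negligible {x \<in> W i. 0 < r x}"
      "\<forall>i<k. \<forall>j<k. i \<noteq> j \<longrightarrow> W i \<inter> W j = {}" by (elim exE conjE)
  then have W: "\<And>i. i < k \<Longrightarrow> open (W i)" "\<And>i. i < k \<Longrightarrow> W i \<subseteq> L" "\<And>i. i < k \<Longrightarrow> \<not> negligible {x \<in> W i. 0 < r x}"
      "\<And>i j. \<lbrakk>i < k; j < k; i \<noteq> j\<rbrakk> \<Longrightarrow> W i \<inter> W j = {}"
    by simp_all
  define W' where "W' i = (if i = k then R else W i)" for i
  have LR: "L \<inter> R = {}" "L \<subseteq> U" "R \<subseteq> U" by (auto simp: L_def R_def)
  have "open (W' i) \<and> W' i \<subseteq> U \<and> \<not> negligible {x \<in> W' i. 0 < r x}" if "i < Suc k" for i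
  proof (cases "i = k")
    case True
    then show ?thesis using oR nR LR(3) by (simp add: W'_def)
  next
    case False
    then have "i < k" using that by simp
    then show ?thesis using W(1-3)[of i] LR(2) False by (auto simp: W'_def)
  qed
  moreover have "W' i \<inter> W' j = {}" if ij: "i < Suc k" "j < Suc k" "i \<noteq> j" for i j
  proof -
    consider "i = k" "j < k" | "j = k" "i < k" | "i < k" "j < k" using ij by linarith
    then show ?thesis
    proof cases
      case 1 then show ?thesis using W(2)[of j] LR(1) by (auto simp: W'_def)
    next
      case 2 then show ?thesis using W(2)[of i] LR(1) by (auto simp: W'_def)
    next
      case 3 then show ?thesis using W(4)[of i j] ij by (auto simp: W'_def)
    qed
  qed
  ultimately show ?case by blast
qed

context fractional_setting
begin

text \<open>A closed set \<open>K\<close> of positive measure inside \<open>{r > 0}\<close> is the limit of tent functions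
\<open>max 0 (1 - n infdist x K)\<close>, which are Lipschitz and supported in \<open>U\<close> for large \<open>n\<close>. Their forms
tend to \<open>\<integral>\<^sub>K r > 0\<close>.\<close>

lemma positive_bump:
  assumes r: "bounded_weight r C" and U: "open U" "U \<subseteq> \<Omega>" and pos: "\<not> negligible {x \<in> U. 0 < r x}"
  shows "\<exists>f\<in>V. (\<forall>x. x \<notin> U \<longrightarrow> f x = 0) \<and> 0 < form r f f"
proof -
  define A where "A = {x \<in> U. 0 < r x}"
  have rm: "r \<in> borel_measurable lebesgue" using r by (simp add: bounded_weight_def)
  have Ul: "U \<in> sets lebesgue" using U(1) by simp
  have "{x \<in> space lebesgue. 0 < r x} \<in> sets lebesgue" by (rule borel_measurable_less) (use rm in auto)
  then have "U \<inter> {x. 0 < r x} \<in> sets lebesgue" using Ul by (intro sets.Int) simp_all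
  moreover have "A = U \<inter> {x. 0 < r x}" by (auto simp: A_def)
  ultimately have Al: "A \<in> sets lebesgue" by simp
  have A\<Omega>: "A \<subseteq> \<Omega>" using U(2) by (auto simp: A_def)
  have Anull: "A \<notin> null_sets lebesgue" using pos by (simp add: A_def negligible_iff_null_sets)
  have Apos: "emeasure lebesgue A > 0" using Anull Al by (simp add: null_sets_def zero_less_iff_neq_zero del: emeasure_completion)
  have Afin: "emeasure lebesgue A < \<infinity>"
    using emeasure_mono[OF A\<Omega>, of lebesgue] emeasure_\<Omega>_finite by (simp add: le_less_trans del: emeasure_completion)
  define \<epsilon> where "\<epsilon> = measure lebesgue A"
  have \<epsilon>e: "emeasure lebesgue A = ennreal \<epsilon>" unfolding \<epsilon>_def using Afin by (intro emeasure_eq_ennreal_measure) simp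
  then have \<epsilon>: "\<epsilon> > 0" using Apos by (simp add: ennreal_less_zero_iff del: emeasure_completion)
  from sets_lebesgue_inner_closed[OF Al \<epsilon>] obtain K where K: "closed K" "K \<subseteq> A" "A - K \<in> lmeasurable"
    "emeasure lebesgue (A - K) < ennreal \<epsilon>" by blast
  have Kl: "K \<in> sets lebesgue" using K(1) by (simp add: borel_closed)
  have Knull: "K \<notin> null_sets lebesgue"
  proof
    assume "K \<in> null_sets lebesgue"
    then have "emeasure lebesgue (A - K) = emeasure lebesgue A" by (rule emeasure_Diff_null_set) (rule Al)
    then show False using K(4) \<epsilon>e by simp
  qed
  have Kne: "K \<noteq> {}" using Knull by auto
  have K\<Omega>: "K \<subseteq> \<Omega>" "K \<subseteq> U" using K(2) A\<Omega> by (auto simp: A_def)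
  have Kc: "compact K" using K(1) bounded_subset[OF bounded_\<Omega> K\<Omega>(1)] by (simp add: compact_eq_bounded_closed)
  obtain \<delta> where \<delta>: "\<delta> > 0" "\<And>x. infdist x K < \<delta> \<Longrightarrow> x \<in> U"
  proof -
    from compact_subset_open_imp_ball_epsilon_subset[OF Kc U(1) K\<Omega>(2)] obtain \<delta>
      where d: "\<delta> > 0" "(\<Union>x\<in>K. ball x \<delta>) \<subseteq> U" by blast
    have "x \<in> U" if "infdist x K < \<delta>" for x
    proof -
      obtain y where "y \<in> K" "infdist x K = dist x y" using infdist_attains_inf[OF K(1) Kne] by blast
      then have "x \<in> ball y \<delta>" using that by (simp add: dist_commute)
      then show ?thesis using d(2) \<open>y \<in> K\<close> by blast
    qed
    then show ?thesis using d(1) that by blast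
  qed
  define f where "f n x = max 0 (1 - real n * infdist x K)" for n :: nat and x :: 'a
  obtain n0 :: nat where n0: "1 / \<delta> < real n0" using reals_Archimedean2 by blast
  have f_out: "f n x = 0" if "n \<ge> n0" "x \<notin> U" for n x
  proof -
    have "\<delta> \<le> infdist x K" using \<delta>(2)[of x] that by force
    moreover have "1 < real n * \<delta>" using n0 that(1) \<delta>(1) by (simp add: field_simps) (smt (verit) mult_left_mono of_nat_mono)
    ultimately have "1 \<le> real n * infdist x K"
      using mult_left_mono[of \<delta> "infdist x K" "real n"] by simp
    then show ?thesis by (simp add: f_def)
  qed
  have f01: "0 \<le> f n x" "f n x \<le> 1" for n x using infdist_nonneg[of x K] by (auto simp: f_def)
  have fV: "f n \<in> V" if n: "n \<ge> n0" for n
  proof (rule Lipschitz_in_H0s[of _ "real n" 1])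
    fix x y
    have "\<bar>infdist x K - infdist y K\<bar> \<le> norm (x - y)"
      using infdist_triangle_abs[of x K y] by (simp add: dist_norm)
    then have "real n * \<bar>infdist x K - infdist y K\<bar> \<le> real n * norm (x - y)" by (rule mult_left_mono) simp
    moreover have "real n * \<bar>infdist x K - infdist y K\<bar> = \<bar>real n * infdist x K - real n * infdist y K\<bar>"
      by (simp flip: right_diff_distrib add: abs_mult)
    ultimately show "\<bar>f n x - f n y\<bar> \<le> real n * norm (x - y)" unfolding f_def by linarith
  next
    show "\<bar>f n x\<bar> \<le> 1" for x using f01[of n x] by simp
    show "f n x = 0" if "x \<notin> \<Omega>" for x using f_out[OF n] U(2) that by blast
  qed
  have f_lim: "(\<lambda>n. f n x) \<longlonglongrightarrow> indicator K x" for x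
  proof (cases "x \<in> K")
    case True
    then have "f n x = 1" for n by (simp add: f_def infdist_zero)
    then show ?thesis using True by simp
  next
    case False
    then have "infdist x K > 0"
      using in_closed_iff_infdist_zero[OF K(1) Kne, of x] infdist_nonneg[of x K] by linarith
    then obtain n1 :: nat where n1: "1 / infdist x K < real n1" using reals_Archimedean2 by blast
    have "f n x = 0" if "n \<ge> n1" for n
    proof -
      have "1 / infdist x K \<le> real n" using n1 that by linarith
      then have "1 \<le> real n * infdist x K" using \<open>infdist x K > 0\<close> by (simp add: pos_divide_le_eq)
      then show ?thesis by (simp add: f_def)
    qed
    then have "(\<lambda>n. f n x) \<longlonglongrightarrow> 0" by (intro tendsto_eventually) (auto simp: eventually_sequentially)
    then show ?thesis using False by simp
  qed
  define F where "F n x = r x * (f (n + n0) x * f (n + n0) x)" for n x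
  have "(\<lambda>n. \<integral>x. F n x \<partial>lebesgue) \<longlonglongrightarrow> (\<integral>x. r x * indicator K x \<partial>lebesgue)"
  proof (rule integral_dominated_convergence[where w = "\<lambda>x. C * indicator \<Omega> x"])
    show "(\<lambda>x. r x * indicator K x) \<in> borel_measurable lebesgue"
      using rm Kl by (intro borel_measurable_times borel_measurable_indicator)
    show "F n \<in> borel_measurable lebesgue" for n unfolding F_def[abs_def]
      using rm H0s_D(1)[OF fV[of "n + n0"]] by (intro borel_measurable_times) auto
    show "integrable lebesgue (\<lambda>x. C * indicator \<Omega> x)"
      using emeasure_\<Omega>_finite by (intro integrable_mult_right integrable_real_indicator) auto
    have "(\<lambda>n. F n x) \<longlonglongrightarrow> r x * (indicator K x * indicator K x)" for x
      unfolding F_def by (intro tendsto_intros LIMSEQ_ignore_initial_segment f_lim)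
    moreover have "indicator K x * indicator K x = (indicator K x :: real)" for x by (simp add: indicator_def)
    ultimately show "AE x in lebesgue. (\<lambda>n. F n x) \<longlonglongrightarrow> r x * indicator K x" by simp
    have "AE x in lebesgue. \<bar>r x\<bar> \<le> C" using r by (simp add: bounded_weight_def)
    then show "AE x in lebesgue. norm (F n x) \<le> C * indicator \<Omega> x" for n
    proof eventually_elim
      case (elim x)
      show ?case
      proof (cases "x \<in> \<Omega>")
        case True
        have "\<bar>f (n + n0) x * f (n + n0) x\<bar> \<le> 1"
          using f01[of "n + n0" x] mult_mono[of "f (n + n0) x" 1 "f (n + n0) x" 1] by (simp add: abs_mult)
        then have "\<bar>r x\<bar> * \<bar>f (n + n0) x * f (n + n0) x\<bar> \<le> C * 1" using elim by (intro mult_mono) auto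
        then show ?thesis using True by (simp add: F_def abs_mult)
      next
        case False
        then have "f (n + n0) x = 0" using f_out[of "n + n0" x] U(2) by auto
        then show ?thesis using False by (simp add: F_def)
      qed
    qed
  qed
  moreover have "(\<integral>x. r x * indicator K x \<partial>lebesgue) > 0"
  proof -
    have rK: "r x > 0" if "x \<in> K" for x using K(2) that by (auto simp: A_def)
    have int: "integrable lebesgue (\<lambda>x. r x * indicator K x)"
    proof (rule Bochner_Integration.integrable_bound[where f = "\<lambda>x. C * indicator \<Omega> x"])
      show "integrable lebesgue (\<lambda>x. C * indicator \<Omega> x)"
        using emeasure_\<Omega>_finite by (intro integrable_mult_right integrable_real_indicator) auto
      have "AE x in lebesgue. \<bar>r x\<bar> \<le> C" using r by (simp add: bounded_weight_def)
      then show "AE x in lebesgue. norm (r x * indicator K x) \<le> norm (C * indicator \<Omega> x)"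
        by eventually_elim (use K\<Omega> in \<open>auto simp: indicator_def\<close>)
    qed (use rm Kl in \<open>intro borel_measurable_times borel_measurable_indicator\<close>)
    have nn: "AE x in lebesgue. 0 \<le> r x * indicator K x" using rK by (intro AE_I2) (auto simp: indicator_def less_imp_le)
    have "(\<integral>x. r x * indicator K x \<partial>lebesgue) \<noteq> 0"
    proof
      assume "(\<integral>x. r x * indicator K x \<partial>lebesgue) = 0"
      then have "AE x in lebesgue. r x * indicator K x = 0"
        using integral_nonneg_eq_0_iff_AE[OF int nn] by blast
      then have "AE x in lebesgue. x \<notin> K"
        by eventually_elim (use rK in \<open>force simp: indicator_def\<close>)
      then have "K \<in> null_sets lebesgue" using AE_iff_null_sets[OF Kl] by blast
      then show False using Knull by blast
    qed
    moreover have "0 \<le> (\<integral>x. r x * indicator K x \<partial>lebesgue)" by (rule integral_nonneg_AE[OF nn])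
    ultimately show ?thesis by linarith
  qed
  ultimately have "eventually (\<lambda>n. (\<integral>x. F n x \<partial>lebesgue) > 0) sequentially"
    by (rule order_tendstoD(1))
  then obtain n where "(\<integral>x. F n x \<partial>lebesgue) > 0" by (auto simp: eventually_sequentially)
  then have "form r (f (n + n0)) (f (n + n0)) > 0" by (simp add: form_def F_def)
  then show ?thesis using fV[of "n + n0"] f_out[of "n + n0"] by (intro bexI[of _ "f (n + n0)"]) auto
qed

text \<open>The form is diagonal with positive entries on the span of \<open>k + 1\<close> bumps with disjoint supports, and
\<open>k\<close> orthogonality conditions leave a nonzero combination.\<close>

lemma positive_directions:
  fixes e :: "nat \<Rightarrow> 'a \<Rightarrow> real"
  assumes r: "bounded_weight r C" and pos: "\<not> negligible {x \<in> \<Omega>. 0 < r x}"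
    and e: "\<And>i. i < k \<Longrightarrow> e i \<in> V"
  shows "\<exists>f\<in>V. (\<forall>i<k. B f (e i) = 0) \<and> 0 < form r f f"
proof -
  interpret Q: sym_form V "form r" by (rule sym_form_form[OF r])
  from disjoint_positive_opens[OF open_\<Omega> bounded_\<Omega> pos, of "Suc k"] obtain W :: "nat \<Rightarrow> 'a set"
    where *: "\<forall>i<Suc k. open (W i) \<and> W i \<subseteq> \<Omega> \<and> \<not> negligible {x \<in> W i. 0 < r x}"
      "\<forall>i<Suc k. \<forall>j<Suc k. i \<noteq> j \<longrightarrow> W i \<inter> W j = {}" by (elim exE conjE)
  then have W: "\<And>i. i < Suc k \<Longrightarrow> open (W i)" "\<And>i. i < Suc k \<Longrightarrow> W i \<subseteq> \<Omega>"
    "\<And>i. i < Suc k \<Longrightarrow> \<not> negligible {x \<in> W i. 0 < r x}"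
    "\<And>i j. \<lbrakk>i < Suc k; j < Suc k; i \<noteq> j\<rbrakk> \<Longrightarrow> W i \<inter> W j = {}"
    by simp_all
  have "\<forall>i. \<exists>f. i < Suc k \<longrightarrow> f \<in> V \<and> (\<forall>x. x \<notin> W i \<longrightarrow> f x = 0) \<and> 0 < form r f f"
    using positive_bump[OF r W(1,2,3)] by blast
  then have "\<exists>f. \<forall>i. i < Suc k \<longrightarrow> f i \<in> V \<and> (\<forall>x. x \<notin> W i \<longrightarrow> f i x = 0) \<and> 0 < form r (f i) (f i)"
    by (rule choice)
  then obtain f where f: "\<And>i. i < Suc k \<Longrightarrow> f i \<in> V" "\<And>i x. i < Suc k \<Longrightarrow> x \<notin> W i \<Longrightarrow> f i x = 0"
    "\<And>i. i < Suc k \<Longrightarrow> 0 < form r (f i) (f i)" by blast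
  have off: "form r (f i) (f j) = 0" if "i < Suc k" "j < Suc k" "i \<noteq> j" for i j
  proof -
    have "f i x * f j x = 0" for x using f(2)[of i x] f(2)[of j x] W(4)[OF that] that by auto
    then show ?thesis unfolding form_def by (simp only: mult_zero_right Bochner_Integration.integral_zero)
  qed
  obtain c where c: "\<exists>i<Suc k. c i \<noteq> 0" "\<And>j. j < k \<Longrightarrow> (\<Sum>i<Suc k. c i * B (f i) (e j)) = 0"
    using underdetermined_system[of k "Suc k" "\<lambda>i j. B (f i) (e j)"] by blast
  define g where "g = (\<Sum>i<Suc k. c i *\<^sub>R f i)"
  have gV: "g \<in> V" unfolding g_def using f(1) by (intro mem) auto
  have orth: "B g (e j) = 0" if "j < k" for j
  proof -
    have "B g (e j) = (\<Sum>i<Suc k. B (c i *\<^sub>R f i) (e j))"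
      unfolding g_def by (rule sum_left) (use f(1) e[OF that] in \<open>auto intro: mem_scale\<close>)
    also have "\<dots> = (\<Sum>i<Suc k. c i * B (f i) (e j))"
      by (intro sum.cong refl scale_left) (use f(1) e[OF that] in auto)
    finally show ?thesis using c(2)[OF that] by simp
  qed
  have fg: "form r g g = (\<Sum>i<Suc k. (c i)\<^sup>2 * form r (f i) (f i))"
    unfolding g_def by (rule Q.sum_diag) (use f(1) off in auto)
  from c(1) obtain i where i: "i < Suc k" "c i \<noteq> 0" by blast
  then have "(\<Sum>i<Suc k. (c i)\<^sup>2 * form r (f i) (f i)) > 0"
    using f(3) by (intro sum_pos2[of _ i]) (auto intro!: mult_pos_pos mult_nonneg_nonneg less_imp_le[OF f(3)])
  then have "0 < form r g g" by (simp only: fg)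
  then show ?thesis using gV orth by blast
qed

end

section \<open>The strong maximum principle\<close>

text \<open>The pointwise inequality behind the maximum principle, with \<open>a, b\<close> the values of \<open>u\<close> and \<open>p, q\<close> those
of a cutoff \<open>\<eta>\<close> at two points. Write \<open>t = \<epsilon> + (t - \<epsilon>)\<^sup>+ - w t\<close>: the interaction of the part above
\<open>\<epsilon>\<close> with \<open>w \<eta>\<close> is negative, and that of \<open>- w\<close> with \<open>w \<eta>\<close> is negative up to a commutator with
\<open>\<eta>\<close>, the first term on the right.\<close>

lemma truncation_inequality:
  fixes a b p q \<epsilon> \<delta> :: real
  assumes "0 \<le> a" "0 \<le> b" "0 \<le> p" "0 \<le> q" "0 < \<epsilon>" "\<epsilon> \<le> \<delta>"
  defines "w \<equiv> \<lambda>t. max 0 (\<epsilon> - t)"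
  shows "(a - b) * (w a * p - w b * q) \<le>
    \<bar>(w a)\<^sup>2 - (w b)\<^sup>2\<bar> * \<bar>p - q\<bar> / 2 - \<epsilon> * (max 0 (a - \<delta>) * (if b = 0 then 1 else 0) * q)"
proof -
  define A B \<alpha> \<beta> where "A = max 0 (a - \<epsilon>)" and "B = max 0 (b - \<epsilon>)" and "\<alpha> = w a" and "\<beta> = w b"
  have ab: "a = \<epsilon> + A - \<alpha>" "b = \<epsilon> + B - \<beta>" by (auto simp: A_def B_def \<alpha>_def \<beta>_def w_def)
  have A\<alpha>: "A * \<alpha> = 0" and B\<beta>: "B * \<beta> = 0" by (auto simp: A_def B_def \<alpha>_def \<beta>_def w_def max_def)
  have nn: "0 \<le> A" "0 \<le> B" "0 \<le> \<alpha>" "0 \<le> \<beta>" by (auto simp: A_def B_def \<alpha>_def \<beta>_def w_def)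
  have "(a - b) * (\<alpha> * p - \<beta> * q) =
      (A * \<alpha>) * p + (B * \<beta>) * q - A * \<beta> * q - B * \<alpha> * p - (\<alpha> - \<beta>)\<^sup>2 * (p + q) / 2 - (\<alpha>\<^sup>2 - \<beta>\<^sup>2) * (p - q) / 2"
    unfolding ab by (simp add: field_simps power2_eq_square)
  also have "\<dots> = - (A * \<beta> * q) - B * \<alpha> * p - (\<alpha> - \<beta>)\<^sup>2 * (p + q) / 2 - (\<alpha>\<^sup>2 - \<beta>\<^sup>2) * (p - q) / 2"
    by (simp add: A\<alpha> B\<beta>)
  also have "\<dots> \<le> \<bar>\<alpha>\<^sup>2 - \<beta>\<^sup>2\<bar> * \<bar>p - q\<bar> / 2 - A * \<beta> * q"
  proof -
    have "0 \<le> B * \<alpha> * p" "0 \<le> (\<alpha> - \<beta>)\<^sup>2 * (p + q) / 2" using nn assms by auto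
    moreover have "- ((\<alpha>\<^sup>2 - \<beta>\<^sup>2) * (p - q)) \<le> \<bar>\<alpha>\<^sup>2 - \<beta>\<^sup>2\<bar> * \<bar>p - q\<bar>"
      using abs_ge_minus_self[of "(\<alpha>\<^sup>2 - \<beta>\<^sup>2) * (p - q)"] by (simp only: abs_mult)
    ultimately show ?thesis by linarith
  qed
  also have "\<dots> \<le> \<bar>\<alpha>\<^sup>2 - \<beta>\<^sup>2\<bar> * \<bar>p - q\<bar> / 2 - \<epsilon> * (max 0 (a - \<delta>) * (if b = 0 then 1 else 0) * q)"
  proof (cases "b = 0")
    case True
    then have "\<beta> = \<epsilon>" using assms by (simp add: \<beta>_def w_def)
    moreover have "max 0 (a - \<delta>) \<le> A" using assms by (auto simp: A_def)
    then have "max 0 (a - \<delta>) * (\<epsilon> * q) \<le> A * (\<epsilon> * q)" using assms by (intro mult_right_mono) auto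
    ultimately show ?thesis using True by (simp add: mult_ac)
  next
    case False
    then show ?thesis using nn assms by simp
  qed
  finally show ?thesis by (simp add: \<alpha>_def \<beta>_def)
qed

context fractional_setting
begin

text \<open>Any bounded member of the space that is positive in \<open>\<Omega>\<close> would do.\<close>

definition cutoff :: "'a \<Rightarrow> real" where "cutoff x = min 1 (infdist x (- \<Omega>))"

lemma complement_nonempty: "- \<Omega> \<noteq> {}"
  using bounded_\<Omega> not_bounded_UNIV[where 'a = 'a] by (metis Compl_UNIV_eq double_compl)

lemma cutoff_range: "0 \<le> cutoff x" "cutoff x \<le> 1"
  by (auto simp: cutoff_def infdist_nonneg)

lemma cutoff_outside: "x \<notin> \<Omega> \<Longrightarrow> cutoff x = 0"
  by (simp add: cutoff_def infdist_zero)

lemma cutoff_pos: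
  assumes "x \<in> \<Omega>" shows "0 < cutoff x"
proof -
  have "infdist x (- \<Omega>) \<noteq> 0"
    using in_closed_iff_infdist_zero[OF _ complement_nonempty, of x] open_\<Omega> assms by (simp add: closed_def)
  then show ?thesis using infdist_nonneg[of x "- \<Omega>"] by (simp add: cutoff_def)
qed

lemma cutoff_in_H0s: "cutoff \<in> V"
proof (rule Lipschitz_in_H0s[of _ 1 1])
  fix x y
  have "\<bar>infdist x (- \<Omega>) - infdist y (- \<Omega>)\<bar> \<le> norm (x - y)"
    using infdist_triangle_abs[of x "- \<Omega>" y] by (simp add: dist_norm)
  then show "\<bar>cutoff x - cutoff y\<bar> \<le> 1 * norm (x - y)" unfolding cutoff_def by linarith
next
  show "\<bar>cutoff x\<bar> \<le> 1" for x using cutoff_range[of x] by simp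
qed (rule cutoff_outside)

text \<open>Test the equation for \<open>u\<close> with \<open>\<phi> = (\<epsilon> - u)\<^sup>+ \<eta>\<close>, where \<open>\<eta>\<close> is the cutoff. By
\<open>truncation_inequality\<close>, \<open>\<epsilon>\<close> times the interaction \<open>X\<close> between \<open>{u > \<delta>}\<close> and \<open>{u = 0}\<close> is at most
the integral of the commutator \<open>E\<close> minus \<open>B u \<phi> = form r u \<phi> / \<mu>\<close>. The form is \<open>O(\<epsilon>\<^sup>2)\<close>, since
\<open>u (\<epsilon> - u)\<^sup>+ \<le> \<epsilon>\<^sup>2\<close>. And \<open>E / \<epsilon>\<close> tends to \<open>0\<close> pointwise, dominated by the product of the
fractional gradients of \<open>u\<close> and \<open>\<eta>\<close>. So \<open>X\<close> has integral \<open>0\<close>.\<close>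

lemma strong_maximum_principle_aux:
  assumes r: "bounded_weight r C" and \<mu>: "0 < \<mu>"
    and u: "u \<in> V" and eig: "\<And>\<phi>. \<phi> \<in> V \<Longrightarrow> form r u \<phi> = \<mu> * B u \<phi>"
    and ub: "u \<in> borel_measurable borel" and u0: "\<And>x. 0 \<le> u x" and \<delta>: "0 < \<delta>"
  shows "AE z in lebesgue. (max 0 (u (fst z) - \<delta>) * (if u (snd z) = 0 then 1 else 0) * cutoff (snd z)) /
      norm (fst z - snd z) powr (real DIM('a) + 2 * s) = 0"
proof -
  define k where "k z = norm (fst z - snd z) powr (real DIM('a) + 2 * s)" for z :: "'a \<times> 'a"
  have k0: "0 \<le> k z" for z by (simp add: k_def)
  define w where "w \<epsilon> t = max 0 (\<epsilon> - t)" for \<epsilon> t :: real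
  define \<phi> where "\<phi> \<epsilon> x = w \<epsilon> (u x) * cutoff x" for \<epsilon> x
  define X where "X z = (max 0 (u (fst z) - \<delta>) * (if u (snd z) = 0 then 1 else 0) * cutoff (snd z)) / k z" for z
  define E where "E \<epsilon> z = \<bar>(w \<epsilon> (u (fst z)))\<^sup>2 - (w \<epsilon> (u (snd z)))\<^sup>2\<bar> * \<bar>cutoff (fst z) - cutoff (snd z)\<bar> / 2 / k z" for \<epsilon> z
  define D where "D z = \<bar>fgrad s u z\<bar> * \<bar>fgrad s cutoff z\<bar>" for z
  have w_range: "0 \<le> w \<epsilon> t" "w \<epsilon> t \<le> \<epsilon>" if "0 \<le> \<epsilon>" "0 \<le> t" for \<epsilon> t using that by (auto simp: w_def)
  have w_lip: "\<bar>w \<epsilon> t - w \<epsilon> t'\<bar> \<le> \<bar>t - t'\<bar>" for \<epsilon> t t' by (auto simp: w_def)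
  have cm: "cutoff \<in> borel_measurable borel" unfolding cutoff_def[abs_def]
    by (intro borel_measurable_min borel_measurable_const borel_measurable_continuous_onI continuous_on_infdist continuous_on_id)
  have fm: "(\<lambda>z :: 'a \<times> 'a. g (fst z)) \<in> borel_measurable borel"
    and sm: "(\<lambda>z :: 'a \<times> 'a. g (snd z)) \<in> borel_measurable borel" if "g \<in> borel_measurable borel" for g :: "'a \<Rightarrow> real"
    using that by (simp_all add: borel_prod[symmetric])
  have km: "k \<in> borel_measurable borel" unfolding k_def[abs_def] borel_prod[symmetric] by measurable
  note [measurable] = ub cm km fm[OF ub] sm[OF ub] fm[OF cm] sm[OF cm]
  have Xm: "X \<in> borel_measurable lebesgue"
    unfolding X_def[abs_def] by (rule borel_imp_lebesgue) measurable
  have Em: "E \<epsilon> \<in> borel_measurable lebesgue" for \<epsilon>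
    unfolding E_def[abs_def] w_def by (rule borel_imp_lebesgue) measurable
  have iD: "integrable lebesgue D" unfolding D_def[abs_def] abs_mult[symmetric]
    by (intro integrable_abs integrable_fgrad_mult[OF u cutoff_in_H0s])
  have D_eq: "D z = \<bar>u (fst z) - u (snd z)\<bar> * \<bar>cutoff (fst z) - cutoff (snd z)\<bar> / k z" for z
    unfolding D_def abs_mult[symmetric] fgrad_mult k_def by (simp add: abs_mult)
  have E0: "0 \<le> E \<epsilon> z" for \<epsilon> z unfolding E_def using k0 by (intro divide_nonneg_nonneg mult_nonneg_nonneg) auto
  have E_le: "E \<epsilon> z \<le> \<epsilon> * D z" if \<epsilon>: "0 < \<epsilon>" for \<epsilon> z
  proof -
    let ?a = "w \<epsilon> (u (fst z))" and ?b = "w \<epsilon> (u (snd z))"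
    have "\<bar>?a\<^sup>2 - ?b\<^sup>2\<bar> = \<bar>?a + ?b\<bar> * \<bar>?a - ?b\<bar>" by (simp add: power2_eq_square square_diff_square_factored abs_mult)
    also have "\<dots> \<le> (2 * \<epsilon>) * \<bar>u (fst z) - u (snd z)\<bar>"
      using w_range[of \<epsilon> "u (fst z)"] w_range[of \<epsilon> "u (snd z)"] u0 \<epsilon> w_lip by (intro mult_mono) auto
    finally have "\<bar>?a\<^sup>2 - ?b\<^sup>2\<bar> / 2 \<le> \<epsilon> * \<bar>u (fst z) - u (snd z)\<bar>" by simp
    then have "\<bar>?a\<^sup>2 - ?b\<^sup>2\<bar> / 2 * (\<bar>cutoff (fst z) - cutoff (snd z)\<bar> / k z) \<le>
        \<epsilon> * \<bar>u (fst z) - u (snd z)\<bar> * (\<bar>cutoff (fst z) - cutoff (snd z)\<bar> / k z)"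
      using k0 by (intro mult_right_mono) auto
    then show ?thesis by (simp add: E_def D_eq mult_ac)
  qed
  have iE: "integrable lebesgue (E \<epsilon>)" if "0 < \<epsilon>" for \<epsilon>
  proof (rule Bochner_Integration.integrable_bound[where f = "\<lambda>z. \<epsilon> * D z"])
    show "AE z in lebesgue. norm (E \<epsilon> z) \<le> norm (\<epsilon> * D z)"
      using E_le[OF that] E0 by (intro AE_I2) (simp, metis abs_ge_self order.trans)
  qed (use iD Em in auto)
  have \<phi>V: "\<phi> \<epsilon> \<in> V" if \<epsilon>: "0 < \<epsilon>" for \<epsilon>
  proof (rule H0s_of_increment_bound[OF u cutoff_in_H0s, where c = "1 + \<epsilon>"])
    show "\<phi> \<epsilon> \<in> borel_measurable lebesgue"
      unfolding \<phi>_def[abs_def] w_def by (rule borel_imp_lebesgue) measurable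
    fix x y
    have "\<bar>\<phi> \<epsilon> x\<bar> \<le> \<epsilon> * \<bar>cutoff x\<bar>"
      unfolding \<phi>_def abs_mult using w_range[of \<epsilon> "u x"] u0 \<epsilon> by (intro mult_right_mono) auto
    also have "\<dots> \<le> (1 + \<epsilon>) * (\<bar>u x\<bar> + \<bar>cutoff x\<bar>)" using \<epsilon> by (intro mult_mono) auto
    finally show "\<bar>\<phi> \<epsilon> x\<bar> \<le> (1 + \<epsilon>) * (\<bar>u x\<bar> + \<bar>cutoff x\<bar>)" .
    have "\<phi> \<epsilon> x - \<phi> \<epsilon> y = (w \<epsilon> (u x) - w \<epsilon> (u y)) * cutoff x + w \<epsilon> (u y) * (cutoff x - cutoff y)"
      by (simp add: \<phi>_def algebra_simps)
    then have "\<bar>\<phi> \<epsilon> x - \<phi> \<epsilon> y\<bar> \<le> \<bar>w \<epsilon> (u x) - w \<epsilon> (u y)\<bar> * \<bar>cutoff x\<bar> + \<bar>w \<epsilon> (u y)\<bar> * \<bar>cutoff x - cutoff y\<bar>"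
      using abs_triangle_ineq[of "(w \<epsilon> (u x) - w \<epsilon> (u y)) * cutoff x" "w \<epsilon> (u y) * (cutoff x - cutoff y)"]
      by (simp only: abs_mult)
    also have "\<dots> \<le> \<bar>u x - u y\<bar> * 1 + \<epsilon> * \<bar>cutoff x - cutoff y\<bar>"
      using w_lip[of \<epsilon> "u x" "u y"] w_range[of \<epsilon> "u y"] cutoff_range[of x] u0 \<epsilon>
      by (intro add_mono mult_mono) auto
    also have "\<dots> \<le> (1 + \<epsilon>) * \<bar>u x - u y\<bar> + (1 + \<epsilon>) * \<bar>cutoff x - cutoff y\<bar>"
      using \<epsilon> by (intro add_mono) (auto simp: distrib_right)
    finally show "\<bar>\<phi> \<epsilon> x - \<phi> \<epsilon> y\<bar> \<le> (1 + \<epsilon>) * (\<bar>u x - u y\<bar> + \<bar>cutoff x - cutoff y\<bar>)"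
      by (simp only: distrib_left)
  qed
  have pw: "\<epsilon> * X z \<le> E \<epsilon> z - fgrad s u z * fgrad s (\<phi> \<epsilon>) z" if \<epsilon>: "0 < \<epsilon>" "\<epsilon> \<le> \<delta>" for \<epsilon> z
  proof -
    have "(u (fst z) - u (snd z)) * (\<phi> \<epsilon> (fst z) - \<phi> \<epsilon> (snd z)) \<le>
        \<bar>(w \<epsilon> (u (fst z)))\<^sup>2 - (w \<epsilon> (u (snd z)))\<^sup>2\<bar> * \<bar>cutoff (fst z) - cutoff (snd z)\<bar> / 2 -
        \<epsilon> * (max 0 (u (fst z) - \<delta>) * (if u (snd z) = 0 then 1 else 0) * cutoff (snd z))"
      unfolding \<phi>_def w_def by (rule truncation_inequality) (use u0 cutoff_range \<epsilon> in auto)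
    from divide_right_mono[OF this k0[of z]]
    have "fgrad s u z * fgrad s (\<phi> \<epsilon>) z \<le> E \<epsilon> z - \<epsilon> * X z"
      by (simp only: fgrad_mult k_def[symmetric] E_def X_def diff_divide_distrib times_divide_eq_right)
    then show ?thesis by simp
  qed
  have X0: "0 \<le> X z" for z unfolding X_def using k0 cutoff_range by (intro divide_nonneg_nonneg mult_nonneg_nonneg) auto
  have iX: "integrable lebesgue X"
  proof -
    have "integrable lebesgue (\<lambda>z. \<delta> * X z)"
    proof (rule Bochner_Integration.integrable_bound[where f = "\<lambda>z. E \<delta> z - fgrad s u z * fgrad s (\<phi> \<delta>) z"])
      show "integrable lebesgue (\<lambda>z. E \<delta> z - fgrad s u z * fgrad s (\<phi> \<delta>) z)"
        using iE[OF \<delta>] integrable_fgrad_mult[OF u \<phi>V[OF \<delta>]] by simp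
      have "norm (\<delta> * X z) \<le> norm (E \<delta> z - fgrad s u z * fgrad s (\<phi> \<delta>) z)" for z
        using pw[OF \<delta> order.refl, of z] X0[of z] \<delta> by (simp add: abs_mult)
      then show "AE z in lebesgue. norm (\<delta> * X z) \<le> norm (E \<delta> z - fgrad s u z * fgrad s (\<phi> \<delta>) z)" by simp
    qed (use Xm in simp)
    then show ?thesis using \<delta> by simp
  qed
  have C: "0 \<le> C" "AE x in lebesgue. \<bar>r x\<bar> \<le> C" using r by (auto simp: bounded_weight_def)
  define m where "m = measure lebesgue \<Omega>"
  have i\<Omega>: "integrable lebesgue (indicator \<Omega> :: 'a \<Rightarrow> real)"
    using emeasure_\<Omega>_finite by (intro integrable_real_indicator) auto
  have form_small: "\<bar>form r u (\<phi> \<epsilon>)\<bar> \<le> C * \<epsilon>\<^sup>2 * m" if \<epsilon>: "0 < \<epsilon>" for \<epsilon>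
  proof -
    have "\<bar>form r u (\<phi> \<epsilon>)\<bar> \<le> (\<integral>x. \<bar>r x * (u x * \<phi> \<epsilon> x)\<bar> \<partial>lebesgue)"
      unfolding form_def by (rule integral_abs_bound)
    also have "\<dots> \<le> (\<integral>x. C * \<epsilon>\<^sup>2 * indicator \<Omega> x \<partial>lebesgue)"
    proof (rule integral_mono_AE)
      show "integrable lebesgue (\<lambda>x. \<bar>r x * (u x * \<phi> \<epsilon> x)\<bar>)"
        by (intro integrable_abs integrable_weight_mult[OF r] H0s_D(1,2)[OF u] H0s_D(1,2)[OF \<phi>V[OF \<epsilon>]])
      show "integrable lebesgue (\<lambda>x. C * \<epsilon>\<^sup>2 * indicator \<Omega> x)" using i\<Omega> by simp
      show "AE x in lebesgue. \<bar>r x * (u x * \<phi> \<epsilon> x)\<bar> \<le> C * \<epsilon>\<^sup>2 * indicator \<Omega> x"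
        using C(2)
      proof eventually_elim
        case (elim x)
        show ?case
        proof (cases "x \<in> \<Omega>")
          case True
          have "u x * w \<epsilon> (u x) \<le> \<epsilon> * \<epsilon>"
          proof (cases "u x \<le> \<epsilon>")
            case True
            then show ?thesis using w_range[of \<epsilon> "u x"] u0[of x] \<epsilon> by (intro mult_mono) auto
          next
            case False
            then show ?thesis using \<epsilon> by (simp add: w_def)
          qed
          then have "(u x * w \<epsilon> (u x)) * cutoff x \<le> (\<epsilon> * \<epsilon>) * 1"
            by (rule mult_mono) (use cutoff_range[of x] \<epsilon> in auto)
          moreover have "0 \<le> u x * \<phi> \<epsilon> x"
            unfolding \<phi>_def using w_range[of \<epsilon> "u x"] u0[of x] \<epsilon> cutoff_range[of x] by auto
          ultimately have "\<bar>u x * \<phi> \<epsilon> x\<bar> \<le> \<epsilon>\<^sup>2" by (simp add: \<phi>_def power2_eq_square mult_ac)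
          then have "\<bar>r x\<bar> * \<bar>u x * \<phi> \<epsilon> x\<bar> \<le> C * \<epsilon>\<^sup>2" using elim C(1) by (intro mult_mono) auto
          then show ?thesis using True by (simp add: abs_mult)
        next
          case False
          then show ?thesis by (simp add: \<phi>_def cutoff_outside)
        qed
      qed
    qed
    also have "\<dots> = C * \<epsilon>\<^sup>2 * m" by (simp add: m_def)
    finally show ?thesis .
  qed
  have main: "(\<integral>z. X z \<partial>lebesgue) \<le> (\<integral>z. E \<epsilon> z / \<epsilon> \<partial>lebesgue) + C * m / \<mu> * \<epsilon>"
    if \<epsilon>: "0 < \<epsilon>" "\<epsilon> \<le> \<delta>" for \<epsilon>
  proof -
    have "(\<integral>z. \<epsilon> * X z \<partial>lebesgue) \<le> (\<integral>z. E \<epsilon> z - fgrad s u z * fgrad s (\<phi> \<epsilon>) z \<partial>lebesgue)"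
      by (rule integral_mono) (use iX iE[OF \<epsilon>(1)] integrable_fgrad_mult[OF u \<phi>V[OF \<epsilon>(1)]] pw[OF \<epsilon>] in auto)
    then have "\<epsilon> * (\<integral>z. X z \<partial>lebesgue) \<le> (\<integral>z. E \<epsilon> z \<partial>lebesgue) - B u (\<phi> \<epsilon>)"
      using iE[OF \<epsilon>(1)] integrable_fgrad_mult[OF u \<phi>V[OF \<epsilon>(1)]] by (simp add: H0s_inner_fgrad)
    moreover have "- B u (\<phi> \<epsilon>) \<le> C * \<epsilon>\<^sup>2 * m / \<mu>"
      using form_small[OF \<epsilon>(1)] eig[OF \<phi>V[OF \<epsilon>(1)]] \<mu> by (simp add: pos_le_divide_eq mult.commute abs_le_iff)
    ultimately have "\<epsilon> * (\<integral>z. X z \<partial>lebesgue) \<le> (\<integral>z. E \<epsilon> z \<partial>lebesgue) + C * \<epsilon>\<^sup>2 * m / \<mu>" by linarith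
    then have "\<epsilon> * (\<integral>z. X z \<partial>lebesgue) / \<epsilon> \<le> ((\<integral>z. E \<epsilon> z \<partial>lebesgue) + C * \<epsilon>\<^sup>2 * m / \<mu>) / \<epsilon>"
      using \<epsilon> by (intro divide_right_mono) auto
    moreover have "C * \<epsilon>\<^sup>2 * m / \<mu> / \<epsilon> = C * m / \<mu> * \<epsilon>" using \<epsilon> \<mu> by (simp add: power2_eq_square field_simps)
    ultimately show ?thesis using \<epsilon> by (simp add: add_divide_distrib)
  qed
  define \<epsilon> where "\<epsilon> n = \<delta> / real (Suc n)" for n
  have \<epsilon>: "0 < \<epsilon> n" "\<epsilon> n \<le> \<delta>" for n using \<delta> by (auto simp: \<epsilon>_def divide_le_eq)
  have \<epsilon>_lim: "\<epsilon> \<longlonglongrightarrow> 0"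
    using tendsto_mult_right_zero[OF LIMSEQ_Suc[OF lim_1_over_n], of \<delta>] by (simp add: \<epsilon>_def[abs_def])
  have "(\<lambda>n. \<integral>z. E (\<epsilon> n) z / \<epsilon> n \<partial>lebesgue) \<longlonglongrightarrow> (\<integral>z. 0 \<partial>(lebesgue :: ('a \<times> 'a) measure))"
  proof (rule integral_dominated_convergence[where w = D])
    show "(\<lambda>z. E (\<epsilon> n) z / \<epsilon> n) \<in> borel_measurable lebesgue" for n using Em by simp
    show "integrable lebesgue D" by (rule iD)
    show "AE z in lebesgue. norm (E (\<epsilon> n) z / \<epsilon> n) \<le> D z" for n
      using E_le[OF \<epsilon>(1)[of n]] E0[of "\<epsilon> n"] \<epsilon>(1)[of n] by (intro AE_I2) (simp add: pos_divide_le_eq mult.commute)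
    show "AE z in lebesgue. (\<lambda>n. E (\<epsilon> n) z / \<epsilon> n) \<longlonglongrightarrow> 0"
    proof (intro AE_I2)
      fix z :: "'a \<times> 'a"
      define K where "K = \<bar>cutoff (fst z) - cutoff (snd z)\<bar> / 2 / k z"
      have K: "0 \<le> K" using k0[of z] by (simp add: K_def)
      have up: "E (\<epsilon> n) z / \<epsilon> n \<le> \<epsilon> n * K" for n
      proof -
        let ?a = "w (\<epsilon> n) (u (fst z))" and ?b = "w (\<epsilon> n) (u (snd z))"
        have "0 \<le> ?a" "?a \<le> \<epsilon> n" "0 \<le> ?b" "?b \<le> \<epsilon> n" using w_range[of "\<epsilon> n"] \<epsilon>[of n] u0 by auto
        then have "?a\<^sup>2 \<le> (\<epsilon> n)\<^sup>2" "?b\<^sup>2 \<le> (\<epsilon> n)\<^sup>2" by (auto intro: power_mono)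
        then have "\<bar>?a\<^sup>2 - ?b\<^sup>2\<bar> \<le> (\<epsilon> n)\<^sup>2" using zero_le_power2[of ?a] zero_le_power2[of ?b] by linarith
        then have "\<bar>?a\<^sup>2 - ?b\<^sup>2\<bar> * K \<le> (\<epsilon> n)\<^sup>2 * K" using K by (rule mult_right_mono)
        then have "E (\<epsilon> n) z \<le> \<epsilon> n * K * \<epsilon> n" by (simp add: E_def K_def power2_eq_square mult_ac)
        then show ?thesis using \<epsilon>(1)[of n] by (simp add: pos_divide_le_eq)
      qed
      have "(\<lambda>n. \<epsilon> n * K) \<longlonglongrightarrow> 0" using tendsto_mult_left_zero[OF \<epsilon>_lim] by simp
      then show "(\<lambda>n. E (\<epsilon> n) z / \<epsilon> n) \<longlonglongrightarrow> 0"
      proof (rule real_tendsto_sandwich[where f = "\<lambda>n. 0" and h = "\<lambda>n. \<epsilon> n * K", rotated 3])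
        show "\<forall>\<^sub>F n in sequentially. 0 \<le> E (\<epsilon> n) z / \<epsilon> n"
          by (intro always_eventually allI divide_nonneg_pos E0 \<epsilon>(1))
        show "\<forall>\<^sub>F n in sequentially. E (\<epsilon> n) z / \<epsilon> n \<le> \<epsilon> n * K"
          by (intro always_eventually allI up)
      qed (rule tendsto_const)
    qed
  qed simp
  then have "(\<lambda>n. \<integral>z. E (\<epsilon> n) z / \<epsilon> n \<partial>lebesgue) \<longlonglongrightarrow> 0" by simp
  from tendsto_add[OF this tendsto_mult_left[OF \<epsilon>_lim, of "C * m / \<mu>"]]
  have "(\<lambda>n. (\<integral>z. E (\<epsilon> n) z / \<epsilon> n \<partial>lebesgue) + C * m / \<mu> * \<epsilon> n) \<longlonglongrightarrow> 0 + C * m / \<mu> * 0" .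
  then have "(\<integral>z. X z \<partial>lebesgue) \<le> 0 + C * m / \<mu> * 0"
    by (rule LIMSEQ_le_const) (use main[OF \<epsilon>] in auto)
  moreover have "0 \<le> (\<integral>z. X z \<partial>lebesgue)" by (rule integral_nonneg_AE) (use X0 in simp)
  ultimately have "(\<integral>z. X z \<partial>lebesgue) = 0" by simp
  moreover have "AE z in lebesgue. 0 \<le> X z" using X0 by simp
  ultimately have "AE z in lebesgue. X z = 0" using integral_nonneg_eq_0_iff_AE[OF iX] by blast
  then show ?thesis by (simp add: X_def k_def)
qed

text \<open>The kernel is positive everywhere: if \<open>{u = 0}\<close> had positive measure in \<open>\<Omega>\<close>, the vanishing of its
interaction with \<open>{u > \<delta>}\<close> would make the latter a null set for every \<open>\<delta> > 0\<close>.\<close>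

theorem strong_maximum_principle:
  assumes r: "bounded_weight r C" and \<mu>: "0 < \<mu>"
    and u: "u \<in> V" and eig: "\<And>\<phi>. \<phi> \<in> V \<Longrightarrow> form r u \<phi> = \<mu> * B u \<phi>"
    and nonneg: "AE x in lebesgue. 0 \<le> u x"
  shows "(AE x in lebesgue. u x = 0) \<or> (AE x in lebesgue. x \<in> \<Omega> \<longrightarrow> 0 < u x)"
proof -
  obtain v0 where v0: "v0 \<in> V" "v0 \<in> borel_measurable borel" "AE x in lebesgue. u x = v0 x"
    using borel_representative[OF u] by blast
  define v where "v x = max 0 (v0 x)" for x
  have vb: "v \<in> borel_measurable borel" unfolding v_def[abs_def] using v0(2) by simp
  have uv: "AE x in lebesgue. u x = v x" using v0(3) nonneg by eventually_elim (auto simp: v_def)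
  have vV: "v \<in> V" by (rule H0s_cong_AE[OF u uv])
  have v_nn: "0 \<le> v x" for x by (simp add: v_def)
  have v_eig: "form r v \<phi> = \<mu> * B v \<phi>" if \<phi>: "\<phi> \<in> V" for \<phi>
  proof -
    have "form r u \<phi> = form r v \<phi>" unfolding form_def
    proof (rule integral_cong_AE)
      show "AE x in lebesgue. r x * (u x * \<phi> x) = r x * (v x * \<phi> x)" using uv by eventually_elim simp
    qed (use r H0s_D(1)[OF u] H0s_D(1)[OF vV] H0s_D(1)[OF \<phi>] in \<open>auto simp: bounded_weight_def\<close>)
    moreover have "B u \<phi> = B v \<phi>" by (rule B_cong_AE[OF u \<phi> uv]) simp
    ultimately show ?thesis using eig[OF \<phi>] by simp
  qed
  show ?thesis
  proof (cases "AE x in lebesgue. x \<in> \<Omega> \<longrightarrow> 0 < v x")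
    case True
    then have "AE x in lebesgue. x \<in> \<Omega> \<longrightarrow> 0 < u x" using uv by eventually_elim simp
    then show ?thesis ..
  next
    case False
    have small: "AE x in lebesgue. v x \<le> \<delta>" if \<delta>: "0 < \<delta>" for \<delta>
    proof -
      have "AE z in lebesgue. (max 0 (v (fst z) - \<delta>) * (if v (snd z) = 0 then 1 else 0) * cutoff (snd z)) /
          norm (fst z - snd z) powr (real DIM('a) + 2 * s) = 0"
        by (rule strong_maximum_principle_aux[OF r \<mu> vV v_eig vb v_nn \<delta>])
      then have "AE z in lborel \<Otimes>\<^sub>M lborel. (max 0 (v (fst z) - \<delta>) * (if v (snd z) = 0 then 1 else 0) * cutoff (snd z)) /
          norm (fst z - snd z) powr (real DIM('a) + 2 * s) = 0"
        by (simp only: AE_lebesgue_iff lborel_prod)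
      from pair_sigma_finite.AE_pair[OF pair_sigma_finite_lborel this]
      have "AE x in lborel. AE y in lborel. (max 0 (v x - \<delta>) * (if v y = 0 then 1 else 0) * cutoff y) /
          norm (x - y) powr (real DIM('a) + 2 * s) = 0" by simp
      then have "AE x in lborel. v x \<le> \<delta>"
      proof eventually_elim
        case (elim x)
        show ?case
        proof (rule ccontr)
          assume nle: "\<not> v x \<le> \<delta>"
          have "AE y in lborel. y \<noteq> x" by (rule AE_lborel_singleton)
          with elim have "AE y in lborel. y \<in> \<Omega> \<longrightarrow> 0 < v y"
          proof eventually_elim
            case (elim y)
            show ?case
            proof
              assume y: "y \<in> \<Omega>"
              have "v y \<noteq> 0"
              proof
                assume "v y = 0"
                then have "max 0 (v x - \<delta>) * cutoff y / norm (x - y) powr (real DIM('a) + 2 * s) = 0"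
                  using elim(1) by simp
                moreover have "0 < max 0 (v x - \<delta>)" using nle by simp
                moreover have "0 < cutoff y" by (rule cutoff_pos[OF y])
                moreover have "0 < norm (x - y) powr (real DIM('a) + 2 * s)" using elim(2) by simp
                ultimately show False by simp
              qed
              then show "0 < v y" using v_nn[of y] by simp
            qed
          qed
          then show False using False by (simp add: AE_lebesgue_iff)
        qed
      qed
      then show ?thesis by (simp add: AE_lebesgue_iff)
    qed
    have "AE x in lebesgue. \<forall>n :: nat. v x \<le> 1 / real (Suc n)"
      unfolding AE_all_countable using small by simp
    then have "AE x in lebesgue. v x = 0"
    proof eventually_elim
      case (elim x)
      have "\<not> 0 < v x"
      proof
        assume "0 < v x"
        then obtain n where "1 / real (Suc n) < v x" using nat_approx_posE by blast
        then show False using elim by (simp add: not_less[symmetric])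
      qed
      then show ?case using v_nn[of x] by simp
    qed
    then have "AE x in lebesgue. u x = 0" using uv by eventually_elim simp
    then show ?thesis ..
  qed
qed

end

section \<open>Dimension modulo equality almost everywhere\<close>

lemma has_ae_dim_le:
  assumes "has_ae_dim W d" "has_ae_dim W d'"
  shows "d \<le> d'"
proof (rule ccontr)
  assume "\<not> d \<le> d'"
  then have less: "d' < d" by simp
  from assms(1) obtain b where b: "\<And>i. i < d \<Longrightarrow> b i \<in> W"
    "\<And>c. (AE x in lebesgue. (\<Sum>i<d. c i * b i x) = 0) \<Longrightarrow> \<forall>i<d. c i = 0"
    unfolding has_ae_dim_def by blast
  from assms(2) obtain b' :: "nat \<Rightarrow> 'a \<Rightarrow> real" where
    b': "\<And>f. f \<in> W \<Longrightarrow> \<exists>c. AE x in lebesgue. f x = (\<Sum>j<d'. c j * b' j x)"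
    unfolding has_ae_dim_def by blast
  have "\<forall>i. \<exists>c. i < d \<longrightarrow> (AE x in lebesgue. b i x = (\<Sum>j<d'. c j * b' j x))" using b(1) b' by blast
  then have "\<exists>A. \<forall>i. i < d \<longrightarrow> (AE x in lebesgue. b i x = (\<Sum>j<d'. A i j * b' j x))" by (rule choice)
  then obtain A where A: "\<And>i. i < d \<Longrightarrow> AE x in lebesgue. b i x = (\<Sum>j<d'. A i j * b' j x)" by blast
  obtain c where c: "\<exists>i<d. c i \<noteq> 0" "\<And>j. j < d' \<Longrightarrow> (\<Sum>i<d. c i * A i j) = 0"
    using underdetermined_system[OF less, of A] by blast
  have "AE x in lebesgue. \<forall>i\<in>{..<d}. b i x = (\<Sum>j<d'. A i j * b' j x)"
    using A by (intro AE_finite_allI) auto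
  then have "AE x in lebesgue. (\<Sum>i<d. c i * b i x) = 0"
  proof eventually_elim
    case (elim x)
    have "(\<Sum>i<d. c i * b i x) = (\<Sum>i<d. \<Sum>j<d'. c i * A i j * b' j x)"
      using elim by (intro sum.cong refl) (simp add: sum_distrib_left mult.assoc)
    also have "\<dots> = (\<Sum>j<d'. \<Sum>i<d. c i * A i j * b' j x)" by (rule sum.swap)
    also have "\<dots> = (\<Sum>j<d'. (\<Sum>i<d. c i * A i j) * b' j x)" by (simp only: sum_distrib_right)
    also have "\<dots> = 0" using c(2) by simp
    finally show ?case .
  qed
  then show False using b(2)[of c] c(1) by blast
qed

lemma has_ae_dim_unique: "has_ae_dim W d \<Longrightarrow> has_ae_dim W d' \<Longrightarrow> d = d'"
  by (intro antisym has_ae_dim_le)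

context fractional_setting
begin

section \<open>The solution operator and its eigenvalues\<close>

lemma form_square_le:
  assumes r: "bounded_weight r C" and f: "f \<in> V" and g: "g \<in> V"
  shows "(form r f g)\<^sup>2 \<le> (C\<^sup>2 * (\<integral>x. (f x)\<^sup>2 \<partial>lebesgue) * Poincare_const) * B g g"
proof -
  let ?a = "\<integral>x. (f x)\<^sup>2 \<partial>lebesgue" and ?b = "\<integral>x. (g x)\<^sup>2 \<partial>lebesgue"
  have a: "0 \<le> ?a" and b: "0 \<le> ?b" by (intro integral_nonneg_AE; simp)+
  have "(form r f g)\<^sup>2 \<le> (C * (sqrt ?a * sqrt ?b))\<^sup>2"
    using power_mono[OF form_le[OF r H0s_D(1,2)[OF f] H0s_D(1,2)[OF g]], of 2] by simp
  also have "\<dots> = (C\<^sup>2 * ?a) * ?b" using a b by (simp only: power_mult_distrib real_sqrt_pow2 mult.assoc)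
  also have "\<dots> \<le> (C\<^sup>2 * ?a) * (Poincare_const * B g g)"
    using a by (intro mult_left_mono Poincare_ineq g mult_nonneg_nonneg) auto
  finally show ?thesis by (simp only: mult.assoc)
qed

lemma bounded_functional_form:
  assumes r: "bounded_weight r C" and f: "f \<in> V"
  shows "bounded_functional (form r f)"
proof -
  interpret Q: sym_form V "form r" by (rule sym_form_form[OF r])
  show ?thesis unfolding bounded_functional_def
    using Q.add_right f Q.scale_right form_square_le[OF r f] by blast
qed

lemma G_solution:
  assumes \<rho>: "bounded_weight (weight \<rho>) C" and f: "f \<in> V"
  shows "G s \<Omega> \<rho> f \<in> V" and "\<phi> \<in> V \<Longrightarrow> B (G s \<Omega> \<rho> f) \<phi> = form (weight \<rho>) f \<phi>"
proof -
  have "\<exists>u. u \<in> V \<and> (\<forall>\<phi>\<in>V. B u \<phi> = (LINT x|lebesgue_on \<Omega>. \<rho> x * f x * \<phi> x))"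
    using Riesz_representation[OF bounded_functional_form[OF \<rho> f]] unfolding form_eq by blast
  then have "G s \<Omega> \<rho> f \<in> V \<and> (\<forall>\<phi>\<in>V. B (G s \<Omega> \<rho> f) \<phi> = (LINT x|lebesgue_on \<Omega>. \<rho> x * f x * \<phi> x))"
    unfolding G_def by (rule someI_ex)
  then show "G s \<Omega> \<rho> f \<in> V" "\<phi> \<in> V \<Longrightarrow> B (G s \<Omega> \<rho> f) \<phi> = form (weight \<rho>) f \<phi>"
    unfolding form_eq by blast+
qed

text \<open>Eigenfunctions in the weak sense; equality almost everywhere is the same as distance \<open>0\<close> with respect
to \<open>B\<close>.\<close>

lemma G_eigenspace_iff:
  assumes \<rho>: "bounded_weight (weight \<rho>) C"
  shows "f \<in> G_eigenspace s \<Omega> \<rho> l \<longleftrightarrow> f \<in> V \<and> (\<forall>\<phi>\<in>V. form (weight \<rho>) f \<phi> = l * B f \<phi>)"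
proof (cases "f \<in> V")
  case f: True
  note GV = G_solution(1)[OF \<rho> f] and GB = G_solution(2)[OF \<rho> f]
  have lf: "l *\<^sub>R f \<in> V" by (rule mem_scale[OF f])
  have "(AE x in lebesgue. G s \<Omega> \<rho> f x = l * f x) \<longleftrightarrow> B (G s \<Omega> \<rho> f - l *\<^sub>R f) (G s \<Omega> \<rho> f - l *\<^sub>R f) = 0"
    unfolding B_eq_0_iff[OF mem_diff[OF GV lf]] by simp
  also have "\<dots> \<longleftrightarrow> (\<forall>\<phi>\<in>V. B (G s \<Omega> \<rho> f - l *\<^sub>R f) \<phi> = 0)"
    using isotropic[OF mem_diff[OF GV lf]] mem_diff[OF GV lf] by blast
  also have "\<dots> \<longleftrightarrow> (\<forall>\<phi>\<in>V. form (weight \<rho>) f \<phi> = l * B f \<phi>)"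
    by (intro ball_cong refl) (simp add: diff_left GV lf GB scale_left f)
  finally show ?thesis using f by (simp add: G_eigenspace_def)
qed (simp add: G_eigenspace_def)

text \<open>The eigenvalues are listed from index \<open>1\<close> on, the spectral sequence from index \<open>0\<close> on.\<close>

lemma lists_pos_eigenvalues_spectral_seq:
  assumes \<rho>: "bounded_weight (weight \<rho>) C" and S: "spectral_seq (form (weight \<rho>)) e \<mu>"
  shows "lists_pos_eigenvalues s \<Omega> \<rho> (\<lambda>k. \<mu> (k - 1))"
  unfolding lists_pos_eigenvalues_def
proof (intro conjI allI impI)
  note SD = spectral_seqD[OF S] and cQ = compact_form_form[OF \<rho>]
  show "0 < \<mu> (k - 1)" for k by (rule SD(3))
  show "\<mu> (k - 1) \<le> \<mu> (j - 1)" if "j \<le> k" for j k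
    using that by (intro spectral_seq_antimono[OF S]) simp
  fix l :: real assume l: "0 < l"
  define K where "K = {k. \<mu> k = l}"
  have fin: "finite K" unfolding K_def
    by (rule finite_subset[OF _ spectral_seq_finite_level[OF cQ S l]]) auto
  have SucK: "{k. 1 \<le> k \<and> \<mu> (k - 1) = l} = Suc ` K"
  proof -
    have "k \<in> Suc ` K" if "1 \<le> k" "\<mu> (k - 1) = l" for k
      using that by (cases k) (auto simp: K_def)
    then show ?thesis by (auto simp: K_def)
  qed
  show "finite {k. 1 \<le> k \<and> \<mu> (k - 1) = l}" unfolding SucK using fin by simp
  have card: "card {k. 1 \<le> k \<and> \<mu> (k - 1) = l} = card K" unfolding SucK by (simp add: card_image)
  obtain q where q: "bij_betw q {..<card K} K"
    using ex_bij_betw_nat_finite[OF fin] by (auto simp: atLeast0LessThan)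
  have qK: "\<mu> (q i) = l" if "i < card K" for i using q that by (auto simp: bij_betw_def K_def)
  have q_inj: "q i = q j \<longleftrightarrow> i = j" if "i < card K" "j < card K" for i j
    using q that by (auto simp: bij_betw_def inj_on_def)
  have "has_ae_dim (G_eigenspace s \<Omega> \<rho> l) (card K)"
    unfolding has_ae_dim_def
  proof (intro exI[of _ "\<lambda>i. e (q i)"] conjI allI impI ballI)
    show "e (q i) \<in> G_eigenspace s \<Omega> \<rho> l" if "i < card K" for i
      unfolding G_eigenspace_iff[OF \<rho>] using SD(1)[of "q i"] SD(4)[of _ "q i"] qK[OF that] by simp
  next
    fix c :: "nat \<Rightarrow> real" and i
    assume ae: "AE x in lebesgue. (\<Sum>i<card K. c i * e (q i) x) = 0" and i: "i < card K"
    define g where "g = (\<Sum>i<card K. c i *\<^sub>R e (q i))"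
    have g: "g \<in> V" unfolding g_def using SD(1) by (intro mem)
    have "AE x in lebesgue. g x = 0" using ae by (simp add: g_def sum_fun_apply)
    then have "B g g = 0" using B_eq_0_iff[OF g] by blast
    moreover have "B g g = (\<Sum>i<card K. (c i)\<^sup>2 * B (e (q i)) (e (q i)))"
      unfolding g_def by (rule sum_diag) (use SD(1,2) q_inj in auto)
    ultimately have "(\<Sum>i<card K. (c i)\<^sup>2) = 0" using SD(2) by simp
    then show "c i = 0" using i by (subst (asm) sum_nonneg_eq_0_iff) auto
  next
    fix f assume "f \<in> G_eigenspace s \<Omega> \<rho> l"
    then have f: "f \<in> V" and feig: "\<And>g. g \<in> V \<Longrightarrow> form (weight \<rho>) f g = l * B f g"
      unfolding G_eigenspace_iff[OF \<rho>] by blast+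
    define h where "h = f - (\<Sum>k | \<mu> k = l. B f (e k) *\<^sub>R e k)"
    have hV: "h \<in> V" unfolding h_def using f SD(1) by (intro mem)
    have "B h h = 0" unfolding h_def by (rule eigenvector_expansion[OF cQ S l f feig])
    then have "AE x in lebesgue. h x = 0" using B_eq_0_iff[OF hV] by blast
    then have "AE x in lebesgue. f x = (\<Sum>i<card K. B f (e (q i)) * e (q i) x)"
    proof eventually_elim
      case (elim x)
      have "f x = (\<Sum>k\<in>K. B f (e k) * e k x)" using elim by (simp add: h_def sum_fun_apply K_def)
      also have "\<dots> = (\<Sum>i<card K. B f (e (q i)) * e (q i) x)"
        by (rule sum.reindex_bij_betw[OF q, symmetric])
      finally show ?case .
    qed
    then show "\<exists>c. AE x in lebesgue. f x = (\<Sum>i<card K. c i * e (q i) x)"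
      by (rule exI[of _ "\<lambda>i. B f (e (q i))"])
  qed
  then show "has_ae_dim (G_eigenspace s \<Omega> \<rho> l) (card {k. 1 \<le> k \<and> \<mu> (k - 1) = l})" by (simp only: card)
qed

lemma mu_eq_spectral_seq:
  assumes \<rho>: "bounded_weight (weight \<rho>) C" and S: "spectral_seq (form (weight \<rho>)) e \<mu>"
  shows "mu s \<Omega> \<rho> (Suc k) = \<mu> k"
proof -
  have L: "lists_pos_eigenvalues s \<Omega> \<rho> (\<lambda>k. \<mu> (k - 1))" by (rule lists_pos_eigenvalues_spectral_seq[OF \<rho> S])
  then have M: "lists_pos_eigenvalues s \<Omega> \<rho> (mu s \<Omega> \<rho>)" unfolding mu_def by (rule someI[where P = "lists_pos_eigenvalues s \<Omega> \<rho>"])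
  have shift: "{k. 1 \<le> k \<and> m k = l} = Suc ` {k. m (Suc k) = l}" for m :: "nat \<Rightarrow> real" and l
  proof -
    have "k \<in> Suc ` {k. m (Suc k) = l}" if "1 \<le> k" "m k = l" for k using that by (cases k) auto
    then show ?thesis by auto
  qed
  have fin: "finite {k. m (Suc k) = l}" if "lists_pos_eigenvalues s \<Omega> \<rho> m" "0 < l" for m l
  proof -
    have "finite (Suc ` {k. m (Suc k) = l})"
      using that unfolding lists_pos_eigenvalues_def shift by blast
    then show ?thesis by (rule finite_imageD) simp
  qed
  have dim: "has_ae_dim (G_eigenspace s \<Omega> \<rho> l) (card {k. m (Suc k) = l})"
    if "lists_pos_eigenvalues s \<Omega> \<rho> m" "0 < l" for m l
  proof -
    have "has_ae_dim (G_eigenspace s \<Omega> \<rho> l) (card (Suc ` {k. m (Suc k) = l}))"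
      using that unfolding lists_pos_eigenvalues_def shift by blast
    then show ?thesis by (simp add: card_image)
  qed
  have "(\<lambda>k. mu s \<Omega> \<rho> (Suc k)) = \<mu>"
  proof (rule antimono_eq_if_same_multiplicities)
    show "0 < mu s \<Omega> \<rho> (Suc k)" "0 < \<mu> k" for k
      using M L unfolding lists_pos_eigenvalues_def by (auto dest!: spec[of _ "Suc k"])
    show "mu s \<Omega> \<rho> (Suc k) \<le> mu s \<Omega> \<rho> (Suc j)" if "j \<le> k" for j k
      using M that unfolding lists_pos_eigenvalues_def by simp
    show "\<mu> k \<le> \<mu> j" if "j \<le> k" for j k by (rule spectral_seq_antimono[OF S that])
    fix l :: real assume l: "0 < l"
    show "finite {k. mu s \<Omega> \<rho> (Suc k) = l}" by (rule fin[OF M l])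
    show "finite {k. \<mu> k = l}" using fin[OF L l] by simp
    show "card {k. mu s \<Omega> \<rho> (Suc k) = l} = card {k. \<mu> k = l}"
      using has_ae_dim_unique[OF dim[OF M l] dim[OF L l]] by simp
  qed
  then show ?thesis by (rule fun_cong)
qed

lemma positive_part_null_iff:
  assumes "\<rho> \<in> Linf \<Omega>"
  shows "emeasure lebesgue {x \<in> \<Omega>. 0 < \<rho> x} > 0 \<longleftrightarrow> \<not> negligible {x \<in> \<Omega>. 0 < weight \<rho> x}"
proof -
  have eq: "{x \<in> \<Omega>. 0 < weight \<rho> x} = {x \<in> \<Omega>. 0 < \<rho> x}" by (auto simp: weight_def)
  have rm: "weight \<rho> \<in> borel_measurable lebesgue" using assms by (auto simp: Linf_def intro: weight_measurable)
  have "{x \<in> space lebesgue. 0 < weight \<rho> x} \<in> sets lebesgue" by (rule borel_measurable_less) (use rm in auto)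
  then have "\<Omega> \<inter> {x. 0 < weight \<rho> x} \<in> sets lebesgue" using \<Omega>_lebesgue by (intro sets.Int) simp_all
  moreover have "{x \<in> \<Omega>. 0 < \<rho> x} = \<Omega> \<inter> {x. 0 < weight \<rho> x}" by (auto simp: weight_def)
  ultimately have "{x \<in> \<Omega>. 0 < \<rho> x} \<in> sets lebesgue" by simp
  then show ?thesis unfolding eq
    by (simp only: negligible_iff_emeasure0 zero_less_iff_neq_zero)
qed

lemma spectral_seq_of_weight:
  assumes r: "bounded_weight r C" and pos: "\<not> negligible {x \<in> \<Omega>. 0 < r x}"
  shows "\<exists>e \<mu>. spectral_seq (form r) e \<mu>"
  by (rule spectral_seq_exists[OF compact_form_form[OF r]]) (rule positive_directions[OF r pos])

lemma form_nonpos: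
  assumes r: "bounded_weight r C" and neg: "negligible {x \<in> \<Omega>. 0 < r x}" and f: "f \<in> V"
  shows "form r f f \<le> 0"
proof -
  have "AE x in lebesgue. x \<notin> {x \<in> \<Omega>. 0 < r x}"
    using neg unfolding negligible_iff_null_sets by (rule AE_not_in)
  then have "AE x in lebesgue. 0 \<le> - (r x * (f x * f x))"
    using H0s_D(5)[OF f]
  proof eventually_elim
    case (elim x)
    show ?case
    proof (cases "x \<in> \<Omega>")
      case True
      then have "r x \<le> 0" using elim by auto
      then show ?thesis by (simp add: mult_nonpos_nonneg)
    next
      case False
      then show ?thesis using elim by simp
    qed
  qed
  then have "0 \<le> (\<integral>x. - (r x * (f x * f x)) \<partial>lebesgue)" by (rule integral_nonneg_AE)
  then show ?thesis by (simp add: form_def)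
qed

lemma mu_tilde_nonneg:
  assumes "\<rho> \<in> Linf \<Omega>" shows "0 \<le> mu_tilde s \<Omega> \<rho> (Suc k)"
proof (cases "emeasure lebesgue {x \<in> \<Omega>. 0 < \<rho> x} > 0")
  case True
  obtain C where C: "bounded_weight (weight \<rho>) C" using Linf_bounded_weight[OF assms] by blast
  obtain e \<mu> where S: "spectral_seq (form (weight \<rho>)) e \<mu>"
    using spectral_seq_of_weight[OF C] True positive_part_null_iff[OF assms] by blast
  show ?thesis using mu_eq_spectral_seq[OF C S, of k] spectral_seqD(3)[OF S, of k] True by (simp add: mu_tilde_def)
qed (simp add: mu_tilde_def)

text \<open>If \<open>{\<rho>' > 0}\<close> is a null set, the form of \<open>\<rho>'\<close> is nonpositive and the hypothesis gives
\<open>form (weight \<rho>) (e k) (e k) \<le> \<delta>\<close> directly.\<close>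

lemma mu_tilde_compare:
  assumes \<rho>: "\<rho> \<in> Linf \<Omega>" and \<rho>': "\<rho>' \<in> Linf \<Omega>" and \<delta>: "0 \<le> \<delta>"
    and le: "\<And>f. f \<in> V \<Longrightarrow> form (weight \<rho>) f f \<le> form (weight \<rho>') f f + \<delta> * B f f"
  shows "mu_tilde s \<Omega> \<rho> (Suc k) \<le> mu_tilde s \<Omega> \<rho>' (Suc k) + \<delta>"
proof (cases "emeasure lebesgue {x \<in> \<Omega>. 0 < \<rho> x} > 0")
  case True
  obtain C where C: "bounded_weight (weight \<rho>) C" using Linf_bounded_weight[OF \<rho>] by blast
  obtain e \<mu> where S: "spectral_seq (form (weight \<rho>)) e \<mu>"
    using spectral_seq_of_weight[OF C] True positive_part_null_iff[OF \<rho>] by blast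
  have mt: "mu_tilde s \<Omega> \<rho> (Suc k) = \<mu> k" using mu_eq_spectral_seq[OF C S] True by (simp add: mu_tilde_def)
  obtain C' where C': "bounded_weight (weight \<rho>') C'" using Linf_bounded_weight[OF \<rho>'] by blast
  show ?thesis
  proof (cases "emeasure lebesgue {x \<in> \<Omega>. 0 < \<rho>' x} > 0")
    case True
    obtain e' \<mu>' where S': "spectral_seq (form (weight \<rho>')) e' \<mu>'"
      using spectral_seq_of_weight[OF C'] True positive_part_null_iff[OF \<rho>'] by blast
    have "mu_tilde s \<Omega> \<rho>' (Suc k) = \<mu>' k" using mu_eq_spectral_seq[OF C' S'] True by (simp add: mu_tilde_def)
    then show ?thesis using spectral_seq_compare[OF S S' sym_form_form[OF C] le, of k] mt by simp
  next
    case False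
    have eV: "e k \<in> V" by (rule spectral_seqD(1)[OF S])
    have "form (weight \<rho>') (e k) (e k) \<le> 0"
      by (rule form_nonpos[OF C' _ eV]) (use False positive_part_null_iff[OF \<rho>'] in blast)
    moreover have "form (weight \<rho>) (e k) (e k) = \<mu> k" "B (e k) (e k) = 1"
      using spectral_seqD(4)[OF S eV, of k] spectral_seqD(2)[OF S, of k k] by simp_all
    ultimately have "\<mu> k \<le> \<delta>" using le[OF eV] by simp
    then show ?thesis using False mt by (simp add: mu_tilde_def)
  qed
next
  case False
  then show ?thesis using mu_tilde_nonneg[OF \<rho>', of k] \<delta> by (simp add: mu_tilde_def)
qed

section \<open>The first eigenfunction\<close>

lemma abs_in_H0s:
  assumes f: "f \<in> V"
  shows "(\<lambda>x. \<bar>f x\<bar>) \<in> V" and "B (\<lambda>x. \<bar>f x\<bar>) (\<lambda>x. \<bar>f x\<bar>) \<le> B f f"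
proof -
  show aV: "(\<lambda>x. \<bar>f x\<bar>) \<in> V"
  proof (rule H0s_of_increment_bound[OF f f, where c = 1])
    show "(\<lambda>x. \<bar>f x\<bar>) \<in> borel_measurable lebesgue" using H0s_D(1)[OF f] by simp
    fix x y
    show "\<bar>\<bar>f x\<bar>\<bar> \<le> 1 * (\<bar>f x\<bar> + \<bar>f x\<bar>)" by simp
    show "\<bar>\<bar>f x\<bar> - \<bar>f y\<bar>\<bar> \<le> 1 * (\<bar>f x - f y\<bar> + \<bar>f x - f y\<bar>)"
      by (rule order.trans[OF abs_triangle_ineq3]) simp
  qed
  show "B (\<lambda>x. \<bar>f x\<bar>) (\<lambda>x. \<bar>f x\<bar>) \<le> B f f"
    unfolding H0s_inner_self
  proof (rule integral_mono[OF H0s_D(4)[OF aV] H0s_D(4)[OF f]])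
    fix z
    have "\<bar>\<bar>f (fst z)\<bar> - \<bar>f (snd z)\<bar>\<bar>\<^sup>2 \<le> \<bar>f (fst z) - f (snd z)\<bar>\<^sup>2" by (intro power_mono) auto
    then show "(fgrad s (\<lambda>x. \<bar>f x\<bar>) z)\<^sup>2 \<le> (fgrad s f z)\<^sup>2"
      unfolding fgrad_square by (intro divide_right_mono) auto
  qed
qed

lemma integrable_H0s: "f \<in> V \<Longrightarrow> integrable lebesgue f"
proof -
  assume f: "f \<in> V"
  have "integrable lebesgue (\<lambda>x. indicator \<Omega> x * f x)"
  proof (rule integrable_mult_of_squares)
    have "(indicator \<Omega> x :: real)\<^sup>2 = indicator \<Omega> x" for x by (simp add: indicator_def)
    then show "integrable lebesgue (\<lambda>x. (indicator \<Omega> x :: real)\<^sup>2)"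
      using emeasure_\<Omega>_finite by (simp only:) (intro integrable_real_indicator; simp)
  qed (use H0s_D[OF f] in auto)
  then show ?thesis
    by (rule integrable_cong_AE_imp)
      (use H0s_D(1)[OF f] H0s_D(5)[OF f] in \<open>auto elim!: eventually_mono simp: indicator_def\<close>)
qed

context
  fixes r C e \<mu>
  assumes r: "bounded_weight r C" and S: "spectral_seq (form r) e \<mu>"
begin

text \<open>First eigenfunctions, together with the null functions, so that they form a vector space.\<close>

definition "ground f \<longleftrightarrow> f \<in> V \<and> (\<forall>\<phi>\<in>V. form r f \<phi> = \<mu> 0 * B f \<phi>)"

lemma ground_of_max: "f \<in> V \<Longrightarrow> form r f f = \<mu> 0 * B f f \<Longrightarrow> ground f"
  unfolding ground_def
  using maximizer_eigenvector[OF sym_form_form[OF r], of f "\<mu> 0"] spectral_seqD(5)[OF S, of _ 0] by blast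

lemma ground_add: "ground f \<Longrightarrow> ground g \<Longrightarrow> ground (f + g)"
  and ground_scale: "ground f \<Longrightarrow> ground (c *\<^sub>R f)"
proof -
  interpret Q: sym_form V "form r" by (rule sym_form_form[OF r])
  show "ground f \<Longrightarrow> ground g \<Longrightarrow> ground (f + g)"
    unfolding ground_def by (auto simp: mem Q.add_left add_left distrib_left)
  show "ground f \<Longrightarrow> ground (c *\<^sub>R f)"
    unfolding ground_def by (auto simp: mem Q.scale_left scale_left)
qed

lemma ground_abs:
  assumes "ground f" shows "ground (\<lambda>x. \<bar>f x\<bar>)"
proof (rule ground_of_max)
  have f: "f \<in> V" using assms by (simp add: ground_def)
  show aV: "(\<lambda>x. \<bar>f x\<bar>) \<in> V" by (rule abs_in_H0s(1)[OF f])
  have eq: "form r (\<lambda>x. \<bar>f x\<bar>) (\<lambda>x. \<bar>f x\<bar>) = form r f f" by (simp add: form_def)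
  have "form r f f = \<mu> 0 * B f f" using assms f by (simp add: ground_def)
  moreover have "\<mu> 0 * B (\<lambda>x. \<bar>f x\<bar>) (\<lambda>x. \<bar>f x\<bar>) \<le> \<mu> 0 * B f f"
    using abs_in_H0s(2)[OF f] spectral_seqD(3)[OF S, of 0] by simp
  moreover have "form r (\<lambda>x. \<bar>f x\<bar>) (\<lambda>x. \<bar>f x\<bar>) \<le> \<mu> 0 * B (\<lambda>x. \<bar>f x\<bar>) (\<lambda>x. \<bar>f x\<bar>)"
    by (rule spectral_seqD(5)[OF S aV]) simp
  ultimately show "form r (\<lambda>x. \<bar>f x\<bar>) (\<lambda>x. \<bar>f x\<bar>) = \<mu> 0 * B (\<lambda>x. \<bar>f x\<bar>) (\<lambda>x. \<bar>f x\<bar>)"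
    unfolding eq by linarith
qed

lemma ground_nonneg_cases:
  assumes "ground f" "AE x in lebesgue. 0 \<le> f x"
  shows "(AE x in lebesgue. f x = 0) \<or> (AE x in lebesgue. x \<in> \<Omega> \<longrightarrow> 0 < f x)"
  by (rule strong_maximum_principle[OF r spectral_seqD(3)[OF S, of 0]])
    (use assms in \<open>auto simp: ground_def\<close>)

text \<open>The positive part of \<open>f\<close> is a combination of \<open>f\<close> and \<open>\<bar>f\<bar>\<close>, hence again in the eigenspace, and the
maximum principle leaves only the possibilities that it vanishes or that \<open>f > 0\<close>.\<close>

lemma ground_sign:
  assumes f: "ground f"
  shows "(AE x in lebesgue. f x = 0) \<or> (AE x in lebesgue. x \<in> \<Omega> \<longrightarrow> 0 < f x) \<or>
    (AE x in lebesgue. x \<in> \<Omega> \<longrightarrow> f x < 0)"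
proof -
  define g where "g = (1 / 2) *\<^sub>R ((\<lambda>x. \<bar>f x\<bar>) + f)"
  have g: "ground g" unfolding g_def by (intro ground_scale ground_add ground_abs f)
  have gx: "g x = (\<bar>f x\<bar> + f x) / 2" for x by (simp add: g_def)
  have "AE x in lebesgue. 0 \<le> g x" by (simp add: gx)
  from ground_nonneg_cases[OF g this] show ?thesis
  proof
    assume "AE x in lebesgue. x \<in> \<Omega> \<longrightarrow> 0 < g x"
    then have "AE x in lebesgue. x \<in> \<Omega> \<longrightarrow> 0 < f x" by eventually_elim (auto simp: gx)
    then show ?thesis by blast
  next
    assume "AE x in lebesgue. g x = 0"
    then have nn: "AE x in lebesgue. 0 \<le> ((-1) *\<^sub>R f) x" by eventually_elim (auto simp: gx)
    from ground_nonneg_cases[OF ground_scale[OF f] nn]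
    have "(AE x in lebesgue. f x = 0) \<or> (AE x in lebesgue. x \<in> \<Omega> \<longrightarrow> f x < 0)" by simp
    then show ?thesis by blast
  qed
qed

lemma ground_integral_zero:
  assumes f: "ground f" and int: "(\<integral>x. f x \<partial>lebesgue) = 0"
  shows "AE x in lebesgue. f x = 0"
proof -
  have fV: "f \<in> V" using f by (simp add: ground_def)
  note i = integrable_H0s[OF fV]
  from ground_sign[OF f] show ?thesis
  proof (elim disjE)
    assume "AE x in lebesgue. x \<in> \<Omega> \<longrightarrow> 0 < f x"
    then have "AE x in lebesgue. 0 \<le> f x"
      using H0s_D(5)[OF fV] by eventually_elim (metis less_imp_le order.refl)
    from integral_nonneg_eq_0_iff_AE[OF i this] int show ?thesis by blast
  next
    assume "AE x in lebesgue. x \<in> \<Omega> \<longrightarrow> f x < 0"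
    then have nn: "AE x in lebesgue. 0 \<le> - f x"
      using H0s_D(5)[OF fV] by eventually_elim (metis less_imp_le neg_0_le_iff_le order.refl)
    have "integrable lebesgue (\<lambda>x. - f x)" using i by simp
    from integral_nonneg_eq_0_iff_AE[OF this nn] int show ?thesis by simp
  qed
qed

lemma first_eigenvector_ground: "ground (e 0)"
  unfolding ground_def using spectral_seqD(1,4)[OF S] by blast

text \<open>The combination of \<open>f\<close> and \<open>g\<close> with vanishing integral is a null function, having a sign.\<close>

lemma ground_multiple:
  assumes f: "ground f" and g: "ground g" and ng: "B g g \<noteq> 0"
  shows "\<exists>t. AE x in lebesgue. f x = t * g x"
proof -
  have fV: "f \<in> V" and gV: "g \<in> V" using f g by (simp_all add: ground_def)
  have "(\<integral>x. g x \<partial>lebesgue) \<noteq> 0"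
    using ground_integral_zero[OF g] B_eq_0_iff[OF gV] ng by blast
  define t where "t = (\<integral>x. f x \<partial>lebesgue) / (\<integral>x. g x \<partial>lebesgue)"
  have h: "ground (f + (- t) *\<^sub>R g)" by (intro ground_add ground_scale f g)
  have "(\<integral>x. (f + (- t) *\<^sub>R g) x \<partial>lebesgue) = 0"
    using integrable_H0s[OF fV] integrable_H0s[OF gV] \<open>(\<integral>x. g x \<partial>lebesgue) \<noteq> 0\<close> by (simp add: t_def)
  from ground_integral_zero[OF h this] have "AE x in lebesgue. f x = t * g x" by eventually_elim simp
  then show ?thesis by blast
qed

lemma ground_simple: "\<mu> 1 < \<mu> 0"
proof (rule ccontr)
  assume "\<not> \<mu> 1 < \<mu> 0"
  then have eq: "\<mu> 1 = \<mu> 0" using spectral_seq_antimono[OF S, of 0 1] by simp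
  have "ground (e 1)" unfolding ground_def using spectral_seqD(1)[OF S, of 1] spectral_seqD(4)[OF S, of _ 1] eq by simp
  from ground_multiple[OF this first_eigenvector_ground] obtain t where t: "AE x in lebesgue. e 1 x = t * e 0 x"
    using spectral_seqD(2)[OF S, of 0 0] by auto
  have V0: "e 0 \<in> V" and V1: "e 1 \<in> V" by (rule spectral_seqD(1)[OF S])+
  have "B (e 1) (e 0) = B (t *\<^sub>R e 0) (e 0)" by (rule B_cong_AE[OF V1 V0]) (use t in auto)
  then have "t = 0" using spectral_seqD(2)[OF S, of 1 0] spectral_seqD(2)[OF S, of 0 0] V0 by (simp add: scale_left)
  then have "B (e 1) (e 1) = 0" using t B_eq_0_iff[OF V1] by simp
  then show False using spectral_seqD(2)[OF S, of 1 1] by simp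
qed

lemma positivfirst_eigenvector_ground_exists:
  "\<exists>u. ground u \<and> (AE x in lebesgue. x \<in> \<Omega> \<longrightarrow> 0 < u x) \<and> B u u = 1"
proof -
  have V0: "e 0 \<in> V" by (rule spectral_seqD(1)[OF S])
  have B0: "B (e 0) (e 0) = 1" using spectral_seqD(2)[OF S, of 0 0] by simp
  then have "\<not> (AE x in lebesgue. e 0 x = 0)" using B_eq_0_iff[OF V0] by simp
  then consider "AE x in lebesgue. x \<in> \<Omega> \<longrightarrow> 0 < e 0 x" | "AE x in lebesgue. x \<in> \<Omega> \<longrightarrow> e 0 x < 0"
    using ground_sign[OF first_eigenvector_ground] by blast
  then show ?thesis
  proof cases
    case 1
    then show ?thesis using first_eigenvector_ground B0 by blast
  next
    case 2
    then have "AE x in lebesgue. x \<in> \<Omega> \<longrightarrow> 0 < ((-1) *\<^sub>R e 0) x" by simp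
    moreover have "B ((-1) *\<^sub>R e 0) ((-1) *\<^sub>R e 0) = 1" using scale_scale[OF V0, of "-1"] B0 by simp
    ultimately show ?thesis using ground_scale[OF first_eigenvector_ground] by blast
  qed
qed

text \<open>\<open>u\<close> is a multiple of \<open>e 0\<close> up to a null function, so \<open>w\<close> competes in the second maximization.\<close>

lemma ground_gap:
  assumes u: "ground u" "B u u = 1" and w: "w \<in> V" "B w u = 0"
  shows "form r w w \<le> \<mu> 1 * B w w"
proof -
  have uV: "u \<in> V" using u by (simp add: ground_def)
  have V0: "e 0 \<in> V" by (rule spectral_seqD(1)[OF S])
  from ground_multiple[OF first_eigenvector_ground u(1)] obtain t where t: "AE x in lebesgue. e 0 x = t * u x" using u(2) by auto
  have "B (e 0) w = B (t *\<^sub>R u) w" by (rule B_cong_AE[OF V0 w(1)]) (use t in auto)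
  then have "B w (e 0) = 0" using w uV by (simp add: scale_left commute[OF w(1) V0] commute[OF uV w(1)])
  then show ?thesis by (intro spectral_seqD(5)[OF S w(1)]) simp
qed

text \<open>Split \<open>v = a u + w\<close> with \<open>w\<close> orthogonal to \<open>u\<close>. The gap gives \<open>(\<mu> 0 - \<mu> 1) B w w \<le> \<delta>\<close>. The
coefficient \<open>a\<close> is positive: otherwise \<open>w = v - a u \<ge> \<bar>a\<bar> u \<ge> 0\<close>, and the \<open>L\<^sup>2\<close> norm of \<open>w\<close> could not
be small. Since \<open>a\<^sup>2 = 1 - B w w\<close>, \<open>a\<close> is close to \<open>1\<close>.\<close>

lemma near_maximizer_close:
  assumes u: "ground u" "AE x in lebesgue. x \<in> \<Omega> \<longrightarrow> 0 < u x" "B u u = 1"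
  shows "\<exists>d>0. \<exists>K>0. \<forall>v \<delta>. v \<in> V \<and> (AE x in lebesgue. x \<in> \<Omega> \<longrightarrow> 0 < v x) \<and> B v v = 1 \<and>
     \<mu> 0 - \<delta> \<le> form r v v \<and> \<delta> < d \<longrightarrow> B (v - u) (v - u) \<le> K * \<delta>"
proof -
  have uV: "u \<in> V" using u by (simp add: ground_def)
  interpret Q: sym_form V "form r" by (rule sym_form_form[OF r])
  define gap where "gap = \<mu> 0 - \<mu> 1"
  have gap: "gap > 0" using ground_simple by (simp add: gap_def)
  define \<kappa> where "\<kappa> = (\<integral>x. (u x)\<^sup>2 \<partial>lebesgue)"
  have "\<kappa> \<noteq> 0"
  proof
    assume "\<kappa> = 0"
    then have "AE x in lebesgue. (u x)\<^sup>2 = 0"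
      using integral_nonneg_eq_0_iff_AE[OF H0s_D(2)[OF uV]] unfolding \<kappa>_def by simp
    then have "AE x in lebesgue. u x = 0" by eventually_elim simp
    then show False using B_eq_0_iff[OF uV] u(3) by simp
  qed
  moreover have "0 \<le> \<kappa>" unfolding \<kappa>_def by (intro integral_nonneg_AE) simp
  ultimately have \<kappa>: "\<kappa> > 0" by simp
  define Cp where "Cp = Poincare_const"
  have Cp: "Cp > 0" by (simp add: Cp_def Poincare_const_pos)
  \<comment> \<open>If \<open>a \<le> 0\<close>, then \<open>(1 - B w w) \<kappa> = a\<^sup>2 \<kappa> \<le> Cp * B w w\<close>,
    which contradicts \<open>B w w \<le> \<delta> / gap\<close>
    below this threshold.\<close>
  define d where "d = gap * \<kappa> / (\<kappa> + Cp)"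
  have d: "d > 0" using gap \<kappa> Cp by (simp add: d_def)
  have "B (v - u) (v - u) \<le> 2 / gap * \<delta>"
    if v: "v \<in> V" "AE x in lebesgue. x \<in> \<Omega> \<longrightarrow> 0 < v x" "B v v = 1"
      and Qv: "\<mu> 0 - \<delta> \<le> form r v v" and \<delta>: "\<delta> < d" for v \<delta>
  proof -
    define a where "a = B v u"
    define w where "w = v - a *\<^sub>R u"
    have wV: "w \<in> V" unfolding w_def by (intro mem v uV)
    have au: "a *\<^sub>R u \<in> V" by (rule mem_scale[OF uV])
    have wu: "B w u = 0" unfolding w_def using v(1) uV au u(3) by (simp add: diff_left scale_left a_def)
    have vw: "v = a *\<^sub>R u + w" by (simp add: w_def)
    define \<beta> where "\<beta> = B w w"
    have Bv: "1 = a\<^sup>2 + \<beta>"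
    proof -
      have "B v v = B (a *\<^sub>R u) (a *\<^sub>R u) + 2 * B (a *\<^sub>R u) w + B w w"
        using add_add[OF au wV] by (simp only: vw[symmetric])
      then show ?thesis using v(3) u(3) uV wV wu by (simp add: scale_scale scale_left commute[OF uV wV] \<beta>_def)
    qed
    have Qv_eq: "form r v v = a\<^sup>2 * \<mu> 0 + form r w w"
    proof -
      have "form r v v = form r (a *\<^sub>R u) (a *\<^sub>R u) + 2 * form r (a *\<^sub>R u) w + form r w w"
        using Q.add_add[OF au wV] by (simp only: vw[symmetric])
      moreover have "form r u w = 0" "form r u u = \<mu> 0"
        using u(1) uV wV wu u(3) commute[OF uV wV] by (simp_all add: ground_def)
      ultimately show ?thesis using uV wV by (simp add: Q.scale_scale Q.scale_left)
    qed
    have "form r w w \<le> \<mu> 1 * \<beta>" unfolding \<beta>_def by (rule ground_gap[OF u(1,3) wV wu])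
    then have "\<mu> 0 - \<delta> \<le> a\<^sup>2 * \<mu> 0 + \<mu> 1 * \<beta>" using Qv Qv_eq by linarith
    moreover have a2: "a\<^sup>2 = 1 - \<beta>" using Bv by simp
    ultimately have gb: "gap * \<beta> \<le> \<delta>" by (simp add: gap_def algebra_simps)
    have \<beta>0: "0 \<le> \<beta>" unfolding \<beta>_def by (rule nonneg[OF wV])
    have "a > 0"
    proof (rule ccontr)
      assume "\<not> a > 0"
      then have a: "a \<le> 0" by simp
      have "(\<integral>x. a\<^sup>2 * (u x)\<^sup>2 \<partial>lebesgue) \<le> (\<integral>x. (w x)\<^sup>2 \<partial>lebesgue)"
      proof (rule integral_mono_AE)
        show "AE x in lebesgue. a\<^sup>2 * (u x)\<^sup>2 \<le> (w x)\<^sup>2"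
          using u(2) v(2) H0s_D(5)[OF uV] H0s_D(5)[OF v(1)]
        proof eventually_elim
          case (elim x)
          show ?case
          proof (cases "x \<in> \<Omega>")
            case True
            then have "0 \<le> (- a) * u x" "(- a) * u x \<le> w x" using elim a by (simp_all add: w_def mult_nonpos_nonneg)
            then have "((- a) * u x)\<^sup>2 \<le> (w x)\<^sup>2" by (intro power_mono)
            then show ?thesis by (simp add: power_mult_distrib)
          next
            case False
            then show ?thesis using elim by (simp add: w_def)
          qed
        qed
      qed (use H0s_D(2)[OF uV] H0s_D(2)[OF wV] in auto)
      also have "\<dots> \<le> Cp * \<beta>" unfolding Cp_def \<beta>_def by (rule Poincare_ineq[OF wV])
      finally have "(1 - \<beta>) * \<kappa> \<le> Cp * \<beta>" by (simp add: \<kappa>_def a2)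
      then have "\<kappa> \<le> (\<kappa> + Cp) * \<beta>" by (simp add: algebra_simps)
      then have "gap * \<kappa> \<le> gap * ((\<kappa> + Cp) * \<beta>)" using gap by simp
      also have "\<dots> \<le> (\<kappa> + Cp) * \<delta>" using mult_left_mono[OF gb, of "\<kappa> + Cp"] \<kappa> Cp by (simp add: mult_ac)
      also have "\<dots> < (\<kappa> + Cp) * d" using \<delta> \<kappa> Cp by simp
      also have "\<dots> = gap * \<kappa>" using \<kappa> Cp by (simp add: d_def)
      finally show False by simp
    qed
    have "a \<le> 1"
    proof (rule ccontr)
      assume "\<not> a \<le> 1"
      then have "1 * 1 < a * a" by (intro mult_strict_mono) auto
      then show False using Bv \<beta>0 by (simp add: power2_eq_square)
    qed
    have vu: "v - u = (a - 1) *\<^sub>R u + w" by (simp add: w_def scaleR_left_diff_distrib)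
    have "B (v - u) (v - u) = (a - 1)\<^sup>2 + \<beta>"
    proof -
      have a1: "(a - 1) *\<^sub>R u \<in> V" by (rule mem_scale[OF uV])
      show ?thesis unfolding vu
        using add_add[OF a1 wV] u(3) uV wV wu by (simp add: scale_scale scale_left commute[OF uV wV] \<beta>_def)
    qed
    also have "(a - 1)\<^sup>2 \<le> 1 - a\<^sup>2"
    proof -
      have "0 \<le> 2 * a * (1 - a)" using \<open>a > 0\<close> \<open>a \<le> 1\<close> by simp
      then show ?thesis by (simp add: power2_eq_square algebra_simps)
    qed
    also have "1 - a\<^sup>2 + \<beta> = 2 * \<beta>" using Bv by simp
    also have "\<dots> \<le> 2 / gap * \<delta>" using gb gap by (simp add: field_simps)
    finally show ?thesis by simp
  qed
  then show ?thesis using d gap by (intro exI[of _ d] exI[of _ "2 / gap"] conjI) auto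
qed

end

lemma u_pos_spec:
  assumes \<rho>: "bounded_weight (weight \<rho>) C" and S: "spectral_seq (form (weight \<rho>)) e \<mu>"
  shows "ground (weight \<rho>) \<mu> (u_pos s \<Omega> \<rho>)" "AE x in lebesgue. x \<in> \<Omega> \<longrightarrow> 0 < u_pos s \<Omega> \<rho> x"
    "B (u_pos s \<Omega> \<rho>) (u_pos s \<Omega> \<rho>) = 1"
proof -
  have mu1: "mu s \<Omega> \<rho> 1 = \<mu> 0" using mu_eq_spectral_seq[OF \<rho> S, of 0] by simp
  have AE_iff: "(AE x in lebesgue_on \<Omega>. 0 < u x) \<longleftrightarrow> (AE x in lebesgue. x \<in> \<Omega> \<longrightarrow> 0 < u x)" for u :: "'a \<Rightarrow> real"
    by (rule AE_restrict_space_iff) simp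
  have eig: "u \<in> G_eigenspace s \<Omega> \<rho> (mu s \<Omega> \<rho> 1) \<longleftrightarrow> ground (weight \<rho>) \<mu> u" for u
    unfolding mu1 G_eigenspace_iff[OF \<rho>] ground_def[OF \<rho> S] ..
  have norm: "H0s_norm s u = 1 \<longleftrightarrow> B u u = 1" for u :: "'a \<Rightarrow> real" by (simp add: H0s_norm_def)
  have "\<exists>u. u \<in> G_eigenspace s \<Omega> \<rho> (mu s \<Omega> \<rho> 1) \<and> (AE x in lebesgue_on \<Omega>. 0 < u x) \<and> H0s_norm s u = 1"
    unfolding eig AE_iff norm by (rule positivfirst_eigenvector_ground_exists[OF \<rho> S])
  then have "u_pos s \<Omega> \<rho> \<in> G_eigenspace s \<Omega> \<rho> (mu s \<Omega> \<rho> 1) \<and>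
      (AE x in lebesgue_on \<Omega>. 0 < u_pos s \<Omega> \<rho> x) \<and> H0s_norm s (u_pos s \<Omega> \<rho>) = 1"
    unfolding u_pos_def by (rule someI_ex)
  then show "ground (weight \<rho>) \<mu> (u_pos s \<Omega> \<rho>)" "AE x in lebesgue. x \<in> \<Omega> \<longrightarrow> 0 < u_pos s \<Omega> \<rho> x"
    "B (u_pos s \<Omega> \<rho>) (u_pos s \<Omega> \<rho>) = 1"
    unfolding eig AE_iff norm by blast+
qed


section \<open>Weak* convergence\<close>

text \<open>Weakly* convergent sequences are bounded in \<open>L\<^sup>\<infinity>\<close>, and testing with indicators of sets of finite
measure shows that \<open>form_uniformly_small\<close> applies to the differences of the weights.\<close>

lemma weakstar_form_converges:
  assumes W: "weakstar_converges \<Omega> \<rho>s \<rho>" and \<epsilon>: "0 < \<epsilon>"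
  shows "\<exists>N. \<forall>n\<ge>N. \<forall>f\<in>V. \<bar>form (weight (\<rho>s n)) f f - form (weight \<rho>) f f\<bar> \<le> \<epsilon> * B f f"
proof -
  have L: "\<rho>s n \<in> Linf \<Omega>" "\<rho> \<in> Linf \<Omega>" for n using W by (simp_all add: weakstar_converges_def)
  have lim: "(\<lambda>n. LINT x|lebesgue_on \<Omega>. \<rho>s n x * g x) \<longlonglongrightarrow> (LINT x|lebesgue_on \<Omega>. \<rho> x * g x)"
    if "integrable (lebesgue_on \<Omega>) g" for g using W that by (simp add: weakstar_converges_def)
  have fm: "finite_measure (lebesgue_on \<Omega>)"
  proof (rule finite_measureI)
    have "emeasure (lebesgue_on \<Omega>) (space (lebesgue_on \<Omega>)) = emeasure lebesgue \<Omega>"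
      by (simp add: emeasure_restrict_space del: emeasure_completion)
    then show "emeasure (lebesgue_on \<Omega>) (space (lebesgue_on \<Omega>)) \<noteq> \<infinity>"
      using emeasure_\<Omega>_finite by (simp add: less_top del: emeasure_completion)
  qed
  have "\<exists>K. \<forall>n. AE x in lebesgue_on \<Omega>. \<bar>\<rho>s n x\<bar> \<le> K"
  proof (rule uniform_boundedness_Linf[OF fm])
    show "\<rho>s n \<in> borel_measurable (lebesgue_on \<Omega>)" "\<exists>D. AE x in lebesgue_on \<Omega>. \<bar>\<rho>s n x\<bar> \<le> D" for n
      using L(1)[of n] by (simp_all add: Linf_def)
    fix g :: "'a \<Rightarrow> real" assume "integrable (lebesgue_on \<Omega>) g"
    from convergent_imp_Bseq[OF convergentI[OF lim[OF this]]]
    show "\<exists>K. \<forall>n. \<bar>LINT x|lebesgue_on \<Omega>. \<rho>s n x * g x\<bar> \<le> K" by (auto simp: Bseq_def)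
  qed
  then obtain K where K: "\<And>n. AE x in lebesgue_on \<Omega>. \<bar>\<rho>s n x\<bar> \<le> K" by blast
  have bw: "bounded_weight (weight (\<rho>s n)) (max 0 K)" for n
  proof -
    have "AE x in lebesgue. x \<in> \<Omega> \<longrightarrow> \<bar>\<rho>s n x\<bar> \<le> K" using K[of n] by (subst (asm) AE_restrict_space_iff) auto
    then have "AE x in lebesgue. \<bar>weight (\<rho>s n) x\<bar> \<le> max 0 K"
      by eventually_elim (auto simp: weight_def indicator_def)
    moreover have "weight (\<rho>s n) \<in> borel_measurable lebesgue"
      using L(1)[of n] by (auto simp: Linf_def intro: weight_measurable)
    ultimately show ?thesis by (simp add: bounded_weight_def)
  qed
  obtain C where C: "bounded_weight (weight \<rho>) C" using Linf_bounded_weight[OF L(2)] by blast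
  define r where "r n x = weight (\<rho>s n) x - weight \<rho> x" for n x
  have br: "bounded_weight (r n) (max 0 K + C)" for n
  proof -
    have "AE x in lebesgue. \<bar>weight (\<rho>s n) x\<bar> \<le> max 0 K" "AE x in lebesgue. \<bar>weight \<rho> x\<bar> \<le> C"
      using bw[of n] C by (simp_all add: bounded_weight_def)
    then have "AE x in lebesgue. \<bar>r n x\<bar> \<le> max 0 K + C"
    proof eventually_elim
      case (elim x)
      then show ?case unfolding r_def by linarith
    qed
    moreover have "r n \<in> borel_measurable lebesgue"
      using bw[of n] C unfolding r_def[abs_def] bounded_weight_def by (intro borel_measurable_diff) blast+
    ultimately show ?thesis using C by (simp add: bounded_weight_def)
  qed
  have small: "(\<lambda>n. \<integral>x. r n x * indicator A x \<partial>lebesgue) \<longlonglongrightarrow> 0"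
    if A: "A \<in> sets lebesgue" "emeasure lebesgue A < \<infinity>" for A
  proof -
    have iA: "integrable lebesgue (indicator A :: 'a \<Rightarrow> real)"
      by (rule integrable_real_indicator[OF A])
    have ind: "(indicator A x :: real)\<^sup>2 = indicator A x" "indicator A x * indicator A x = (indicator A x :: real)" for x
      by (simp_all add: indicator_def)
    have Am: "(indicator A :: 'a \<Rightarrow> real) \<in> borel_measurable lebesgue" using A(1) by simp
    have int: "integrable lebesgue (\<lambda>x. q x * indicator A x)" if "bounded_weight q D" for q D
      using integrable_weight_mult[OF that Am _ Am] iA by (simp add: ind)
    have "integrable (lebesgue_on \<Omega>) (indicator A :: 'a \<Rightarrow> real)"
      by (rule finite_measure.integrable_const_bound[OF fm, where B = 1])
        (use A(1) in \<open>auto simp: borel_measurable_restrict_space_iff\<close>)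
    from lim[OF this] have "(\<lambda>n. \<integral>x. weight (\<rho>s n) x * indicator A x \<partial>lebesgue) \<longlonglongrightarrow>
        (\<integral>x. weight \<rho> x * indicator A x \<partial>lebesgue)"
      by (simp only: integral_lebesgue_on_eq)
    from tendsto_diff[OF this tendsto_const[of "\<integral>x. weight \<rho> x * indicator A x \<partial>lebesgue"]]
    have "(\<lambda>n. (\<integral>x. weight (\<rho>s n) x * indicator A x \<partial>lebesgue) - (\<integral>x. weight \<rho> x * indicator A x \<partial>lebesgue)) \<longlonglongrightarrow> 0"
      by simp
    moreover have "(\<integral>x. r n x * indicator A x \<partial>lebesgue) =
        (\<integral>x. weight (\<rho>s n) x * indicator A x \<partial>lebesgue) - (\<integral>x. weight \<rho> x * indicator A x \<partial>lebesgue)" for n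
      using int[OF bw[of n]] int[OF C] by (simp add: r_def left_diff_distrib)
    ultimately show ?thesis by simp
  qed
  have "form (r n) f f = form (weight (\<rho>s n)) f f - form (weight \<rho>) f f" if f: "f \<in> V" for n f
    using integrable_weight_mult[OF bw[of n] H0s_D(1,2)[OF f] H0s_D(1,2)[OF f]]
      integrable_weight_mult[OF C H0s_D(1,2)[OF f] H0s_D(1,2)[OF f]]
    by (simp add: form_def r_def left_diff_distrib)
  then show ?thesis using form_uniformly_small[OF br small \<epsilon>] by simp
qed

text \<open>The norm of \<open>h = G\<^sub>\<rho> f - G\<^bsub>\<rho>'\<^esub> f\<close> is the value of the difference of the forms at \<open>f\<close> and
\<open>h\<close> normalized, and polarization bounds this value by those on the diagonal.\<close>

lemma opnorm_diff_le:
  assumes \<rho>: "bounded_weight (weight \<rho>) C" and \<rho>': "bounded_weight (weight \<rho>') C'"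
    and \<epsilon>: "0 \<le> \<epsilon>"
    and le: "\<And>f. f \<in> V \<Longrightarrow> \<bar>form (weight \<rho>) f f - form (weight \<rho>') f f\<bar> \<le> \<epsilon> * B f f"
  shows "H0s_opnorm s \<Omega> (\<lambda>f x. G s \<Omega> \<rho> f x - G s \<Omega> \<rho>' f x) \<le> ennreal \<epsilon>"
  unfolding H0s_opnorm_def
proof (rule SUP_least)
  fix f assume "f \<in> {f \<in> V. H0s_norm s f \<le> 1}"
  then have f: "f \<in> V" and f1: "B f f \<le> 1" using nonneg[of f] by (simp_all add: H0s_norm_def)
  define D where "D g h = 1 * form (weight \<rho>) g h - form (weight \<rho>') g h" for g h
  interpret D: sym_form V D
    unfolding D_def[abs_def] by (rule sym_form_lin_comb[OF sym_form_form[OF \<rho>] sym_form_form[OF \<rho>']])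
  have Dle: "\<bar>D g g\<bar> \<le> \<epsilon> * B g g" if "g \<in> V" for g using le[OF that] by (simp add: D_def)
  define h where "h = G s \<Omega> \<rho> f - G s \<Omega> \<rho>' f"
  have hV: "h \<in> V" unfolding h_def by (intro mem G_solution(1)[OF \<rho> f] G_solution(1)[OF \<rho>' f])
  have Bh: "B h \<phi> = D f \<phi>" if "\<phi> \<in> V" for \<phi>
    unfolding h_def D_def using G_solution[OF \<rho> f] G_solution[OF \<rho>' f] that by (simp add: diff_left)
  have "sqrt (B h h) \<le> \<epsilon>"
  proof (cases "B h h = 0")
    case True
    then show ?thesis using \<epsilon> by simp
  next
    case False
    then have pos: "B h h > 0" using nonneg[OF hV] by simp
    define \<phi> where "\<phi> = (1 / sqrt (B h h)) *\<^sub>R h"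
    have \<phi>: "\<phi> \<in> V" "B \<phi> \<phi> = 1" unfolding \<phi>_def using hV pos by (simp_all add: mem scale_scale power_divide)
    have "B h \<phi> = sqrt (B h h)" unfolding \<phi>_def using hV pos by (simp add: scale_right real_div_sqrt)
    then have sq: "sqrt (B h h) = D f \<phi>" using Bh[OF \<phi>(1)] by simp
    have "4 * D f \<phi> = D (f + \<phi>) (f + \<phi>) - D (f - \<phi>) (f - \<phi>)"
      unfolding D.add_add[OF f \<phi>(1)] D.diff_diff[OF f \<phi>(1)] by simp
    also have "\<dots> \<le> \<epsilon> * B (f + \<phi>) (f + \<phi>) + \<epsilon> * B (f - \<phi>) (f - \<phi>)"
      using Dle[OF mem_add[OF f \<phi>(1)]] Dle[OF mem_diff[OF f \<phi>(1)]] by linarith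
    also have "\<dots> = \<epsilon> * (B (f + \<phi>) (f + \<phi>) + B (f - \<phi>) (f - \<phi>))" by (rule distrib_left[symmetric])
    also have "B (f + \<phi>) (f + \<phi>) + B (f - \<phi>) (f - \<phi>) = 2 * (B f f + B \<phi> \<phi>)"
      unfolding add_add[OF f \<phi>(1)] diff_diff[OF f \<phi>(1)] by simp
    also have "\<epsilon> * (2 * (B f f + B \<phi> \<phi>)) \<le> \<epsilon> * 4"
      using f1 \<phi>(2) \<epsilon> by (intro mult_left_mono) auto
    finally show ?thesis using sq by simp
  qed
  then have "H0s_norm s h \<le> \<epsilon>" by (simp add: H0s_norm_def)
  moreover have "(\<lambda>x. G s \<Omega> \<rho> f x - G s \<Omega> \<rho>' f x) = h" by (simp add: h_def fun_diff_def)
  ultimately show "ennreal (H0s_norm s (\<lambda>x. G s \<Omega> \<rho> f x - G s \<Omega> \<rho>' f x)) \<le> ennreal \<epsilon>"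
    by (simp add: ennreal_leI)
qed

theorem opnorm_converges:
  assumes W: "weakstar_converges \<Omega> \<rho>s \<rho>"
  shows "(\<lambda>n. H0s_opnorm s \<Omega> (\<lambda>f x. G s \<Omega> (\<rho>s n) f x - G s \<Omega> \<rho> f x)) \<longlonglongrightarrow> 0"
proof (rule order_tendstoI)
  fix a :: ennreal assume "0 < a"
  then obtain b where b: "0 < b" "b < a" using dense by blast
  then have "b < top" by (simp add: less_top[symmetric]) (metis b(2) not_less top_greatest)
  then obtain \<epsilon> where \<epsilon>: "b = ennreal \<epsilon>" "0 \<le> \<epsilon>" by (cases b) auto
  have "\<epsilon> > 0" using b(1) \<epsilon> by (simp add: ennreal_less_zero_iff)
  from weakstar_form_converges[OF W this] obtain N where
    N: "\<And>n f. n \<ge> N \<Longrightarrow> f \<in> V \<Longrightarrow> \<bar>form (weight (\<rho>s n)) f f - form (weight \<rho>) f f\<bar> \<le> \<epsilon> * B f f" by blast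
  have L: "\<rho>s n \<in> Linf \<Omega>" "\<rho> \<in> Linf \<Omega>" for n using W by (simp_all add: weakstar_converges_def)
  obtain C where C: "bounded_weight (weight \<rho>) C" using Linf_bounded_weight[OF L(2)] by blast
  have "H0s_opnorm s \<Omega> (\<lambda>f x. G s \<Omega> (\<rho>s n) f x - G s \<Omega> \<rho> f x) < a" if n: "n \<ge> N" for n
  proof -
    obtain D where D: "bounded_weight (weight (\<rho>s n)) D" using Linf_bounded_weight[OF L(1)] by blast
    have "H0s_opnorm s \<Omega> (\<lambda>f x. G s \<Omega> (\<rho>s n) f x - G s \<Omega> \<rho> f x) \<le> ennreal \<epsilon>"
      by (rule opnorm_diff_le[OF D C \<epsilon>(2) N[OF n]])
    then show ?thesis using b(2) \<epsilon>(1) by simp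
  qed
  then show "\<forall>\<^sub>F n in sequentially. H0s_opnorm s \<Omega> (\<lambda>f x. G s \<Omega> (\<rho>s n) f x - G s \<Omega> \<rho> f x) < a"
    by (auto simp: eventually_sequentially)
qed simp

theorem mu_tilde_converges:
  assumes W: "weakstar_converges \<Omega> \<rho>s \<rho>"
  shows "(\<lambda>n. mu_tilde s \<Omega> (\<rho>s n) (Suc k)) \<longlonglongrightarrow> mu_tilde s \<Omega> \<rho> (Suc k)"
proof (rule LIMSEQ_I)
  fix \<epsilon> :: real assume \<epsilon>: "0 < \<epsilon>"
  from weakstar_form_converges[OF W half_gt_zero[OF \<epsilon>]] obtain N where
    N: "\<And>n f. n \<ge> N \<Longrightarrow> f \<in> V \<Longrightarrow> \<bar>form (weight (\<rho>s n)) f f - form (weight \<rho>) f f\<bar> \<le> \<epsilon> / 2 * B f f" by blast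
  have L: "\<rho>s n \<in> Linf \<Omega>" "\<rho> \<in> Linf \<Omega>" for n using W by (simp_all add: weakstar_converges_def)
  have "norm (mu_tilde s \<Omega> (\<rho>s n) (Suc k) - mu_tilde s \<Omega> \<rho> (Suc k)) < \<epsilon>" if n: "n \<ge> N" for n
  proof -
    have "mu_tilde s \<Omega> (\<rho>s n) (Suc k) \<le> mu_tilde s \<Omega> \<rho> (Suc k) + \<epsilon> / 2"
    proof (rule mu_tilde_compare[OF L])
      show "form (weight (\<rho>s n)) f f \<le> form (weight \<rho>) f f + \<epsilon> / 2 * B f f" if "f \<in> V" for f
        using N[OF n that] by linarith
    qed (use \<epsilon> in simp)
    moreover have "mu_tilde s \<Omega> \<rho> (Suc k) \<le> mu_tilde s \<Omega> (\<rho>s n) (Suc k) + \<epsilon> / 2"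
    proof (rule mu_tilde_compare[OF L(2) L(1)])
      show "form (weight \<rho>) f f \<le> form (weight (\<rho>s n)) f f + \<epsilon> / 2 * B f f" if "f \<in> V" for f
        using N[OF n that] by linarith
    qed (use \<epsilon> in simp)
    ultimately show ?thesis using \<epsilon> by simp
  qed
  then show "\<exists>no. \<forall>n\<ge>no. norm (mu_tilde s \<Omega> (\<rho>s n) (Suc k) - mu_tilde s \<Omega> \<rho> (Suc k)) < \<epsilon>" by blast
qed

lemma u_tilde_pos_spec:
  assumes \<rho>: "\<rho> \<in> Linf \<Omega>" and pos: "0 < mu_tilde s \<Omega> \<rho> 1"
  obtains C e \<mu> where "bounded_weight (weight \<rho>) C" "spectral_seq (form (weight \<rho>)) e \<mu>"
    "mu_tilde s \<Omega> \<rho> 1 = \<mu> 0" "ground (weight \<rho>) \<mu> (u_tilde s \<Omega> \<rho>)"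
    "AE x in lebesgue. x \<in> \<Omega> \<longrightarrow> 0 < u_tilde s \<Omega> \<rho> x" "B (u_tilde s \<Omega> \<rho>) (u_tilde s \<Omega> \<rho>) = 1"
proof -
  have P: "emeasure lebesgue {x \<in> \<Omega>. 0 < \<rho> x} > 0" using pos by (simp add: mu_tilde_def split: if_splits)
  obtain C where C: "bounded_weight (weight \<rho>) C" using Linf_bounded_weight[OF \<rho>] by blast
  obtain e \<mu> where S: "spectral_seq (form (weight \<rho>)) e \<mu>"
    using spectral_seq_of_weight[OF C] P positive_part_null_iff[OF \<rho>] by blast
  have "mu_tilde s \<Omega> \<rho> 1 = \<mu> 0" using mu_eq_spectral_seq[OF C S, of 0] P by (simp add: mu_tilde_def)
  moreover have "u_tilde s \<Omega> \<rho> = u_pos s \<Omega> \<rho>" using P by (simp add: u_tilde_def)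
  ultimately show ?thesis using that[OF C S] u_pos_spec[OF C S] by simp
qed

text \<open>The eigenfunction for \<open>\<rho>s n\<close> satisfies \<open>form (weight \<eta>) v v \<ge> \<mu>' 0 - \<delta> \<ge> \<mu> 0 - 2 \<delta>\<close>, where \<open>\<mu>' 0\<close>
is its eigenvalue: it is a near-maximizer for \<open>\<eta>\<close>.\<close>

theorem u_tilde_converges:
  assumes W: "weakstar_converges \<Omega> \<rho>s \<eta>" and pos: "0 < mu_tilde s \<Omega> \<eta> 1"
  shows "(\<lambda>n. H0s_norm s (u_tilde s \<Omega> (\<rho>s n) - u_tilde s \<Omega> \<eta>)) \<longlonglongrightarrow> 0"
    and "\<forall>\<^sub>F n in sequentially. u_tilde s \<Omega> (\<rho>s n) \<in> V"
proof -
  have L: "\<rho>s n \<in> Linf \<Omega>" "\<eta> \<in> Linf \<Omega>" for n using W by (simp_all add: weakstar_converges_def)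
  let ?u = "u_tilde s \<Omega> \<eta>" and ?v = "\<lambda>n. u_tilde s \<Omega> (\<rho>s n)"
  obtain C e \<mu> where C: "bounded_weight (weight \<eta>) C" and S: "spectral_seq (form (weight \<eta>)) e \<mu>"
    and m: "mu_tilde s \<Omega> \<eta> 1 = \<mu> 0" and u: "ground (weight \<eta>) \<mu> ?u"
      "AE x in lebesgue. x \<in> \<Omega> \<longrightarrow> 0 < ?u x" "B ?u ?u = 1"
    by (rule u_tilde_pos_spec[OF L(2) pos])
  have uV: "?u \<in> V" using u(1) by (simp add: ground_def[OF C S])
  from near_maximizer_close[OF C S u] obtain d K where d: "d > 0" and K: "K > 0"
    and close: "\<And>v \<delta>. \<lbrakk>v \<in> V; AE x in lebesgue. x \<in> \<Omega> \<longrightarrow> 0 < v x; B v v = 1;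
      \<mu> 0 - \<delta> \<le> form (weight \<eta>) v v; \<delta> < d\<rbrakk> \<Longrightarrow> B (v - ?u) (v - ?u) \<le> K * \<delta>" by blast
  have mu_lim: "(\<lambda>n. mu_tilde s \<Omega> (\<rho>s n) 1) \<longlonglongrightarrow> mu_tilde s \<Omega> \<eta> 1"
    using mu_tilde_converges[OF W, of 0] by simp
  then have ev_pos: "\<forall>\<^sub>F n in sequentially. 0 < mu_tilde s \<Omega> (\<rho>s n) 1"
    using pos by (rule order_tendstoD(1))
  then show "\<forall>\<^sub>F n in sequentially. ?v n \<in> V"
  proof eventually_elim
    case (elim n)
    show ?case by (rule u_tilde_pos_spec[OF L(1) elim]) (simp add: ground_def)
  qed
  show "(\<lambda>n. H0s_norm s (?v n - ?u)) \<longlonglongrightarrow> 0"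
  proof (rule LIMSEQ_I)
    fix \<epsilon> :: real assume \<epsilon>: "0 < \<epsilon>"
    \<comment> \<open>The defect is \<open>2 * \<delta>\<close>: it has to stay below \<open>d\<close>, and the bound \<open>2 * K * \<delta>\<close> below \<open>\<epsilon>\<^sup>2\<close>.\<close>
    define \<delta> where "\<delta> = min (d / 3) (\<epsilon>\<^sup>2 / (3 * K))"
    have \<delta>: "0 < \<delta>" using d K \<epsilon> by (simp add: \<delta>_def)
    from weakstar_form_converges[OF W \<delta>] obtain N where
      N: "\<And>n f. n \<ge> N \<Longrightarrow> f \<in> V \<Longrightarrow> \<bar>form (weight (\<rho>s n)) f f - form (weight \<eta>) f f\<bar> \<le> \<delta> * B f f" by blast
    from LIMSEQ_D[OF mu_lim \<delta>] obtain N1 where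
      N1: "\<And>n. n \<ge> N1 \<Longrightarrow> norm (mu_tilde s \<Omega> (\<rho>s n) 1 - mu_tilde s \<Omega> \<eta> 1) < \<delta>" by blast
    obtain N2 where N2: "\<And>n. n \<ge> N2 \<Longrightarrow> 0 < mu_tilde s \<Omega> (\<rho>s n) 1"
      using ev_pos by (auto simp: eventually_sequentially)
    have "norm (H0s_norm s (?v n - ?u) - 0) < \<epsilon>" if n: "n \<ge> N + N1 + N2" for n
    proof -
      have n': "n \<ge> N" "n \<ge> N1" "n \<ge> N2" using n by linarith+
      obtain C' e' \<mu>' where C': "bounded_weight (weight (\<rho>s n)) C'"
        and S': "spectral_seq (form (weight (\<rho>s n))) e' \<mu>'"
        and m': "mu_tilde s \<Omega> (\<rho>s n) 1 = \<mu>' 0" and v: "ground (weight (\<rho>s n)) \<mu>' (?v n)"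
          "AE x in lebesgue. x \<in> \<Omega> \<longrightarrow> 0 < ?v n x" "B (?v n) (?v n) = 1"
        by (rule u_tilde_pos_spec[OF L(1) N2[OF n'(3)]])
      have vV: "?v n \<in> V" using v(1) by (simp add: ground_def[OF C' S'])
      have "form (weight (\<rho>s n)) (?v n) (?v n) = \<mu>' 0" using v(1,3) vV by (simp add: ground_def[OF C' S'])
      then have "\<mu>' 0 - \<delta> \<le> form (weight \<eta>) (?v n) (?v n)" using N[OF n'(1) vV] v(3) by simp
      moreover have "\<mu> 0 - \<delta> \<le> \<mu>' 0" using N1[OF n'(2)] m m' by simp
      ultimately have "\<mu> 0 - 2 * \<delta> \<le> form (weight \<eta>) (?v n) (?v n)" by linarith
      moreover have "2 * \<delta> < d" using d by (simp add: \<delta>_def min_def)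
      ultimately have "B (?v n - ?u) (?v n - ?u) \<le> K * (2 * \<delta>)" by (intro close vV v(2,3))
      also have "\<dots> \<le> K * (2 * (\<epsilon>\<^sup>2 / (3 * K)))" using K by (intro mult_left_mono) (auto simp: \<delta>_def)
      also have "\<dots> < \<epsilon>\<^sup>2" using K \<epsilon> by (simp add: field_simps)
      finally have "sqrt (B (?v n - ?u) (?v n - ?u)) < sqrt (\<epsilon>\<^sup>2)" by (rule real_sqrt_less_mono)
      then show ?thesis using \<epsilon> nonneg[OF mem_diff[OF vV uV]] by (simp add: H0s_norm_def)
    qed
    then show "\<exists>no. \<forall>n\<ge>no. norm (H0s_norm s (?v n - ?u) - 0) < \<epsilon>" by blast
  qed
qed

lemma H0s_norm_triangle:
  assumes "f \<in> V" "g \<in> V" shows "H0s_norm s (f + g) \<le> H0s_norm s f + H0s_norm s g"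
proof -
  have "B (f + g) (f + g) \<le> (H0s_norm s f + H0s_norm s g)\<^sup>2"
    using abs_le[OF assms] assms nonneg[OF assms(1)] nonneg[OF assms(2)]
    by (simp add: add_add H0s_norm_def power2_sum abs_le_iff)
  then have "sqrt (B (f + g) (f + g)) \<le> sqrt ((H0s_norm s f + H0s_norm s g)\<^sup>2)" by (rule real_sqrt_le_mono)
  then show ?thesis using nonneg[OF assms(1)] nonneg[OF assms(2)] by (simp add: H0s_norm_def)
qed

lemma H0s_norm_scale: "f \<in> V \<Longrightarrow> H0s_norm s (c *\<^sub>R f) = \<bar>c\<bar> * H0s_norm s f"
  by (simp add: H0s_norm_def scale_scale real_sqrt_mult)

text \<open>If the limit eigenvalue is positive, eigenvalues and eigenfunctions converge separately. If it is
\<open>0\<close>, the eigenfunctions need not converge, but the norm of the product is the eigenvalue, which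
tends to \<open>0\<close>.\<close>

theorem mu_u_tilde_converges:
  assumes W: "weakstar_converges \<Omega> \<rho>s \<rho>"
  shows "(\<lambda>n. H0s_norm s (mu_tilde s \<Omega> (\<rho>s n) 1 *\<^sub>R u_tilde s \<Omega> (\<rho>s n) - mu_tilde s \<Omega> \<rho> 1 *\<^sub>R u_tilde s \<Omega> \<rho>)) \<longlonglongrightarrow> 0"
proof -
  have L: "\<rho>s n \<in> Linf \<Omega>" "\<rho> \<in> Linf \<Omega>" for n using W by (simp_all add: weakstar_converges_def)
  let ?m = "mu_tilde s \<Omega> \<rho> 1" and ?u = "u_tilde s \<Omega> \<rho>"
  let ?mn = "\<lambda>n. mu_tilde s \<Omega> (\<rho>s n) 1" and ?un = "\<lambda>n. u_tilde s \<Omega> (\<rho>s n)"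
  have mu_lim: "?mn \<longlonglongrightarrow> ?m" using mu_tilde_converges[OF W, of 0] by simp
  have mn0: "0 \<le> ?mn n" for n using mu_tilde_nonneg[OF L(1)[of n], of 0] by simp
  have N0: "0 \<le> H0s_norm s f" if "f \<in> V" for f using nonneg[OF that] by (simp add: H0s_norm_def)
  show ?thesis
  proof (cases "0 < ?m")
    case True
    have uV: "?u \<in> V" and u1: "H0s_norm s ?u = 1"
      by (rule u_tilde_pos_spec[OF L(2) True], simp add: ground_def H0s_norm_def)+
    have up: "\<forall>\<^sub>F n in sequentially. H0s_norm s (?mn n *\<^sub>R ?un n - ?m *\<^sub>R ?u) \<le>
        ?mn n * H0s_norm s (?un n - ?u) + \<bar>?mn n - ?m\<bar>"
      using u_tilde_converges(2)[OF W True]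
    proof eventually_elim
      case (elim n)
      have "?mn n *\<^sub>R ?un n - ?m *\<^sub>R ?u = ?mn n *\<^sub>R (?un n - ?u) + (?mn n - ?m) *\<^sub>R ?u"
        by (simp add: scaleR_diff_right scaleR_left_diff_distrib)
      then have "H0s_norm s (?mn n *\<^sub>R ?un n - ?m *\<^sub>R ?u) \<le>
          H0s_norm s (?mn n *\<^sub>R (?un n - ?u)) + H0s_norm s ((?mn n - ?m) *\<^sub>R ?u)"
        using H0s_norm_triangle[OF mem_scale[OF mem_diff[OF elim uV]] mem_scale[OF uV]] by simp
      then show ?case using mn0[of n] by (simp add: H0s_norm_scale mem_diff[OF elim uV] uV u1)
    qed
    have low: "\<forall>\<^sub>F n in sequentially. 0 \<le> H0s_norm s (?mn n *\<^sub>R ?un n - ?m *\<^sub>R ?u)"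
      using u_tilde_converges(2)[OF W True]
    proof eventually_elim
      case (elim n)
      show ?case by (intro N0 mem_diff mem_scale elim uV)
    qed
    have "(\<lambda>n. ?mn n * H0s_norm s (?un n - ?u) + \<bar>?mn n - ?m\<bar>) \<longlonglongrightarrow> ?m * 0 + \<bar>?m - ?m\<bar>"
      by (intro tendsto_intros mu_lim u_tilde_converges(1)[OF W True])
    then have "(\<lambda>n. ?mn n * H0s_norm s (?un n - ?u) + \<bar>?mn n - ?m\<bar>) \<longlonglongrightarrow> 0" by simp
    from real_tendsto_sandwich[OF low up tendsto_const this] show ?thesis .
  next
    case False
    then have m0: "?m = 0" using mu_tilde_nonneg[OF L(2), of 0] by simp
    have eq: "H0s_norm s (?mn n *\<^sub>R ?un n - ?m *\<^sub>R ?u) = ?mn n" for n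
    proof (cases "0 < ?mn n")
      case True
      have uV: "?un n \<in> V" and u1: "H0s_norm s (?un n) = 1"
        by (rule u_tilde_pos_spec[OF L(1) True], simp add: ground_def H0s_norm_def)+
      show ?thesis unfolding m0 using True by (simp add: H0s_norm_scale uV u1)
    next
      case False
      then have z: "?mn n = 0" using mn0[of n] by simp
      have "B 0 0 = 0" by (rule zero_left[OF mem_zero])
      then show ?thesis unfolding m0 z by (simp add: H0s_norm_def)
    qed
    show ?thesis unfolding eq using mu_lim m0 by simp
  qed
qed

end

theorem theorem4p1:
  fixes s :: real and \<Omega> :: "(real ^ 'n) set"
  assumes "CARD('n) \<ge> 2"
    and "0 < s" and "s < 1"
    and "bounded_C2_domain \<Omega>"
  shows
    "(\<forall>\<rho>s \<rho>. weakstar_converges \<Omega> \<rho>s \<rho> \<longrightarrow>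
        (\<lambda>n. H0s_opnorm s \<Omega> (\<lambda>f x. G s \<Omega> (\<rho>s n) f x - G s \<Omega> \<rho> f x)) \<longlonglongrightarrow> 0) \<and>
     (\<forall>k\<ge>1. \<forall>\<rho>s \<rho>. weakstar_converges \<Omega> \<rho>s \<rho> \<longrightarrow>
        (\<lambda>n. mu_tilde s \<Omega> (\<rho>s n) k) \<longlonglongrightarrow> mu_tilde s \<Omega> \<rho> k) \<and>
     (\<forall>\<rho>s \<rho>. weakstar_converges \<Omega> \<rho>s \<rho> \<longrightarrow>
        (\<lambda>n. H0s_norm s (\<lambda>x. mu_tilde s \<Omega> (\<rho>s n) 1 * u_tilde s \<Omega> (\<rho>s n) x
                              - mu_tilde s \<Omega> \<rho> 1 * u_tilde s \<Omega> \<rho> x)) \<longlonglongrightarrow> 0) \<and>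
     (\<forall>\<rho>s \<eta>. weakstar_converges \<Omega> \<rho>s \<eta> \<and> 0 < mu_tilde s \<Omega> \<eta> 1 \<longrightarrow>
        (\<lambda>n. H0s_norm s (\<lambda>x. u_tilde s \<Omega> (\<rho>s n) x - u_tilde s \<Omega> \<eta> x)) \<longlonglongrightarrow> 0)"
proof -
  interpret fractional_setting s \<Omega>
    using assms by unfold_locales (auto simp: bounded_C2_domain_def)
  show ?thesis
  proof (intro conjI allI impI)
    fix \<rho>s \<rho> assume W: "weakstar_converges \<Omega> \<rho>s \<rho>"
    show "(\<lambda>n. H0s_opnorm s \<Omega> (\<lambda>f x. G s \<Omega> (\<rho>s n) f x - G s \<Omega> \<rho> f x)) \<longlonglongrightarrow> 0"
      by (rule opnorm_converges[OF W])
    show "(\<lambda>n. H0s_norm s (\<lambda>x. mu_tilde s \<Omega> (\<rho>s n) 1 * u_tilde s \<Omega> (\<rho>s n) x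
                              - mu_tilde s \<Omega> \<rho> 1 * u_tilde s \<Omega> \<rho> x)) \<longlonglongrightarrow> 0"
      using mu_u_tilde_converges[OF W] by (simp add: fun_diff_def scaleR_fun_def)
  next
    fix k :: nat and \<rho>s \<rho> assume k: "1 \<le> k" and W: "weakstar_converges \<Omega> \<rho>s \<rho>"
    from k obtain j where "k = Suc j" by (cases k) auto
    then show "(\<lambda>n. mu_tilde s \<Omega> (\<rho>s n) k) \<longlonglongrightarrow> mu_tilde s \<Omega> \<rho> k"
      using mu_tilde_converges[OF W, of j] by simp
  next
    fix \<rho>s \<eta> assume "weakstar_converges \<Omega> \<rho>s \<eta> \<and> 0 < mu_tilde s \<Omega> \<eta> 1"
    then show "(\<lambda>n. H0s_norm s (\<lambda>x. u_tilde s \<Omega> (\<rho>s n) x - u_tilde s \<Omega> \<eta> x)) \<longlonglongrightarrow> 0"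
      using u_tilde_converges(1)[of \<rho>s \<eta>] by (simp add: fun_diff_def)
  qed
qed

end
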